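(* Let $\mathcal{G}=(\mathcal{V},\mathcal{F},\mathcal{E})$ be a quantum factor graph with Hilbert spaces $\{\mathcal{H}_i\}_{i\in\mathcal{V}}$ and strictly positive definite local operators $\{\rho_a\}_{a\in\mathcal{F}}$. For strictly positive definite messages (density operators) $\{m_{i\to a},m_{a\to i}\}_{(i,a)\in\mathcal{E}}$, with $m_{i\to a},m_{a\to i}$ acting on $\mathcal{H}_i$, consider the conditions $$m_{i\to a}\propto\bigstar_{c\in\partial i\setminus a}m_{c\to i},\qquad m_{a\to i}\propto\operatorname{tr}_{\partial a\setminus i}\Big(\rho_a\star\bigotimes_{k\in\partial a}m_{k\to a}\Big)\star m_{i\to a}^{-1}\qquad\forall(i,a)\in\mathcal{E},\tag{1}$$ and, for $(\{\sigma_a\}_{a\in\mathcal{F}},\{\sigma_i\}_{i\in\mathcal{V}})$, the relations $$\sigma_a\propto\rho_a\star\bigstar_{i\in\partial a}m_{i\to a}\quad\forall a\in\mathcal{F},\qquad\sigma_i\propto\bigstar_{a\in\partial i}m_{a\to i}\quad\forall i\in\mathcal{V}.\tag{2}$$ Then $(\{\sigma_a\}_{a\in\mathcal{F}},\{\sigma_i\}_{i\in\mathcal{V}})\in\mathcal{L}(\mathcal{G})$ is an interior stationary point of the quantum Bethe free energy $F_{\mathsf B}$ if (2) holds for strictly positive definite messages $\{m_{i\to a},m_{a\to i}\}_{(i,a)\in\mathcal{E}}$ satisfying (1). Conversely, (1) holds for the messages $\{m_{i\to a},m_{a\to i}\}_{(i,a)\in\mathcal{E}}$ if the density operators $(\{\sigma_a\}_{a\in\mathcal{F}},\{\sigma_i\}_{i\in\mathcal{V}})$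 defined from these messages according to (2) form an interior stationary point of $F_{\mathsf B}$.
   Context: All Hilbert spaces are finite-dimensional. For positive definite operators $\rho,\sigma$ on the same space, $\rho\star\sigma=\exp(\log\rho+\log\sigma)$; this product is commutative and associative. Operators acting on different tensor products of spaces are first embedded into the smallest common tensor product by tensoring with identities; an empty $\star$-product is the identity. $\propto$ means equality up to a positive constant factor. A quantum factor graph is a finite bipartite graph $\mathcal{G}=(\mathcal{V},\mathcal{F},\mathcal{E}\subseteq\mathcal{V}\times\mathcal{F})$ with a Hilbert space $\mathcal{H}_i$ for each $i\in\mathcal{V}$ and a positive semidefinite operator $\rho_a$ on $\bigotimes_{i\in\partial a}\mathcal{H}_i$ for each $a\in\mathcal{F}$; $\partial a$, $\partial i$ denote sets of neighbors and $d_i=|\partial i|$. $\mathcal{L}(\mathcal{G})$ is the set of all families $(\{\sigma_a\}_{a\in\mathcal{F}},\{\sigma_i\}_{i\in\mathcal{V}})$ of density operators $\sigma_a$ on $\bigotimes_{i\in\partial a}\mathcal{H}_i$ and $\sigma_i$ on $\mathcal{H}_i$ such that $\operatorname{tr}_{\partial a\setminus i}\sigma_a=\sigma_i$ for all $(i,a)\in\mathcal{E}$, where $\operatorname{tr}_{\partial a\setminus i}$ is the partial trace over $\bigotimes_{k\in\partial a\setminus i}\mathcal{H}_k$. The quantum Bethe free energy on $\mathcal{L}(\mathcal{G})$ is $$F_{\mathsf B}=-\sum_{a\in\mathcal{F}}\operatorname{tr}(\sigma_a\log\rho_a)+\sum_{a\in\mathcal{F}}\operatorname{tr}(\sigma_a\log\sigma_a)-\sum_{i\in\mathcal{V}}(d_i-1)\operatorname{tr}(\sigma_i\log\sigma_i).$$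 An interior stationary point is a point of $\mathcal{L}(\mathcal{G})$ with all $\sigma_a,\sigma_i$ positive definite that is stationary for $F_{\mathsf B}$ under the constraints defining $\mathcal{L}(\mathcal{G})$ (i.e., at which the Lagrangian of the constrained problem, with multipliers for the trace-one constraints and for the constraints $\operatorname{tr}_{\partial a\setminus i}\sigma_a=\sigma_i$, is stationary for some choice of multipliers).
   Formalization: Converse is false as stated: (2) fixes only the star-product of the m_{a→i}. Proved instead: a stationary point has messages with (1),(2); given messages with (2), m_{i→a} stay and some new m_{a→i} give (1),(2); if one half of (1) holds for the given messages, all of (1) does. *)

theory Defs
  imports
    "HOL-Analysis.Analysis"
    "Jordan_Normal_Form.Schur_Decomposition"
    "Jordan_Normal_Form.Gauss_Jordan_Elimination"
begin

section \<open>Operators on finite-dimensional Hilbert spaces\<close>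

text \<open>A Hilbert space of dimension \<open>n\<close> is \<open>\<complex>\<^sup>n\<close> with its standard inner product; an operator on it is
  a complex \<open>n \<times> n\<close> matrix.\<close>

definition hermitian_op :: "nat \<Rightarrow> complex mat \<Rightarrow> bool" where
  "hermitian_op n A \<longleftrightarrow> A \<in> carrier_mat n n \<and> mat_adjoint A = A"

definition psd_op :: "nat \<Rightarrow> complex mat \<Rightarrow> bool" where
  "psd_op n A \<longleftrightarrow> hermitian_op n A \<and> (\<forall>v \<in> carrier_vec n. Re ((A *\<^sub>v v) \<bullet>c v) \<ge> 0)"

definition posdef_op :: "nat \<Rightarrow> complex mat \<Rightarrow> bool" where
  "posdef_op n A \<longleftrightarrow>
     hermitian_op n A \<and> (\<forall>v \<in> carrier_vec n. v \<noteq> 0\<^sub>v n \<longrightarrow> Re ((A *\<^sub>v v) \<bullet>c v) > 0)"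

definition tr :: "complex mat \<Rightarrow> complex" where
  "tr A = (\<Sum>k<dim_row A. A $$ (k, k))"

definition density_op :: "nat \<Rightarrow> complex mat \<Rightarrow> bool" where
  "density_op n A \<longleftrightarrow> psd_op n A \<and> tr A = 1"

definition unitary_op :: "nat \<Rightarrow> complex mat \<Rightarrow> bool" where
  "unitary_op n U \<longleftrightarrow> U \<in> carrier_mat n n \<and> U * mat_adjoint U = 1\<^sub>m n \<and> mat_adjoint U * U = 1\<^sub>m n"

text \<open>Functional calculus for Hermitian matrices: \<open>f (U diag(\<mu>) U\<^sup>*) = U diag(f \<circ> \<mu>) U\<^sup>*\<close>, which does not
  depend on the chosen diagonalization.\<close>

definition herm_fun :: "(real \<Rightarrow> real) \<Rightarrow> complex mat \<Rightarrow> complex mat" where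
  "herm_fun f A = (THE B. \<exists>U \<mu>. unitary_op (dim_row A) U \<and>
      A = U * mat_diag (dim_row A) (\<lambda>k. complex_of_real (\<mu> k)) * mat_adjoint U \<and>
      B = U * mat_diag (dim_row A) (\<lambda>k. complex_of_real (f (\<mu> k))) * mat_adjoint U)"

abbreviation mexp :: "complex mat \<Rightarrow> complex mat" where
  "mexp \<equiv> herm_fun exp"

text \<open>As \<open>ln 0 = 0\<close>, the term \<open>tr (\<sigma> * mlog \<sigma>)\<close> obeys the convention \<open>0 log 0 = 0\<close> for
  singular positive semidefinite \<open>\<sigma>\<close>.\<close>

abbreviation mlog :: "complex mat \<Rightarrow> complex mat" where
  "mlog \<equiv> herm_fun ln"

abbreviation minv :: "complex mat \<Rightarrow> complex mat" where
  "minv A \<equiv> the (mat_inverse A)"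

definition star :: "complex mat \<Rightarrow> complex mat \<Rightarrow> complex mat" (infixl "\<star>" 65) where
  "A \<star> B = mexp (mlog A + mlog B)"

text \<open>Iterated \<open>\<star>\<close>-product of operators on an \<open>n\<close>-dimensional space. For positive definite factors
  the order of the fold is immaterial.\<close>

definition big_star :: "nat \<Rightarrow> ('k \<Rightarrow> complex mat) \<Rightarrow> 'k set \<Rightarrow> complex mat" where
  "big_star n M K = Finite_Set.fold (\<lambda>k A. M k \<star> A) (1\<^sub>m n) K"

definition propto :: "complex mat \<Rightarrow> complex mat \<Rightarrow> bool" (infix "\<propto>\<^sub>+" 50) where
  "A \<propto>\<^sub>+ B \<longleftrightarrow> (\<exists>c::real. c > 0 \<and> A = complex_of_real c \<cdot>\<^sub>m B)"


section \<open>Tensor products\<close>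

text \<open>Let the space at \<open>i\<close> be \<open>\<complex>\<^bsup>d i\<^esup>\<close>. The product basis of the tensor product over \<open>S\<close> is
  indexed by the assignments \<open>x \<in> (\<Pi>\<^sub>E i\<in>S. {..<d i})\<close>; \<open>basis_cfg d S\<close> numbers them, in an arbitrary
  fixed order, by \<open>{..<tdim d S}\<close>.\<close>

definition tdim :: "('v \<Rightarrow> nat) \<Rightarrow> 'v set \<Rightarrow> nat" where
  "tdim d S = (\<Prod>i\<in>S. d i)"

definition basis_cfg :: "('v \<Rightarrow> nat) \<Rightarrow> 'v set \<Rightarrow> nat \<Rightarrow> ('v \<Rightarrow> nat)" where
  "basis_cfg d S = (SOME f. bij_betw f {..<tdim d S} (\<Pi>\<^sub>E i\<in>S. {..<d i}))"

definition tensor_op :: "('v \<Rightarrow> nat) \<Rightarrow> 'v set \<Rightarrow> ('v \<Rightarrow> complex mat) \<Rightarrow> complex mat" where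
  "tensor_op d S M = mat (tdim d S) (tdim d S)
     (\<lambda>(u, w). \<Prod>k\<in>S. M k $$ (basis_cfg d S u k, basis_cfg d S w k))"

definition embed_op :: "('v \<Rightarrow> nat) \<Rightarrow> 'v set \<Rightarrow> 'v \<Rightarrow> complex mat \<Rightarrow> complex mat" where
  "embed_op d S i A = tensor_op d S (\<lambda>k. if k = i then A else 1\<^sub>m (d k))"

text \<open>Partial trace over all tensor factors except the one at \<open>i \<in> S\<close>.\<close>

definition ptrace :: "('v \<Rightarrow> nat) \<Rightarrow> 'v set \<Rightarrow> 'v \<Rightarrow> complex mat \<Rightarrow> complex mat" where
  "ptrace d S i A = mat (d i) (d i) (\<lambda>(x, y).
     \<Sum>(u, w) \<in> {(u, w). u < tdim d S \<and> w < tdim d S \<and>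
         basis_cfg d S u i = x \<and> basis_cfg d S w i = y \<and>
         (\<forall>k \<in> S - {i}. basis_cfg d S u k = basis_cfg d S w k)}. A $$ (u, w))"


section \<open>Quantum factor graphs\<close>

record ('v, 'f) qfg =
  verts :: "'v set"
  factors :: "'f set"
  edges :: "('v \<times> 'f) set"
  hdim :: "'v \<Rightarrow> nat"
  pot :: "'f \<Rightarrow> complex mat"

definition nbf :: "('v, 'f) qfg \<Rightarrow> 'f \<Rightarrow> 'v set" where
  "nbf G a = {i. (i, a) \<in> edges G}"

definition nbv :: "('v, 'f) qfg \<Rightarrow> 'v \<Rightarrow> 'f set" where
  "nbv G i = {a. (i, a) \<in> edges G}"

definition fdim :: "('v, 'f) qfg \<Rightarrow> 'f \<Rightarrow> nat" where
  "fdim G a = tdim (hdim G) (nbf G a)"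

definition quantum_factor_graph :: "('v, 'f) qfg \<Rightarrow> bool" where
  "quantum_factor_graph G \<longleftrightarrow>
     finite (verts G) \<and> finite (factors G) \<and> edges G \<subseteq> verts G \<times> factors G \<and>
     (\<forall>i \<in> verts G. hdim G i \<ge> 1) \<and> (\<forall>a \<in> factors G. psd_op (fdim G a) (pot G a))"

definition density_family ::
    "('v, 'f) qfg \<Rightarrow> ('f \<Rightarrow> complex mat) \<Rightarrow> ('v \<Rightarrow> complex mat) \<Rightarrow> bool" where
  "density_family G \<sigma>F \<sigma>V \<longleftrightarrow>
     (\<forall>a \<in> factors G. density_op (fdim G a) (\<sigma>F a)) \<and>
     (\<forall>i \<in> verts G. density_op (hdim G i) (\<sigma>V i))"

definition local_consistent ::
    "('v, 'f) qfg \<Rightarrow> ('f \<Rightarrow> complex mat) \<Rightarrow> ('v \<Rightarrow> complex mat) \<Rightarrow> bool" where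
  "local_consistent G \<sigma>F \<sigma>V \<longleftrightarrow> density_family G \<sigma>F \<sigma>V \<and>
     (\<forall>(i, a) \<in> edges G. ptrace (hdim G) (nbf G a) i (\<sigma>F a) = \<sigma>V i)"


section \<open>Bethe free energy and its interior stationary points\<close>

definition bethe ::
    "('v, 'f) qfg \<Rightarrow> ('f \<Rightarrow> complex mat) \<Rightarrow> ('v \<Rightarrow> complex mat) \<Rightarrow> real" where
  "bethe G \<sigma>F \<sigma>V =
     - (\<Sum>a\<in>factors G. Re (tr (\<sigma>F a * mlog (pot G a))))
     + (\<Sum>a\<in>factors G. Re (tr (\<sigma>F a * mlog (\<sigma>F a))))
     - (\<Sum>i\<in>verts G. (real (card (nbv G i)) - 1) * Re (tr (\<sigma>V i * mlog (\<sigma>V i))))"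

text \<open>The multipliers are real numbers for the trace constraints and Hermitian operators, paired through
  the trace, for the operator-valued marginalization constraints.\<close>

definition lagrangian ::
    "('v, 'f) qfg \<Rightarrow> ('f \<Rightarrow> real) \<Rightarrow> ('v \<Rightarrow> real) \<Rightarrow> ('v \<Rightarrow> 'f \<Rightarrow> complex mat) \<Rightarrow>
     ('f \<Rightarrow> complex mat) \<Rightarrow> ('v \<Rightarrow> complex mat) \<Rightarrow> real" where
  "lagrangian G \<kappa> \<nu> \<Lambda> \<sigma>F \<sigma>V = bethe G \<sigma>F \<sigma>V
     + (\<Sum>a\<in>factors G. \<kappa> a * (Re (tr (\<sigma>F a)) - 1))
     + (\<Sum>i\<in>verts G. \<nu> i * (Re (tr (\<sigma>V i)) - 1))
     + (\<Sum>(i, a)\<in>edges G. Re (tr (\<Lambda> i a * (ptrace (hdim G) (nbf G a) i (\<sigma>F a) - \<sigma>V i))))"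

text \<open>Stationarity: all directional derivatives, in independent Hermitian directions for all
  the \<open>\<sigma>\<^sub>a\<close> and \<open>\<sigma>\<^sub>i\<close>, vanish.\<close>

definition lagrangian_stationary ::
    "('v, 'f) qfg \<Rightarrow> ('f \<Rightarrow> real) \<Rightarrow> ('v \<Rightarrow> real) \<Rightarrow> ('v \<Rightarrow> 'f \<Rightarrow> complex mat) \<Rightarrow>
     ('f \<Rightarrow> complex mat) \<Rightarrow> ('v \<Rightarrow> complex mat) \<Rightarrow> bool" where
  "lagrangian_stationary G \<kappa> \<nu> \<Lambda> \<sigma>F \<sigma>V \<longleftrightarrow>
     (\<forall>X Y. (\<forall>a \<in> factors G. hermitian_op (fdim G a) (X a)) \<longrightarrow>
            (\<forall>i \<in> verts G. hermitian_op (hdim G i) (Y i)) \<longrightarrow>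
        ((\<lambda>t::real. lagrangian G \<kappa> \<nu> \<Lambda>
             (\<lambda>a. \<sigma>F a + complex_of_real t \<cdot>\<^sub>m X a)
             (\<lambda>i. \<sigma>V i + complex_of_real t \<cdot>\<^sub>m Y i)) has_real_derivative 0) (at 0))"

definition interior_stationary ::
    "('v, 'f) qfg \<Rightarrow> ('f \<Rightarrow> complex mat) \<Rightarrow> ('v \<Rightarrow> complex mat) \<Rightarrow> bool" where
  "interior_stationary G \<sigma>F \<sigma>V \<longleftrightarrow>
     local_consistent G \<sigma>F \<sigma>V \<and>
     (\<forall>a \<in> factors G. posdef_op (fdim G a) (\<sigma>F a)) \<and>
     (\<forall>i \<in> verts G. posdef_op (hdim G i) (\<sigma>V i)) \<and>
     (\<exists>\<kappa> \<nu> \<Lambda>. (\<forall>(i, a) \<in> edges G. hermitian_op (hdim G i) (\<Lambda> i a)) \<and>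
        lagrangian_stationary G \<kappa> \<nu> \<Lambda> \<sigma>F \<sigma>V)"


section \<open>Belief propagation\<close>

text \<open>Messages: \<open>mVF i a\<close> is \<open>m\<^bsub>i\<rightarrow>a\<^esub>\<close> and \<open>mFV a i\<close> is \<open>m\<^bsub>a\<rightarrow>i\<^esub>\<close>.\<close>

definition messages ::
    "('v, 'f) qfg \<Rightarrow> ('v \<Rightarrow> 'f \<Rightarrow> complex mat) \<Rightarrow> ('f \<Rightarrow> 'v \<Rightarrow> complex mat) \<Rightarrow> bool" where
  "messages G mVF mFV \<longleftrightarrow> (\<forall>(i, a) \<in> edges G.
     density_op (hdim G i) (mVF i a) \<and> posdef_op (hdim G i) (mVF i a) \<and>
     density_op (hdim G i) (mFV a i) \<and> posdef_op (hdim G i) (mFV a i))"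

definition bp_var_to_factor ::
    "('v, 'f) qfg \<Rightarrow> ('v \<Rightarrow> 'f \<Rightarrow> complex mat) \<Rightarrow> ('f \<Rightarrow> 'v \<Rightarrow> complex mat) \<Rightarrow> bool" where
  "bp_var_to_factor G mVF mFV \<longleftrightarrow> (\<forall>(i, a) \<in> edges G.
     mVF i a \<propto>\<^sub>+ big_star (hdim G i) (\<lambda>c. mFV c i) (nbv G i - {a}))"

definition bp_factor_to_var ::
    "('v, 'f) qfg \<Rightarrow> ('v \<Rightarrow> 'f \<Rightarrow> complex mat) \<Rightarrow> ('f \<Rightarrow> 'v \<Rightarrow> complex mat) \<Rightarrow> bool" where
  "bp_factor_to_var G mVF mFV \<longleftrightarrow> (\<forall>(i, a) \<in> edges G.
     mFV a i \<propto>\<^sub>+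
       ptrace (hdim G) (nbf G a) i (pot G a \<star> tensor_op (hdim G) (nbf G a) (\<lambda>k. mVF k a))
         \<star> minv (mVF i a))"

definition bp_fixed_point ::
    "('v, 'f) qfg \<Rightarrow> ('v \<Rightarrow> 'f \<Rightarrow> complex mat) \<Rightarrow> ('f \<Rightarrow> 'v \<Rightarrow> complex mat) \<Rightarrow> bool" where
  "bp_fixed_point G mVF mFV \<longleftrightarrow> bp_var_to_factor G mVF mFV \<and> bp_factor_to_var G mVF mFV"

text \<open>The beliefs determine the \<open>mVF i a\<close> up to scalars, but they depend on the \<open>mFV a i\<close> only through
  the \<open>\<star>\<close>-product over \<open>nbv G i\<close>: replacing \<open>mFV a i\<close> and \<open>mFV b i\<close>, \<open>a \<noteq> b\<close>, by \<open>mFV a i \<star> x\<close> and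
  \<open>mFV b i \<star> minv x\<close> (rescaled to trace one) does not affect \<open>bp_beliefs\<close>, while it does in general
  destroy \<open>bp_fixed_point\<close>. A statement recovering the fixed point equations from the beliefs has to
  account for this freedom.\<close>

definition bp_beliefs ::
    "('v, 'f) qfg \<Rightarrow> ('v \<Rightarrow> 'f \<Rightarrow> complex mat) \<Rightarrow> ('f \<Rightarrow> 'v \<Rightarrow> complex mat) \<Rightarrow>
     ('f \<Rightarrow> complex mat) \<Rightarrow> ('v \<Rightarrow> complex mat) \<Rightarrow> bool" where
  "bp_beliefs G mVF mFV \<sigma>F \<sigma>V \<longleftrightarrow>
     (\<forall>a \<in> factors G. \<sigma>F a \<propto>\<^sub>+
        pot G a \<star> big_star (fdim G a) (\<lambda>i. embed_op (hdim G) (nbf G a) i (mVF i a)) (nbf G a)) \<and>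
     (\<forall>i \<in> verts G. \<sigma>V i \<propto>\<^sub>+ big_star (hdim G i) (\<lambda>a. mFV a i) (nbv G i))"

end

(*
  On the logarithmic level all conditions become linear modulo real multiples of the identity. With
  P = log m_{i->a}, Q = log m_{a->i}, S = log sigma_i, the two message updates at an edge both say
  Q = S - P as soon as the marginal of sigma_a is sigma_i, and the stationarity equations of the
  Lagrangian say that minus the multipliers of the marginalization constraints are the P. The
  multipliers are unique modulo the identity because local operators on different tensor factors are
  linearly independent modulo scalars.

  The one analytic input is the gradient of tr(A log A). Since
  0 <= a log a - a log b - a + b <= (a - b)^2 / b for numbers, the relative entropy of A = B + tX with
  respect to B lies between 0 and O(t^2), so the derivative at t = 0 is read off directly and no
  differentiability or continuity of the matrix logarithm is needed.
*)
theory Submission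
  imports Defs
begin

section \<open>Spectral theorem for Hermitian matrices\<close>

text \<open>The factor \<open>d_i - 1\<close> in the free energy is what matches stationarity with
  message passing. Modulo the identity, the belief at \<open>i\<close> says
  \<open>S = sum Q_a\<close>; inserting \<open>Q_a = S - P_a\<close> for the \<open>d_i\<close>
  neighbours gives \<open>(d_i - 1) S = sum P_a\<close>, the stationarity equation for
  \<open>sigma_i\<close>.

  The obstacle is the converse. Beliefs determine each \<open>P_a\<close>, but only the sum of the
  \<open>Q_a\<close>. Already for \<open>d_i = 2\<close> the first update demands
  \<open>P_1 = Q_2\<close>, and replacing \<open>Q_1, Q_2\<close> by \<open>Q_1 + x, Q_2 - x\<close>
  destroys this without changing a belief. Hence the messages from factors to variables are rebuilt
  from \<open>Q_a = S - P_a\<close> with the given \<open>P_a\<close> kept, and the equations are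
  claimed for the original messages only when one of the two updates is already known.

  Operators to be compared need not commute. Inequalities between numbers are transferred to them
  through the doubly stochastic matrix of squared scalar products of two eigenbases, and positivity
  of a perturbed or partially traced operator is read off by writing an eigenvalue as a trace
  against its spectral projection.\<close>

lemma index_mult_mat_sum:
  assumes "A \<in> carrier_mat n m" "B \<in> carrier_mat m p" "i < n" "j < p"
  shows "(A * B) $$ (i, j) = (\<Sum>k<m. A $$ (i, k) * B $$ (k, j))"
  using assms by (auto simp: scalar_prod_def atLeast0LessThan intro!: sum.cong)

lemma index_mult_mat_vec_sum:
  assumes "A \<in> carrier_mat n m" "v \<in> carrier_vec m" "i < n"
  shows "(A *\<^sub>v v) $ i = (\<Sum>k<m. A $$ (i, k) * v $ k)"
  using assms by (auto simp: scalar_prod_def atLeast0LessThan intro!: sum.cong)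

lemma mat_adjoint_index [simp]:
  assumes "i < dim_col A" "j < dim_row A"
  shows "mat_adjoint (A :: complex mat) $$ (i, j) = cnj (A $$ (j, i))"
  using assms unfolding mat_adjoint_def by (simp add: mat_of_rows_index)

lemma mat_adjoint_dim [simp]:
  "dim_row (mat_adjoint A) = dim_col A" "dim_col (mat_adjoint A) = dim_row A"
  unfolding mat_adjoint_def by auto

lemma mat_adjoint_carrier [simp]:
  "A \<in> carrier_mat n m \<Longrightarrow> mat_adjoint A \<in> carrier_mat m n"
  by auto

lemma mat_adjoint_adjoint [simp]: "mat_adjoint (mat_adjoint (A :: complex mat)) = A"
  by (rule eq_matI) auto

lemma mat_adjoint_mult:
  fixes A B :: "complex mat"
  assumes "A \<in> carrier_mat n m" "B \<in> carrier_mat m p"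
  shows "mat_adjoint (A * B) = mat_adjoint B * mat_adjoint A"
proof (rule eq_matI)
  fix i j assume "i < dim_row (mat_adjoint B * mat_adjoint A)" "j < dim_col (mat_adjoint B * mat_adjoint A)"
  then have ij: "i < p" "j < n" using assms by auto
  have "mat_adjoint (A * B) $$ (i, j) = cnj (\<Sum>k<m. A $$ (j, k) * B $$ (k, i))"
    using ij assms by (simp add: index_mult_mat_sum[OF assms] del: index_mult_mat(1))
  also have "\<dots> = (\<Sum>k<m. mat_adjoint B $$ (i, k) * mat_adjoint A $$ (k, j))"
    using ij assms by (auto intro!: sum.cong)
  also have "\<dots> = (mat_adjoint B * mat_adjoint A) $$ (i, j)"
    using ij assms by (subst index_mult_mat_sum[of _ p m _ n]) auto
  finally show "mat_adjoint (A * B) $$ (i, j) = (mat_adjoint B * mat_adjoint A) $$ (i, j)" .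
qed (use assms in auto)

lemma mat_adjoint_one [simp]: "mat_adjoint (1\<^sub>m n :: complex mat) = 1\<^sub>m n"
  by (rule eq_matI) auto

lemma mat_diag_cong: "(\<And>k. k < n \<Longrightarrow> f k = g k) \<Longrightarrow> mat_diag n f = mat_diag n g"
  by (rule eq_matI) (auto simp: mat_diag_def)

lemma unitary_opD:
  assumes "unitary_op n U"
  shows "U \<in> carrier_mat n n" "mat_adjoint U \<in> carrier_mat n n" "dim_row U = n" "dim_col U = n"
    "U * mat_adjoint U = 1\<^sub>m n" "mat_adjoint U * U = 1\<^sub>m n"
  using assms unfolding unitary_op_def by auto

lemma unitary_op_one: "unitary_op n (1\<^sub>m n)"
  unfolding unitary_op_def by auto

lemma sq_mult_closed:
  "A \<in> carrier_mat n n \<Longrightarrow> B \<in> carrier_mat n n \<Longrightarrow> A * B \<in> carrier_mat n n"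
  by simp

lemma sq_mult_assoc:
  fixes A :: "'a :: semiring_0 mat"
  assumes "A \<in> carrier_mat n n" "B \<in> carrier_mat n n" "C \<in> carrier_mat n n"
  shows "A * B * C = A * (B * C)"
  using assms by (rule assoc_mult_mat)

lemma unitary_op_cancel:
  assumes "unitary_op n U" "X \<in> carrier_mat n n"
  shows "U * (mat_adjoint U * X) = X" "mat_adjoint U * (U * X) = X"
  using unitary_opD[OF assms(1)] assms(2) by (simp_all add: sq_mult_assoc[of _ n, symmetric])

lemma unitary_op_mult:
  assumes "unitary_op n U" "unitary_op n V"
  shows "unitary_op n (U * V)"
proof -
  note u = unitary_opD[OF assms(1)] and v = unitary_opD[OF assms(2)]
  show ?thesis unfolding unitary_op_def mat_adjoint_mult[OF u(1) v(1)]
    by (simp add: sq_mult_assoc[of _ n] sq_mult_closed[of _ n] u v unitary_op_cancel[OF assms(1)]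
        unitary_op_cancel[OF assms(2)])
qed

lemma unitary_op_adjoint: "unitary_op n U \<Longrightarrow> unitary_op n (mat_adjoint U)"
  unfolding unitary_op_def by auto

lemma unitary_opI:
  assumes "U \<in> carrier_mat n n" "mat_adjoint U * U = 1\<^sub>m n"
  shows "unitary_op n U"
  using assms mat_mult_left_right_inverse[of "mat_adjoint U" n U] unfolding unitary_op_def by auto

text \<open>The characteristic polynomial splits into \<open>n\<close> linear factors over the
  complex numbers, and \<open>n > 0\<close> guarantees at least one root.\<close>

lemma complex_eigenvector_exists:
  fixes A :: "complex mat"
  assumes "A \<in> carrier_mat n n" "n > 0"
  obtains v e where "v \<in> carrier_vec n" "v \<noteq> 0\<^sub>v n" "A *\<^sub>v v = e \<cdot>\<^sub>v v"
proof -
  obtain as where as: "char_poly A = (\<Prod>a\<leftarrow>as. [:- a, 1:])" "length as = n"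
    using char_poly_factorized[OF assms(1)] by auto
  then obtain e es where "as = e # es" using assms(2) by (cases as) auto
  then have "poly (char_poly A) e = 0" using as by simp
  then have "eigenvalue A e" using eigenvalue_root_char_poly[OF assms(1)] by simp
  then show thesis using that assms unfolding eigenvalue_def eigenvector_def by auto
qed

lemma cscalar_prod_self:
  assumes "v \<in> carrier_vec n"
  shows "v \<bullet>c v = complex_of_real (\<Sum>k<n. (cmod (v $ k))\<^sup>2)"
  using assms by (simp add: scalar_prod_def atLeast0LessThan complex_norm_square flip: of_real_power)

text \<open>Completing \<open>v\<close> to a basis and orthogonalising keeps \<open>v\<close> in
  first place. The scalar \<open>c\<close> appears because the columns are normalised only
  afterwards.\<close>

lemma unitary_with_first_column:
  fixes v :: "complex vec"
  assumes v: "v \<in> carrier_vec n" "v \<noteq> 0\<^sub>v n"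
  obtains U c where "unitary_op n U" "\<And>i. i < n \<Longrightarrow> U $$ (i, 0) = c * v $ i"
proof -
  interpret cof_vec_space n "TYPE(complex)" .
  define b where "b = basis_completion v"
  define ws where "ws = gram_schmidt n b"
  note bc = basis_completion[OF v, folded b_def]
  have n: "n > 0" using v by (cases n) (auto intro: eq_vecI)
  from bc have hdb: "hd b = v" and len_b: "length b = n" by auto
  then obtain vs where bv: "b = v # vs" using n by (cases b) auto
  from gram_schmidt_result[OF bc(2,4,5) refl, folded ws_def]
  have ws: "set ws \<subseteq> carrier_vec n" "corthogonal ws" "length ws = n"
    by (auto simp: len_b)
  have hdws: "hd ws = v" unfolding ws_def bv using gram_schmidt_hd[OF v(1), of vs] by simp
  then have ws0: "ws ! 0 = v" using ws(3) n by (cases ws) auto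
  define N where "N i = (\<Sum>k<n. (cmod (ws ! i $ k))\<^sup>2)" for i
  have wsc: "ws ! i \<in> carrier_vec n" if "i < n" for i using ws that by auto
  have dot: "ws ! j \<bullet>c ws ! i = (\<Sum>k<n. ws ! j $ k * cnj (ws ! i $ k))" if "i < n" "j < n" for i j
    using wsc[OF that(1)] wsc[OF that(2)] by (auto simp: scalar_prod_def atLeast0LessThan)
  have Nsq: "ws ! i \<bullet>c ws ! i = complex_of_real (N i)" if "i < n" for i
    unfolding N_def by (rule cscalar_prod_self[OF wsc[OF that]])
  have Npos: "N i > 0" if "i < n" for i
  proof -
    have "N i \<ge> 0" unfolding N_def by (simp add: sum_nonneg)
    moreover have "N i \<noteq> 0" using corthogonalD[OF ws(2), of i i] Nsq[OF that] ws(3) that by auto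
    ultimately show ?thesis by simp
  qed
  define U where "U = mat n n (\<lambda>(i, j). ws ! j $ i / complex_of_real (sqrt (N j)))"
  have U: "U \<in> carrier_mat n n" unfolding U_def by simp
  have "mat_adjoint U * U = 1\<^sub>m n"
  proof (rule eq_matI)
    fix i j assume "i < dim_row (1\<^sub>m n :: complex mat)" "j < dim_col (1\<^sub>m n :: complex mat)"
    then have ij: "i < n" "j < n" by auto
    have "(mat_adjoint U * U) $$ (i, j) = (\<Sum>k<n. mat_adjoint U $$ (i, k) * U $$ (k, j))"
      using U ij by (subst index_mult_mat_sum[of _ n n _ n]) auto
    also have "\<dots> = (\<Sum>k<n. cnj (ws ! i $ k) * ws ! j $ k / (sqrt (N i) * sqrt (N j)))"
      using U ij by (auto intro!: sum.cong simp: U_def)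
    also have "\<dots> = (ws ! j \<bullet>c ws ! i) / (sqrt (N i) * sqrt (N j))"
      unfolding dot[OF ij] by (simp add: sum_divide_distrib mult.commute)
    also have "\<dots> = (if i = j then 1 else 0)"
    proof (cases "i = j")
      case True
      have "complex_of_real (sqrt (N i)) * complex_of_real (sqrt (N i)) = complex_of_real (N i)"
        using Npos[OF ij(1)] by (simp flip: of_real_mult)
      then show ?thesis using True Nsq[OF ij(1)] Npos[OF ij(1)] by simp
    next
      case False
      then show ?thesis using corthogonalD[OF ws(2), of j i] ws(3) ij by auto
    qed
    finally show "(mat_adjoint U * U) $$ (i, j) = 1\<^sub>m n $$ (i, j)" using ij by simp
  qed (use U in auto)
  then have "unitary_op n U" using unitary_opI[OF U] by simp
  moreover have "U $$ (i, 0) = (1 / complex_of_real (sqrt (N 0))) * v $ i" if "i < n" for i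
    using that n unfolding U_def by (simp add: ws0)
  ultimately show thesis using that by blast
qed

text \<open>Working form of a diagonalised operator: functions of the operator become functions
  composed with \<open>\<mu>\<close>, whose values at arguments \<open>\<ge> n\<close> do not
  matter.\<close>

definition specm :: "nat \<Rightarrow> complex mat \<Rightarrow> (nat \<Rightarrow> real) \<Rightarrow> complex mat" where
  "specm n U \<mu> = U * mat_diag n (\<lambda>k. complex_of_real (\<mu> k)) * mat_adjoint U"

lemma hermitian_opD:
  assumes "hermitian_op n A"
  shows "A \<in> carrier_mat n n" "mat_adjoint A = A" "dim_row A = n" "dim_col A = n"
  using assms unfolding hermitian_op_def by auto

lemma hermitian_op_index:
  assumes "hermitian_op n A" "i < n" "j < n"
  shows "A $$ (i, j) = cnj (A $$ (j, i))"
  using assms mat_adjoint_index[of i A j] unfolding hermitian_op_def by auto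

lemma hermitian_opI:
  assumes "A \<in> carrier_mat n n" "\<And>i j. i < n \<Longrightarrow> j < n \<Longrightarrow> A $$ (i, j) = cnj (A $$ (j, i))"
  shows "hermitian_op n A"
  unfolding hermitian_op_def using assms(1)
  by (auto intro!: eq_matI simp: assms(2)[symmetric])

lemma hermitian_conj:
  assumes "hermitian_op n A" "U \<in> carrier_mat n n"
  shows "hermitian_op n (mat_adjoint U * A * U)"
proof -
  note h = hermitian_opD[OF assms(1)]
  have "mat_adjoint (mat_adjoint U * A * U) = mat_adjoint U * (A * U)"
    using h assms(2) by (simp add: mat_adjoint_mult[of _ n n _ n] sq_mult_closed[of _ n])
  also have "\<dots> = mat_adjoint U * A * U"
    using h assms(2) by (simp add: assoc_mult_mat[of _ n n _ n _ n])
  finally show ?thesis using h assms(2) unfolding hermitian_op_def by auto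
qed

text \<open>Deflation: in a unitary basis starting with an eigenvector, the first column vanishes
  below the corner. Hermiticity then clears the first row as well and makes the eigenvalue real, so
  the induction hypothesis applies to the remaining block.\<close>

theorem hermitian_spectral:
  assumes "hermitian_op n A"
  shows "\<exists>U \<mu>. unitary_op n U \<and> A = specm n U \<mu>"
  using assms
proof (induction n arbitrary: A)
  case 0
  then have "A = specm 0 (1\<^sub>m 0) (\<lambda>_. 0)"
    by (intro eq_matI) (auto simp: specm_def hermitian_op_def)
  then show ?case using unitary_op_one by blast
next
  case (Suc n)
  note h = hermitian_opD[OF Suc.prems]
  let ?N = "Suc n"
  obtain v e where v: "v \<in> carrier_vec ?N" "v \<noteq> 0\<^sub>v ?N" and ev: "A *\<^sub>v v = e \<cdot>\<^sub>v v"
    using complex_eigenvector_exists[OF h(1)] by auto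
  obtain U c where U: "unitary_op ?N U" and U0: "\<And>i. i < ?N \<Longrightarrow> U $$ (i, 0) = c * v $ i"
    using unitary_with_first_column[OF v] by metis
  note u = unitary_opD[OF U]
  define B where "B = mat_adjoint U * A * U"
  have hB: "hermitian_op ?N B" unfolding B_def by (rule hermitian_conj[OF Suc.prems u(1)])
  have B_eq: "B = mat_adjoint U * (A * U)" unfolding B_def
    using u h by (simp add: assoc_mult_mat[of _ ?N ?N _ ?N _ ?N])
  have AU: "(A * U) $$ (k, 0) = e * U $$ (k, 0)" if "k < ?N" for k
  proof -
    have "(A * U) $$ (k, 0) = (\<Sum>l<?N. A $$ (k, l) * U $$ (l, 0))"
      using u h that by (subst index_mult_mat_sum[of _ ?N ?N _ ?N]) auto
    also have "\<dots> = c * (\<Sum>l<?N. A $$ (k, l) * v $ l)"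
      unfolding sum_distrib_left by (rule sum.cong) (auto simp: U0)
    also have "(\<Sum>l<?N. A $$ (k, l) * v $ l) = (A *\<^sub>v v) $ k"
      using h v that by (subst index_mult_mat_vec_sum[of _ ?N ?N]) auto
    also have "\<dots> = e * v $ k" unfolding ev using v that by simp
    finally show ?thesis using U0[OF that] by simp
  qed
  have B0: "B $$ (i, 0) = (if i = 0 then e else 0)" if "i < ?N" for i
  proof -
    have "B $$ (i, 0) = (\<Sum>k<?N. mat_adjoint U $$ (i, k) * (A * U) $$ (k, 0))"
      unfolding B_eq using u h that by (subst index_mult_mat_sum[of _ ?N ?N _ ?N]) auto
    also have "\<dots> = e * (\<Sum>k<?N. mat_adjoint U $$ (i, k) * U $$ (k, 0))"
      unfolding sum_distrib_left by (rule sum.cong) (auto simp: AU simp del: index_mult_mat(1))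
    also have "(\<Sum>k<?N. mat_adjoint U $$ (i, k) * U $$ (k, 0)) = (mat_adjoint U * U) $$ (i, 0)"
      using u that by (subst index_mult_mat_sum[of _ ?N ?N _ ?N]) auto
    finally show ?thesis using u that by simp
  qed
  have B0': "B $$ (0, j) = (if j = 0 then cnj e else 0)" if "j < ?N" for j
    using hermitian_op_index[OF hB, of 0 j] B0[OF that] that by auto
  have e: "cnj e = e" using B0[of 0] B0'[of 0] by simp
  define C where "C = mat n n (\<lambda>(i, j). B $$ (Suc i, Suc j))"
  have "hermitian_op n C"
    unfolding C_def by (rule hermitian_opI) (auto intro: hermitian_op_index[OF hB])
  then obtain V \<nu> where V: "unitary_op n V" and C: "C = specm n V \<nu>" using Suc.IH by blast
  note vv = unitary_opD[OF V]
  \<comment> \<open>The unitary of the smaller block is bordered by a 1 in the corner, so that it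
    fixes the first basis vector, which represents the eigenvector already split off.\<close>
  let ?W = "mat ?N ?N (\<lambda>(i, j). if i = 0 \<or> j = 0 then (if i = j then 1 else 0) else V $$ (i - 1, j - 1))"
  define W where "W = ?W"
  have W: "W \<in> carrier_mat ?N ?N" unfolding W_def by simp
  have W0: "W $$ (0, k) = (if k = 0 then 1 else 0)" "W $$ (k, 0) = (if k = 0 then 1 else 0)"
      if "k < ?N" for k using that unfolding W_def by auto
  have WS: "W $$ (Suc i, Suc j) = V $$ (i, j)" if "i < n" "j < n" for i j
    using that unfolding W_def by auto
  have WW: "mat_adjoint W * W = 1\<^sub>m ?N"
  proof (rule eq_matI)
    fix i j assume "i < dim_row (1\<^sub>m ?N :: complex mat)" "j < dim_col (1\<^sub>m ?N :: complex mat)"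
    then have ij: "i < ?N" "j < ?N" by auto
    have "(mat_adjoint W * W) $$ (i, j) = (\<Sum>k<?N. mat_adjoint W $$ (i, k) * W $$ (k, j))"
      using W ij by (subst index_mult_mat_sum[of _ ?N ?N _ ?N]) auto
    also have "\<dots> = cnj (W $$ (0, i)) * W $$ (0, j) + (\<Sum>k<n. cnj (W $$ (Suc k, i)) * W $$ (Suc k, j))"
      using W ij by (simp add: sum.lessThan_Suc_shift del: sum.lessThan_Suc)
    also have "\<dots> = (if i = j then 1 else 0)"
    proof (cases "i = 0 \<or> j = 0")
      case True
      then show ?thesis using ij W0 by auto
    next
      case False
      then obtain i' j' where s: "i = Suc i'" "j = Suc j'" by (meson not0_implies_Suc)
      have "(\<Sum>k<n. cnj (W $$ (Suc k, i)) * W $$ (Suc k, j)) = (\<Sum>k<n. mat_adjoint V $$ (i', k) * V $$ (k, j'))"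
        using ij vv s by (auto simp: WS intro!: sum.cong)
      also have "\<dots> = (mat_adjoint V * V) $$ (i', j')"
        using ij vv(1) s by (subst index_mult_mat_sum[of _ n n _ n]) auto
      finally show ?thesis using ij s vv W0 by simp
    qed
    finally show "(mat_adjoint W * W) $$ (i, j) = 1\<^sub>m ?N $$ (i, j)" using ij by simp
  qed (use W in auto)
  have UW: "unitary_op ?N W" using unitary_opI[OF W WW] .
  define \<mu> where "\<mu> k = (case k of 0 \<Rightarrow> Re e | Suc k \<Rightarrow> \<nu> k)" for k
  have ee: "complex_of_real (Re e) = e" using e by (simp add: complex_eq_iff)
  have Bsp: "B = specm ?N W \<mu>"
  proof (rule eq_matI)
    fix i j assume "i < dim_row (specm ?N W \<mu>)" "j < dim_col (specm ?N W \<mu>)"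
    then have ij: "i < ?N" "j < ?N" using W by (auto simp: specm_def)
    have "specm ?N W \<mu> $$ (i, j) = (\<Sum>k<?N. W $$ (i, k) * \<mu> k * cnj (W $$ (j, k)))"
      unfolding specm_def mat_diag_mult_right[OF W]
      using W ij by (subst index_mult_mat_sum[of _ ?N ?N _ ?N]) (auto simp del: sum.lessThan_Suc)
    also have "\<dots> = W $$ (i, 0) * e * cnj (W $$ (j, 0)) + (\<Sum>k<n. W $$ (i, Suc k) * \<nu> k * cnj (W $$ (j, Suc k)))"
      by (simp add: sum.lessThan_Suc_shift \<mu>_def ee del: sum.lessThan_Suc)
    also have "\<dots> = B $$ (i, j)"
    proof (cases "i = 0 \<or> j = 0")
      case True
      then show ?thesis using ij W0 B0 B0' e by auto
    next
      case False
      then obtain i' j' where s: "i = Suc i'" "j = Suc j'" by (meson not0_implies_Suc)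
      have "(\<Sum>k<n. W $$ (i, Suc k) * \<nu> k * cnj (W $$ (j, Suc k))) = (\<Sum>k<n. V $$ (i', k) * \<nu> k * cnj (V $$ (j', k)))"
        using ij vv s by (auto simp: WS intro!: sum.cong)
      also have "\<dots> = specm n V \<nu> $$ (i', j')"
        unfolding specm_def mat_diag_mult_right[OF vv(1)]
        using vv(1) ij s by (subst index_mult_mat_sum[of _ n n _ n]) auto
      also have "\<dots> = B $$ (i, j)" unfolding C[symmetric] C_def using ij s by simp
      finally show ?thesis using ij s W0 by simp
    qed
    finally show "B $$ (i, j) = specm ?N W \<mu> $$ (i, j)" by simp
  qed (use W hermitian_opD[OF hB] in \<open>auto simp: specm_def\<close>)
  have "A = U * B * mat_adjoint U"
  proof -
    have "U * B * mat_adjoint U = U * mat_adjoint U * A * (U * mat_adjoint U)"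
      unfolding B_def using u(1-4) h(1) by (simp add: sq_mult_assoc[of _ ?N] sq_mult_closed[of _ ?N])
    then show ?thesis using u h by simp
  qed
  also have "\<dots> = specm ?N (U * W) \<mu>"
    unfolding Bsp specm_def mat_adjoint_mult[OF u(1) W]
    using u(1-4) W by (simp add: sq_mult_assoc[of _ ?N] sq_mult_closed[of _ ?N])
  finally show ?case using unitary_op_mult[OF U UW] by blast
qed

section \<open>Functional calculus\<close>

lemma one_smult_mat [simp]: "(1 :: 'a :: monoid_mult) \<cdot>\<^sub>m A = A"
  by (rule eq_matI) auto

lemma specm_carrier [simp]: "unitary_op n U \<Longrightarrow> specm n U \<mu> \<in> carrier_mat n n"
  unfolding specm_def using unitary_opD by (auto simp: sq_mult_closed)

lemma specm_dim:
  assumes "unitary_op n U"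
  shows "dim_row (specm n U \<mu>) = n" "dim_col (specm n U \<mu>) = n"
  using specm_carrier[OF assms, of \<mu>] by auto

lemma specm_index:
  assumes "unitary_op n U" "i < n" "j < n"
  shows "specm n U \<mu> $$ (i, j) = (\<Sum>k<n. U $$ (i, k) * \<mu> k * cnj (U $$ (j, k)))"
  unfolding specm_def mat_diag_mult_right[OF unitary_opD(1)[OF assms(1)]]
  using unitary_opD[OF assms(1)] assms by (subst index_mult_mat_sum[of _ n n _ n]) auto

lemma specm_cong: "(\<And>k. k < n \<Longrightarrow> \<mu> k = \<nu> k) \<Longrightarrow> specm n U \<mu> = specm n U \<nu>"
  unfolding specm_def by (subst mat_diag_cong[of n "\<lambda>k. complex_of_real (\<mu> k)" "\<lambda>k. complex_of_real (\<nu> k)"]) auto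

lemma specm_hermitian:
  assumes "unitary_op n U"
  shows "hermitian_op n (specm n U \<mu>)"
proof (rule hermitian_opI)
  fix i j assume ij: "i < n" "j < n"
  show "specm n U \<mu> $$ (i, j) = cnj (specm n U \<mu> $$ (j, i))"
    unfolding specm_index[OF assms ij] specm_index[OF assms ij(2,1)] cnj_sum
    by (rule sum.cong) simp_all
qed (use assms in simp)

lemma specm_add:
  assumes "unitary_op n U"
  shows "specm n U \<mu> + specm n U \<nu> = specm n U (\<lambda>k. \<mu> k + \<nu> k)"
proof (rule eq_matI)
  fix i j assume "i < dim_row (specm n U (\<lambda>k. \<mu> k + \<nu> k))" "j < dim_col (specm n U (\<lambda>k. \<mu> k + \<nu> k))"
  then have ij: "i < n" "j < n" using specm_dim[OF assms] by auto
  have "specm n U \<mu> $$ (i, j) + specm n U \<nu> $$ (i, j) = specm n U (\<lambda>k. \<mu> k + \<nu> k) $$ (i, j)"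
    unfolding specm_index[OF assms ij] sum.distrib[symmetric] by (rule sum.cong) (simp_all add: algebra_simps)
  then show "(specm n U \<mu> + specm n U \<nu>) $$ (i, j) = specm n U (\<lambda>k. \<mu> k + \<nu> k) $$ (i, j)"
    using ij specm_dim[OF assms] by simp
qed (use specm_dim[OF assms] in auto)

lemma specm_smult:
  assumes "unitary_op n U"
  shows "complex_of_real c \<cdot>\<^sub>m specm n U \<mu> = specm n U (\<lambda>k. c * \<mu> k)"
proof (rule eq_matI)
  fix i j assume "i < dim_row (specm n U (\<lambda>k. c * \<mu> k))" "j < dim_col (specm n U (\<lambda>k. c * \<mu> k))"
  then have ij: "i < n" "j < n" using specm_dim[OF assms] by auto
  have "complex_of_real c * specm n U \<mu> $$ (i, j) = specm n U (\<lambda>k. c * \<mu> k) $$ (i, j)"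
    unfolding specm_index[OF assms ij] sum_distrib_left by (rule sum.cong) simp_all
  then show "(complex_of_real c \<cdot>\<^sub>m specm n U \<mu>) $$ (i, j) = specm n U (\<lambda>k. c * \<mu> k) $$ (i, j)"
    using ij specm_dim[OF assms] by simp
qed (use specm_dim[OF assms] in auto)

lemma specm_const:
  assumes "unitary_op n U"
  shows "specm n U (\<lambda>_. c) = complex_of_real c \<cdot>\<^sub>m 1\<^sub>m n"
proof (rule eq_matI)
  fix i j assume "i < dim_row (complex_of_real c \<cdot>\<^sub>m 1\<^sub>m n)" "j < dim_col (complex_of_real c \<cdot>\<^sub>m 1\<^sub>m n)"
  then have ij: "i < n" "j < n" by auto
  have "(\<Sum>k<n. U $$ (i, k) * cnj (U $$ (j, k))) = (U * mat_adjoint U) $$ (i, j)"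
    using ij unitary_opD(1,3,4)[OF assms] by (subst index_mult_mat_sum[of _ n n _ n]) auto
  also have "\<dots> = 1\<^sub>m n $$ (i, j)" using unitary_opD(5)[OF assms] by simp
  finally show "specm n U (\<lambda>_. c) $$ (i, j) = (complex_of_real c \<cdot>\<^sub>m 1\<^sub>m n) $$ (i, j)"
    unfolding specm_index[OF assms ij] using ij
    by (simp add: mult.assoc mult.left_commute[of _ "complex_of_real c"] flip: sum_distrib_left)
qed (use specm_dim[OF assms] in auto)

lemma specm_mult:
  assumes "unitary_op n U"
  shows "specm n U \<mu> * specm n U \<nu> = specm n U (\<lambda>k. \<mu> k * \<nu> k)"
proof -
  note u = unitary_opD[OF assms]
  let ?D = "\<lambda>\<mu>. mat_diag n (\<lambda>k. complex_of_real (\<mu> k))"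
  have "specm n U \<mu> * specm n U \<nu> = U * ((?D \<mu> * ?D \<nu>) * mat_adjoint U)"
    unfolding specm_def
    by (simp add: sq_mult_assoc[of _ n] sq_mult_closed[of _ n] u(1,2) unitary_op_cancel[OF assms] del: mat_diag_diag)
  also have "\<dots> = specm n U (\<lambda>k. \<mu> k * \<nu> k)"
    unfolding specm_def by (simp add: sq_mult_assoc[of _ n] u(1,2))
  finally show ?thesis .
qed

text \<open>The unitary \<open>W = mat_adjoint V * U\<close> intertwines the two diagonal matrices.
  Entrywise this says that \<open>W $$ (i, j)\<close> can be nonzero only where
  \<open>\<mu> j = \<nu> i\<close>; there \<open>f\<close> takes the same value, so \<open>W\<close>
  also intertwines the transformed diagonals.\<close>

lemma specm_fun_unique:
  assumes U: "unitary_op n U" and V: "unitary_op n V" and eq: "specm n U \<mu> = specm n V \<nu>"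
  shows "specm n U (\<lambda>k. f (\<mu> k)) = specm n V (\<lambda>k. f (\<nu> k))"
proof -
  note u = unitary_opD[OF U] and v = unitary_opD[OF V]
  let ?D = "\<lambda>\<mu>. mat_diag n (\<lambda>k. complex_of_real (\<mu> k))"
  define W where "W = mat_adjoint V * U"
  note a = sq_mult_assoc[of _ n] sq_mult_closed[of _ n] u(1,2) v(1,2)
    unitary_op_cancel[OF U] unitary_op_cancel[OF V]
  have W: "W \<in> carrier_mat n n" unfolding W_def by (simp add: a)
  have "mat_adjoint V * specm n U \<mu> * U = mat_adjoint V * specm n V \<nu> * U" by (simp add: eq)
  then have WD: "W * ?D \<mu> = ?D \<nu> * W"
    unfolding W_def specm_def by (simp add: a u(6) right_mult_one_mat[of _ n])
  have "W * ?D (\<lambda>k. f (\<mu> k)) = ?D (\<lambda>k. f (\<nu> k)) * W"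
  proof (rule eq_matI)
    fix i j assume "i < dim_row (?D (\<lambda>k. f (\<nu> k)) * W)" "j < dim_col (?D (\<lambda>k. f (\<nu> k)) * W)"
    then have ij: "i < n" "j < n" using W by (auto simp: mat_diag_def)
    have "W $$ (i, j) * complex_of_real (\<mu> j) = complex_of_real (\<nu> i) * W $$ (i, j)"
      using arg_cong[OF WD, of "\<lambda>M. M $$ (i, j)"] ij
      by (simp add: mat_diag_mult_right[OF W] mat_diag_mult_left[OF W])
    then have "W $$ (i, j) = 0 \<or> \<mu> j = \<nu> i" by (auto simp: mult.commute)
    then show "(W * ?D (\<lambda>k. f (\<mu> k))) $$ (i, j) = (?D (\<lambda>k. f (\<nu> k)) * W) $$ (i, j)"
      using ij by (auto simp: mat_diag_mult_right[OF W] mat_diag_mult_left[OF W])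
  qed (use W in \<open>auto simp: mat_diag_def\<close>)
  then have "V * (W * ?D (\<lambda>k. f (\<mu> k))) * mat_adjoint U = V * (?D (\<lambda>k. f (\<nu> k)) * W) * mat_adjoint U"
    by simp
  then show ?thesis unfolding W_def specm_def by (simp add: a u(5) right_mult_one_mat[of _ n])
qed

text \<open>This discharges the \<open>THE\<close> in \<open>herm_fun\<close> once and for all: any
  diagonalisation may be used to compute it.\<close>

lemma herm_fun_specm:
  assumes U: "unitary_op n U"
  shows "herm_fun f (specm n U \<mu>) = specm n U (\<lambda>k. f (\<mu> k))"
  unfolding herm_fun_def specm_dim[OF U] specm_def[symmetric]
proof (rule the_equality)
  show "\<exists>U' \<mu>'. unitary_op n U' \<and> specm n U \<mu> = specm n U' \<mu>' \<and>
      specm n U (\<lambda>k. f (\<mu> k)) = specm n U' (\<lambda>k. f (\<mu>' k))"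
    using U by blast
qed (use specm_fun_unique[OF U] in metis)

lemma herm_fun_hermitian:
  assumes "hermitian_op n A"
  shows "hermitian_op n (herm_fun f A)"
proof -
  obtain U \<mu> where "unitary_op n U" "A = specm n U \<mu>" using hermitian_spectral[OF assms] by blast
  then show ?thesis by (simp add: herm_fun_specm specm_hermitian)
qed

section \<open>Positive definiteness in terms of eigenvalues\<close>

lemma quadratic_form_specm:
  assumes U: "unitary_op n U" and v: "v \<in> carrier_vec n"
  shows "(specm n U \<mu> *\<^sub>v v) \<bullet>c v =
    complex_of_real (\<Sum>k<n. \<mu> k * (cmod ((mat_adjoint U *\<^sub>v v) $ k))\<^sup>2)"
proof -
  note u = unitary_opD[OF U]
  have y: "(mat_adjoint U *\<^sub>v v) $ k = (\<Sum>j<n. cnj (U $$ (j, k)) * v $ j)" if "k < n" for k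
    using u(1,2) v that by (subst index_mult_mat_vec_sum[of _ n n]) (auto intro!: sum.cong)
  have "(specm n U \<mu> *\<^sub>v v) \<bullet>c v = (\<Sum>i<n. (specm n U \<mu> *\<^sub>v v) $ i * cnj (v $ i))"
    using v by (simp add: scalar_prod_def atLeast0LessThan)
  also have "\<dots> = (\<Sum>i<n. \<Sum>j<n. \<Sum>k<n. \<mu> k * ((cnj (U $$ (j, k)) * v $ j) * cnj (cnj (U $$ (i, k)) * v $ i)))"
  proof (rule sum.cong[OF refl])
    fix i assume "i \<in> {..<n}"
    then have i: "i < n" by simp
    have "(specm n U \<mu> *\<^sub>v v) $ i = (\<Sum>j<n. (\<Sum>k<n. U $$ (i, k) * \<mu> k * cnj (U $$ (j, k))) * v $ j)"
      unfolding index_mult_mat_vec_sum[OF specm_carrier[OF U] v i]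
      by (rule sum.cong) (simp_all only: specm_index[OF U i] lessThan_iff)
    then show "(specm n U \<mu> *\<^sub>v v) $ i * cnj (v $ i) =
      (\<Sum>j<n. \<Sum>k<n. \<mu> k * ((cnj (U $$ (j, k)) * v $ j) * cnj (cnj (U $$ (i, k)) * v $ i)))"
      by (simp only: sum_distrib_right) (intro sum.cong refl, simp)
  qed
  also have "\<dots> = (\<Sum>i<n. \<Sum>k<n. \<Sum>j<n. \<mu> k * ((cnj (U $$ (j, k)) * v $ j) * cnj (cnj (U $$ (i, k)) * v $ i)))"
    by (rule sum.cong[OF refl], rule sum.swap)
  also have "\<dots> = (\<Sum>k<n. \<Sum>i<n. \<Sum>j<n. \<mu> k * ((cnj (U $$ (j, k)) * v $ j) * cnj (cnj (U $$ (i, k)) * v $ i)))"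
    by (rule sum.swap)
  also have "\<dots> = (\<Sum>k<n. \<mu> k * ((\<Sum>j<n. cnj (U $$ (j, k)) * v $ j) * cnj (\<Sum>j<n. cnj (U $$ (j, k)) * v $ j)))"
    by (intro sum.cong refl)
      (unfold cnj_sum sum_product, unfold sum_distrib_left, rule sum.swap)
  also have "\<dots> = (\<Sum>k<n. complex_of_real (\<mu> k * (cmod ((mat_adjoint U *\<^sub>v v) $ k))\<^sup>2))"
    by (intro sum.cong refl) (simp add: y[symmetric] complex_norm_square[symmetric] del: complex_cnj_cnj)
  finally show ?thesis by simp
qed

lemma adjoint_mult_vec_nonzero:
  assumes U: "unitary_op n U" and v: "v \<in> carrier_vec n" "v \<noteq> 0\<^sub>v n"
  obtains k where "k < n" "(mat_adjoint U *\<^sub>v v) $ k \<noteq> 0"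
proof (rule ccontr)
  assume "\<not> thesis"
  then have "mat_adjoint U *\<^sub>v v = 0\<^sub>v n"
    using that unitary_opD(4)[OF U] by (intro eq_vecI) auto
  then have "U *\<^sub>v (mat_adjoint U *\<^sub>v v) = 0\<^sub>v n"
    using unitary_opD(1,3)[OF U] by (auto intro!: eq_vecI)
  then have "v = 0\<^sub>v n"
    using v(1) unitary_opD(1,2,5)[OF U] assoc_mult_mat_vec[of U n n "mat_adjoint U" n v] by auto
  with v show False by simp
qed

text \<open>The quadratic form weights the eigenvalues with the squared moduli of the coordinates in
  the eigenbasis. A column of \<open>U\<close> isolates a single eigenvalue; conversely a nonzero
  vector has at least one nonzero coordinate.\<close>

lemma posdef_specm_iff:
  assumes U: "unitary_op n U"
  shows "posdef_op n (specm n U \<mu>) \<longleftrightarrow> (\<forall>k<n. \<mu> k > 0)"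
proof
  note u = unitary_opD[OF U]
  assume pd: "posdef_op n (specm n U \<mu>)"
  show "\<forall>k<n. \<mu> k > 0"
  proof (intro allI impI)
    fix k assume k: "k < n"
    let ?v = "col U k"
    have y: "mat_adjoint U *\<^sub>v ?v = unit_vec n k"
    proof (rule eq_vecI)
      fix i assume "i < dim_vec (unit_vec n k)"
      then have i: "i < n" by simp
      have "(mat_adjoint U *\<^sub>v ?v) $ i = (mat_adjoint U * U) $$ (i, k)"
        using i k u(1-4) by simp
      then show "(mat_adjoint U *\<^sub>v ?v) $ i = unit_vec n k $ i" using u(6) i k by simp
    qed (use u in auto)
    have "?v \<noteq> 0\<^sub>v n"
    proof
      assume "?v = 0\<^sub>v n"
      moreover have "mat_adjoint U *\<^sub>v 0\<^sub>v n = 0\<^sub>v n"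
        using u(2) by (intro eq_vecI) (auto simp: index_mult_mat_vec_sum[of _ n n] simp del: index_mult_mat_vec)
      ultimately have "unit_vec n k = (0\<^sub>v n :: complex vec)" using y by simp
      then have "unit_vec n k $ k = (0\<^sub>v n :: complex vec) $ k" by simp
      then show False using k by simp
    qed
    then have "Re ((specm n U \<mu> *\<^sub>v ?v) \<bullet>c ?v) > 0"
      using pd u(1,3) k unfolding posdef_op_def by (metis col_carrier_vec carrier_matD(2))
    moreover have "(specm n U \<mu> *\<^sub>v ?v) \<bullet>c ?v = complex_of_real (\<mu> k)"
    proof -
      have "?v \<in> carrier_vec n" using u(1,3) by (auto simp: col_def)
      then have "(specm n U \<mu> *\<^sub>v ?v) \<bullet>c ?v = complex_of_real (\<Sum>l<n. \<mu> l * (cmod (unit_vec n k $ l))\<^sup>2)"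
        using quadratic_form_specm[OF U, of ?v \<mu>] unfolding y by simp
      also have "(\<Sum>l<n. \<mu> l * (cmod (unit_vec n k $ l))\<^sup>2) = (\<Sum>l<n. if l = k then \<mu> l else 0)"
        using k by (intro sum.cong) auto
      finally show ?thesis using k by simp
    qed
    ultimately show "\<mu> k > 0" by simp
  qed
next
  assume pos: "\<forall>k<n. \<mu> k > 0"
  have "Re ((specm n U \<mu> *\<^sub>v v) \<bullet>c v) > 0" if v: "v \<in> carrier_vec n" "v \<noteq> 0\<^sub>v n" for v
  proof -
    obtain k where k: "k < n" "(mat_adjoint U *\<^sub>v v) $ k \<noteq> 0"
      using adjoint_mult_vec_nonzero[OF U v] .
    have "(\<Sum>k<n. \<mu> k * (cmod ((mat_adjoint U *\<^sub>v v) $ k))\<^sup>2) > 0"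
      using pos k by (intro sum_pos2[of _ k]) (auto simp: less_imp_le)
    then show ?thesis by (simp add: quadratic_form_specm[OF U v(1)])
  qed
  then show "posdef_op n (specm n U \<mu>)"
    unfolding posdef_op_def using specm_hermitian[OF U] by blast
qed

lemma posdef_opD: "posdef_op n A \<Longrightarrow> hermitian_op n A" "posdef_op n A \<Longrightarrow> A \<in> carrier_mat n n"
  unfolding posdef_op_def hermitian_op_def by auto

lemma posdef_spectral:
  assumes "posdef_op n A"
  obtains U \<mu> where "unitary_op n U" "A = specm n U \<mu>" "\<And>k. k < n \<Longrightarrow> \<mu> k > 0"
  using hermitian_spectral[OF posdef_opD(1)[OF assms]] posdef_specm_iff assms by metis

lemma posdef_imp_psd:
  assumes "posdef_op n A"
  shows "psd_op n A"
proof -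
  have "Re ((A *\<^sub>v v) \<bullet>c v) \<ge> 0" if "v \<in> carrier_vec n" for v
  proof (cases "v = 0\<^sub>v n")
    case True
    then show ?thesis using posdef_opD(2)[OF assms] by simp
  next
    case False
    then show ?thesis using assms that unfolding posdef_op_def by (simp add: less_imp_le)
  qed
  then show ?thesis using posdef_opD(1)[OF assms] unfolding psd_op_def by simp
qed

section \<open>Exponential, logarithm, inverse and star product\<close>

lemma mexp_posdef:
  assumes "hermitian_op n H"
  shows "posdef_op n (mexp H)"
  using hermitian_spectral[OF assms] by (auto simp: herm_fun_specm posdef_specm_iff)

lemma mlog_hermitian: "posdef_op n A \<Longrightarrow> hermitian_op n (mlog A)"
  using herm_fun_hermitian posdef_opD by blast

lemma mlog_mexp:
  assumes "hermitian_op n H"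
  shows "mlog (mexp H) = H"
  using hermitian_spectral[OF assms] by (auto simp: herm_fun_specm)

lemma mexp_mlog:
  assumes "posdef_op n A"
  shows "mexp (mlog A) = A"
  using assms by (rule posdef_spectral) (auto simp: herm_fun_specm intro: specm_cong)

lemma mlog_one: "mlog (1\<^sub>m n) = 0\<^sub>m n n"
proof -
  have "1\<^sub>m n = specm n (1\<^sub>m n) (\<lambda>_. 1)" by (simp add: specm_const[OF unitary_op_one])
  then have "mlog (1\<^sub>m n) = mlog (specm n (1\<^sub>m n) (\<lambda>_. 1))" by (rule arg_cong)
  also have "\<dots> = specm n (1\<^sub>m n) (\<lambda>_. 0)" by (simp add: herm_fun_specm[OF unitary_op_one])
  also have "\<dots> = 0\<^sub>m n n" unfolding specm_const[OF unitary_op_one] by (rule eq_matI) auto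
  finally show ?thesis .
qed

lemma posdef_one: "posdef_op n (1\<^sub>m n)"
  using posdef_specm_iff[OF unitary_op_one, of n "\<lambda>_. 1"] by (simp add: specm_const[OF unitary_op_one])

lemma posdef_smult:
  assumes "posdef_op n A" "c > 0"
  shows "posdef_op n (complex_of_real c \<cdot>\<^sub>m A)"
  using assms(1) by (rule posdef_spectral) (use assms(2) in \<open>auto simp: specm_smult posdef_specm_iff\<close>)

text \<open>The origin of all calculations modulo the identity: rescaling an operator shifts its
  logarithm by a multiple of the identity.\<close>

lemma mlog_smult:
  assumes "posdef_op n A" "c > 0"
  shows "mlog (complex_of_real c \<cdot>\<^sub>m A) = mlog A + complex_of_real (ln c) \<cdot>\<^sub>m 1\<^sub>m n"
  using assms(1)
proof (rule posdef_spectral)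
  fix U \<mu> assume U: "unitary_op n U" and A: "A = specm n U \<mu>" and pos: "\<And>k. k < n \<Longrightarrow> \<mu> k > 0"
  have "specm n U (\<lambda>k. ln (c * \<mu> k)) = specm n U (\<lambda>k. ln (\<mu> k) + ln c)"
    using pos assms(2) by (intro specm_cong) (simp add: ln_mult_pos)
  then show ?thesis unfolding A
    by (simp add: specm_smult U herm_fun_specm specm_add flip: specm_const[OF U])
qed

lemma minv_specm:
  assumes U: "unitary_op n U" and pos: "\<And>k. k < n \<Longrightarrow> \<mu> k \<noteq> 0"
  shows "minv (specm n U \<mu>) = specm n U (\<lambda>k. inverse (\<mu> k))"
proof -
  let ?A = "specm n U \<mu>" and ?B = "specm n U (\<lambda>k. inverse (\<mu> k))"
  have one: "specm n U (\<lambda>k. \<mu> k * inverse (\<mu> k)) = 1\<^sub>m n" "specm n U (\<lambda>k. inverse (\<mu> k) * \<mu> k) = 1\<^sub>m n"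
    using pos specm_const[OF U, of 1] specm_cong[of n "\<lambda>k. \<mu> k * inverse (\<mu> k)" "\<lambda>_. 1" U]
    by (simp_all add: mult.commute)
  have AB: "?A * ?B = 1\<^sub>m n" "?B * ?A = 1\<^sub>m n" by (simp_all add: specm_mult[OF U] one)
  have c: "?A \<in> carrier_mat n n" "?B \<in> carrier_mat n n" using U by auto
  \<comment> \<open>\<open>mat_inverse\<close> can return \<open>None\<close> only on non-units, so
    a two-sided inverse forces \<open>Some C\<close>.\<close>
  have "?A \<in> Units (ring_mat TYPE(complex) n ())"
    unfolding Units_def ring_mat_def using AB c by auto
  then obtain C where C: "mat_inverse ?A = Some C"
    using mat_inverse(1)[OF c(1), of "()"] by (cases "mat_inverse ?A") auto
  then have C': "?A * C = 1\<^sub>m n" "C \<in> carrier_mat n n" using mat_inverse(2)[OF c(1)] by auto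
  \<comment> \<open>The inverse delivered by elimination is a right inverse of \<open>?A\<close>,
    hence equal to the left inverse \<open>?B\<close>.\<close>
  have "C = ?B * ?A * C" using C'(2) AB by simp
  also have "\<dots> = ?B" using c C' by (simp add: sq_mult_assoc[of _ n])
  finally show ?thesis using C by simp
qed

lemma posdef_minv:
  assumes "posdef_op n A"
  shows "posdef_op n (minv A)"
  using assms
proof (rule posdef_spectral)
  fix U \<mu> assume U: "unitary_op n U" and A: "A = specm n U \<mu>" and pos: "\<And>k. k < n \<Longrightarrow> \<mu> k > 0"
  then show ?thesis using minv_specm[OF U, of \<mu>] by (auto simp: posdef_specm_iff less_imp_neq[THEN not_sym])
qed

lemma mlog_minv:
  assumes "posdef_op n A"
  shows "mlog (minv A) = - mlog A"
  using assms
proof (rule posdef_spectral)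
  fix U \<mu> assume U: "unitary_op n U" and A: "A = specm n U \<mu>" and pos: "\<And>k. k < n \<Longrightarrow> \<mu> k > 0"
  have "mlog (minv A) = specm n U (\<lambda>k. (-1) * ln (\<mu> k))"
    using minv_specm[OF U, of \<mu>] pos unfolding A
    by (auto simp: herm_fun_specm[OF U] less_imp_neq[THEN not_sym] ln_inverse intro!: specm_cong)
  also have "\<dots> = - mlog A"
    unfolding A herm_fun_specm[OF U] specm_smult[OF U, symmetric] by (rule eq_matI) auto
  finally show ?thesis .
qed

lemma hermitian_add: "hermitian_op n A \<Longrightarrow> hermitian_op n B \<Longrightarrow> hermitian_op n (A + B)"
  by (rule hermitian_opI) (auto simp: hermitian_opD(1) hermitian_opD(3,4) simp flip: hermitian_op_index)

lemma hermitian_smult: "hermitian_op n A \<Longrightarrow> hermitian_op n (complex_of_real c \<cdot>\<^sub>m A)"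
  by (rule hermitian_opI) (auto simp: hermitian_opD(1) hermitian_opD(3,4) simp flip: hermitian_op_index)

lemma hermitian_uminus: "hermitian_op n A \<Longrightarrow> hermitian_op n (- A)"
  by (rule hermitian_opI) (auto simp: hermitian_opD(1) hermitian_opD(3,4) simp flip: hermitian_op_index)

lemma hermitian_minus: "hermitian_op n A \<Longrightarrow> hermitian_op n B \<Longrightarrow> hermitian_op n (A - B)"
  by (rule hermitian_opI) (auto simp: hermitian_opD(1) hermitian_opD(3,4) simp flip: hermitian_op_index)

lemma hermitian_one: "hermitian_op n (1\<^sub>m n)"
  by (rule hermitian_opI) auto

lemma hermitian_zero: "hermitian_op n (0\<^sub>m n n)"
  by (rule hermitian_opI) auto

lemma star_posdef:
  assumes "posdef_op n A" "posdef_op n B"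
  shows "posdef_op n (A \<star> B)" "mlog (A \<star> B) = mlog A + mlog B"
  using assms unfolding star_def by (auto intro!: mexp_posdef mlog_mexp hermitian_add mlog_hermitian)

section \<open>Traces and the derivative of the entropy\<close>

lemma of_real_cmod_power2: "(complex_of_real (cmod z))\<^sup>2 = z * cnj z"
  by (metis complex_norm_square of_real_power)

lemma tr_mult_sum:
  assumes "A \<in> carrier_mat n m" "B \<in> carrier_mat m n"
  shows "tr (A * B) = (\<Sum>i<n. \<Sum>j<m. A $$ (i, j) * B $$ (j, i))"
  unfolding tr_def using assms by (auto simp: index_mult_mat_sum[OF assms] simp del: index_mult_mat(1) intro!: sum.cong)

lemma tr_mult_commute:
  assumes "A \<in> carrier_mat n m" "B \<in> carrier_mat m n"
  shows "tr (A * B) = tr (B * A)"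
  unfolding tr_mult_sum[OF assms] tr_mult_sum[OF assms(2,1)]
  by (subst sum.swap) (simp add: mult.commute)

lemma tr_add: "A \<in> carrier_mat n n \<Longrightarrow> B \<in> carrier_mat n n \<Longrightarrow> tr (A + B) = tr A + tr B"
  unfolding tr_def by (auto simp: sum.distrib)

lemma tr_smult: "tr (c \<cdot>\<^sub>m A) = c * tr A" if "A \<in> carrier_mat n n"
  unfolding tr_def using that by (auto simp: sum_distrib_left)

lemma tr_mult_distrib:
  assumes A: "A \<in> carrier_mat n n" and B: "B \<in> carrier_mat n n" and C: "C \<in> carrier_mat n n"
  shows "tr (A * (B + C)) = tr (A * B) + tr (A * C)" "tr ((A + B) * C) = tr (A * C) + tr (B * C)"
    "tr (A * (B - C)) = tr (A * B) - tr (A * C)" "tr ((A - B) * C) = tr (A * C) - tr (B * C)"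
proof -
  have c: "B + C \<in> carrier_mat n n" "A + B \<in> carrier_mat n n" "B - C \<in> carrier_mat n n"
    "A - B \<in> carrier_mat n n"
    using assms by auto
  note s = tr_mult_sum[OF A B] tr_mult_sum[OF A C] tr_mult_sum[OF B C]
    tr_mult_sum[OF A c(1)] tr_mult_sum[OF c(2) C] tr_mult_sum[OF A c(3)] tr_mult_sum[OF c(4) C]
  show "tr (A * (B + C)) = tr (A * B) + tr (A * C)" "tr ((A + B) * C) = tr (A * C) + tr (B * C)"
    unfolding s sum.distrib[symmetric] using assms by (auto intro!: sum.cong simp: algebra_simps)
  show "tr (A * (B - C)) = tr (A * B) - tr (A * C)" "tr ((A - B) * C) = tr (A * C) - tr (B * C)"
    unfolding s sum_subtractf[symmetric] using assms by (auto intro!: sum.cong simp: algebra_simps)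
qed

lemma tr_mult_smult:
  assumes A: "A \<in> carrier_mat n n" and B: "B \<in> carrier_mat n n"
  shows "tr (A * (c \<cdot>\<^sub>m B)) = c * tr (A * B)" "tr ((c \<cdot>\<^sub>m A) * B) = c * tr (A * B)"
proof -
  have c: "c \<cdot>\<^sub>m B \<in> carrier_mat n n" "c \<cdot>\<^sub>m A \<in> carrier_mat n n" using assms by auto
  show "tr (A * (c \<cdot>\<^sub>m B)) = c * tr (A * B)" "tr ((c \<cdot>\<^sub>m A) * B) = c * tr (A * B)"
    unfolding tr_mult_sum[OF A B] tr_mult_sum[OF A c(1)] tr_mult_sum[OF c(2) B] sum_distrib_left
    using assms by (auto intro!: sum.cong simp: algebra_simps)
qed

text \<open>For Hermitian \<open>H\<close> the trace of \<open>H * H\<close> is the squared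
  Hilbert-Schmidt norm. This is how a gradient that annihilates every Hermitian direction, in
  particular itself, is seen to vanish.\<close>

lemma hermitian_trace_zero_imp_zero:
  assumes H: "hermitian_op n H" and zero: "Re (tr (H * H)) = 0"
  shows "H = 0\<^sub>m n n"
proof -
  note h = hermitian_opD[OF H]
  have "tr (H * H) = (\<Sum>i<n. \<Sum>j<n. complex_of_real ((cmod (H $$ (i, j)))\<^sup>2))"
    unfolding tr_mult_sum[OF h(1) h(1)]
    by (intro sum.cong refl) (simp add: of_real_cmod_power2 hermitian_op_index[OF H, symmetric])
  then have "(\<Sum>i<n. \<Sum>j<n. (cmod (H $$ (i, j)))\<^sup>2) = 0" using zero by simp
  then have "\<forall>i<n. (\<Sum>j<n. (cmod (H $$ (i, j)))\<^sup>2) = 0"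
    by (subst (asm) sum_nonneg_eq_0_iff) (auto intro: sum_nonneg)
  then have "\<forall>i<n. \<forall>j<n. (cmod (H $$ (i, j)))\<^sup>2 = 0"
    by (simp add: sum_nonneg_eq_0_iff)
  then show ?thesis using h by (intro eq_matI) auto
qed

lemma tr_specm:
  assumes U: "unitary_op n U"
  shows "tr (specm n U \<mu>) = complex_of_real (\<Sum>k<n. \<mu> k)"
proof -
  note u = unitary_opD[OF U]
  let ?D = "mat_diag n (\<lambda>k. complex_of_real (\<mu> k))"
  have "tr (specm n U \<mu>) = tr (mat_adjoint U * (U * ?D))"
    unfolding specm_def using u by (intro tr_mult_commute[of _ n n]) (auto simp: sq_mult_closed)
  also have "\<dots> = tr ?D" by (simp add: unitary_op_cancel[OF U])
  also have "\<dots> = complex_of_real (\<Sum>k<n. \<mu> k)" unfolding tr_def by (simp add: mat_diag_def)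
  finally show ?thesis .
qed

text \<open>Squared modulus of the scalar product of the \<open>i\<close>-th vector of one
  eigenbasis with the \<open>j\<close>-th of the other; for unitary \<open>U\<close> and
  \<open>V\<close> these form a doubly stochastic matrix.\<close>

definition overlap :: "complex mat \<Rightarrow> complex mat \<Rightarrow> nat \<Rightarrow> nat \<Rightarrow> real" where
  "overlap U V i j = (cmod ((mat_adjoint U * V) $$ (i, j)))\<^sup>2"

lemma overlap_nonneg: "overlap U V i j \<ge> 0"
  unfolding overlap_def by simp

text \<open>With \<open>W = mat_adjoint U * V\<close>, cyclicity of the trace leaves
  \<open>diag f * W * diag g * mat_adjoint W\<close>, and only squared moduli of entries of
  \<open>W\<close> enter its diagonal.\<close>

lemma tr_specm_specm:
  assumes U: "unitary_op n U" and V: "unitary_op n V"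
  shows "tr (specm n U f * specm n V g) = complex_of_real (\<Sum>i<n. \<Sum>j<n. overlap U V i j * (f i * g j))"
proof -
  note u = unitary_opD[OF U] and v = unitary_opD[OF V]
  define W where "W = mat_adjoint U * V"
  have W: "unitary_op n W" unfolding W_def by (intro unitary_op_mult unitary_op_adjoint U V)
  let ?D = "\<lambda>f. mat_diag n (\<lambda>k. complex_of_real (f k))"
  note a = sq_mult_assoc[of _ n] sq_mult_closed[of _ n] u(1,2) v(1,2)
  have adj: "mat_adjoint W = mat_adjoint V * U"
    unfolding W_def using mat_adjoint_mult[OF u(2) v(1)] by simp
  have "tr (specm n U f * specm n V g) = tr (U * (?D f * mat_adjoint U * specm n V g))"
    unfolding specm_def by (simp add: a)
  also have "\<dots> = tr (?D f * mat_adjoint U * specm n V g * U)"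
    by (rule tr_mult_commute[of _ n n]) (auto simp: a specm_carrier[OF V])
  also have "\<dots> = tr (?D f * specm n W g)"
    unfolding specm_def adj unfolding W_def by (simp add: a)
  also have "\<dots> = (\<Sum>i<n. complex_of_real (f i) * specm n W g $$ (i, i))"
    unfolding tr_def mat_diag_mult_left[OF specm_carrier[OF W]] by simp
  also have "\<dots> = (\<Sum>i<n. \<Sum>j<n. complex_of_real (overlap U V i j * (f i * g j)))"
    by (intro sum.cong refl)
      (auto simp: specm_index[OF W] sum_distrib_left overlap_def of_real_cmod_power2 W_def[symmetric]
        intro!: sum.cong)
  finally show ?thesis by simp
qed

text \<open>Rows and columns of the unitary matrix \<open>mat_adjoint U * V\<close> have norm
  one.\<close>

lemma sum_overlap:
  assumes U: "unitary_op n U" and V: "unitary_op n V"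
  shows "i < n \<Longrightarrow> (\<Sum>j<n. overlap U V i j) = 1" "j < n \<Longrightarrow> (\<Sum>i<n. overlap U V i j) = 1"
proof -
  define W where "W = mat_adjoint U * V"
  have W: "unitary_op n W" unfolding W_def by (intro unitary_op_mult unitary_op_adjoint U V)
  note w = unitary_opD[OF W]
  { assume i: "i < n"
    have "complex_of_real (\<Sum>j<n. overlap U V i j) = (\<Sum>j<n. W $$ (i, j) * mat_adjoint W $$ (j, i))"
      using i w unfolding overlap_def W_def[symmetric] of_real_sum
      by (intro sum.cong refl) (simp add: of_real_cmod_power2)
    also have "\<dots> = (W * mat_adjoint W) $$ (i, i)"
      using w(1,2) i by (subst index_mult_mat_sum[of _ n n _ n]) auto
    finally show "(\<Sum>j<n. overlap U V i j) = 1" using w(5) i by (simp only: of_real_eq_iff) (simp add: complex_eq_iff) }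
  { assume j: "j < n"
    have "complex_of_real (\<Sum>i<n. overlap U V i j) = (\<Sum>i<n. mat_adjoint W $$ (j, i) * W $$ (i, j))"
      using j w unfolding overlap_def W_def[symmetric] of_real_sum
      by (intro sum.cong refl) (simp add: of_real_cmod_power2)
    also have "\<dots> = (mat_adjoint W * W) $$ (j, j)"
      using w(1,2) j by (subst index_mult_mat_sum[of _ n n _ n]) auto
    finally show "(\<Sum>i<n. overlap U V i j) = 1" using w(6) j by (simp only: of_real_eq_iff) (simp add: complex_eq_iff) }
qed

lemma sum_overlap_left:
  assumes U: "unitary_op n U" and V: "unitary_op n V"
  shows "(\<Sum>i<n. \<Sum>j<n. overlap U V i j * f i) = (\<Sum>i<n. f i)"
  by (rule sum.cong) (auto simp: sum_overlap[OF U V] simp flip: sum_distrib_right)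

lemma sum_overlap_right:
  assumes U: "unitary_op n U" and V: "unitary_op n V"
  shows "(\<Sum>i<n. \<Sum>j<n. overlap U V i j * g j) = (\<Sum>j<n. g j)"
  by (subst sum.swap, rule sum.cong) (auto simp: sum_overlap[OF U V] simp flip: sum_distrib_right)

text \<open>Both bounds are \<open>ln x \<le> x - 1\<close>, at \<open>x = b / a\<close> for the
  lower and at \<open>x = a / b\<close> for the upper one. The latter yields
  \<open>(a - b)^2 / b\<close> exactly, and then \<open>b\<close> is replaced by its lower bound
  \<open>\<beta>\<close>.\<close>

lemma entropy_term_bounds:
  fixes a b \<beta> :: real
  assumes "a > 0" "\<beta> > 0" "b \<ge> \<beta>"
  shows "0 \<le> a * ln a - a * ln b - a + b" "a * ln a - a * ln b - a + b \<le> (a - b)\<^sup>2 / \<beta>"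
proof -
  have b: "b > 0" using assms by simp
  have 1: "ln b - ln a \<le> b / a - 1" using ln_le_minus_one[of "b / a"] assms b by (simp add: ln_div)
  have "a * (ln b - ln a) \<le> a * (b / a - 1)" using 1 assms by (intro mult_left_mono) auto
  then show "0 \<le> a * ln a - a * ln b - a + b" using assms by (simp add: algebra_simps)
  have 2: "ln a - ln b \<le> a / b - 1" using ln_le_minus_one[of "a / b"] assms b by (simp add: ln_div)
  have "a * (ln a - ln b) \<le> a * (a / b - 1)" using 2 assms by (intro mult_left_mono) auto
  then have "a * ln a - a * ln b - a + b \<le> a * (a / b - 1) - a + b" by (simp add: algebra_simps)
  also have "\<dots> = (a - b)\<^sup>2 / b" using b by (simp add: field_simps power2_eq_square)
  also have "\<dots> \<le> (a - b)\<^sup>2 / \<beta>" using assms by (intro divide_left_mono) auto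
  finally show "a * ln a - a * ln b - a + b \<le> (a - b)\<^sup>2 / \<beta>" .
qed

text \<open>The lower bound is Klein's inequality, the upper bound a \<open>\<chi>\<^sup>2\<close>-type estimate.\<close>

lemma relative_entropy_bounds:
  assumes U: "unitary_op n U" and V: "unitary_op n V"
    and a: "\<And>k. k < n \<Longrightarrow> a k > 0" and b: "\<And>k. k < n \<Longrightarrow> b k \<ge> \<beta>" and \<beta>: "\<beta> > 0"
  defines "A \<equiv> specm n U a" and "B \<equiv> specm n V b"
  defines "D \<equiv> Re (tr (A * mlog A)) - Re (tr (A * mlog B)) - Re (tr A) + Re (tr B)"
  shows "0 \<le> D" "D \<le> Re (tr ((A - B) * (A - B))) / \<beta>"
proof -
  let ?S = "\<lambda>f. \<Sum>i<n. \<Sum>j<n. overlap U V i j * f i j"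
  have c: "A \<in> carrier_mat n n" "B \<in> carrier_mat n n" unfolding A_def B_def using U V by auto
  \<comment> \<open>Traces that involve only one of the two eigenbases are padded with the other
    index, since overlaps sum to one. All terms then carry the same weights and the scalar bounds
    can be applied pair by pair.\<close>
  have t1: "Re (tr (A * mlog A)) = ?S (\<lambda>i j. a i * ln (a i))"
    unfolding A_def by (simp add: herm_fun_specm[OF U] specm_mult[OF U] tr_specm[OF U] sum_overlap_left[OF U V])
  have t2: "Re (tr (A * mlog B)) = ?S (\<lambda>i j. a i * ln (b j))"
    unfolding A_def B_def by (simp add: herm_fun_specm[OF V] tr_specm_specm[OF U V])
  have t3: "Re (tr A) = ?S (\<lambda>i j. a i)"
    unfolding A_def by (simp add: tr_specm[OF U] sum_overlap_left[OF U V])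
  have t4: "Re (tr B) = ?S (\<lambda>i j. b j)"
    unfolding B_def by (simp add: tr_specm[OF V] sum_overlap_right[OF U V])
  have t5: "Re (tr (A * A)) = ?S (\<lambda>i j. a i * a i)"
    unfolding A_def by (simp add: specm_mult[OF U] tr_specm[OF U] sum_overlap_left[OF U V])
  have t6: "Re (tr (B * B)) = ?S (\<lambda>i j. b j * b j)"
    unfolding B_def by (simp add: specm_mult[OF V] tr_specm[OF V] sum_overlap_right[OF U V])
  have t7: "Re (tr (A * B)) = ?S (\<lambda>i j. a i * b j)"
    unfolding A_def B_def by (simp add: tr_specm_specm[OF U V])
  have D: "D = ?S (\<lambda>i j. a i * ln (a i) - a i * ln (b j) - a i + b j)"
    unfolding D_def t1 t2 t3 t4 by (simp add: sum.distrib sum_subtractf algebra_simps)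
  show "0 \<le> D" unfolding D
    by (intro sum_nonneg mult_nonneg_nonneg overlap_nonneg) (auto intro!: entropy_term_bounds[OF a \<beta> b])
  have AB: "A - B \<in> carrier_mat n n" using c by auto
  have "tr ((A - B) * (A - B)) = tr (A * A) - tr (A * B) - (tr (B * A) - tr (B * B))"
    by (simp add: tr_mult_distrib(4)[OF c AB] tr_mult_distrib(3)[OF c(1) c] tr_mult_distrib(3)[OF c(2) c])
  then have "Re (tr ((A - B) * (A - B))) = Re (tr (A * A)) - Re (tr (A * B)) - (Re (tr (A * B)) - Re (tr (B * B)))"
    unfolding tr_mult_commute[OF c(2,1)] by simp
  also have "\<dots> = ?S (\<lambda>i j. (a i - b j)\<^sup>2)"
    unfolding t5 t6 t7 sum_subtractf[symmetric]
    by (intro sum.cong refl) (simp add: power2_eq_square algebra_simps)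
  finally have Q: "Re (tr ((A - B) * (A - B))) = ?S (\<lambda>i j. (a i - b j)\<^sup>2)" .
  have "D \<le> ?S (\<lambda>i j. (a i - b j)\<^sup>2 / \<beta>)" unfolding D
    by (intro sum_mono mult_left_mono overlap_nonneg) (auto intro!: entropy_term_bounds[OF a \<beta> b])
  also have "\<dots> = ?S (\<lambda>i j. (a i - b j)\<^sup>2) / \<beta>" by (simp add: sum_divide_distrib)
  finally show "D \<le> Re (tr ((A - B) * (A - B))) / \<beta>" unfolding Q .
qed

section \<open>Perturbation of positive definite operators and the entropy derivative\<close>

lemma posdef_spectral_bound:
  assumes "posdef_op n A"
  obtains U \<mu> \<beta> where "unitary_op n U" "A = specm n U \<mu>" "\<beta> > 0" "\<And>k. k < n \<Longrightarrow> \<mu> k \<ge> \<beta>"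
proof -
  obtain U \<mu> where U: "unitary_op n U" "A = specm n U \<mu>" and pos: "\<And>k. k < n \<Longrightarrow> \<mu> k > 0"
    using posdef_spectral[OF assms] by blast
  \<comment> \<open>The element 1 keeps the set nonempty when \<open>n = 0\<close>.\<close>
  let ?\<beta> = "Min (insert 1 (\<mu> ` {..<n}))"
  have "?\<beta> > 0" using pos by (subst Min_gr_iff) auto
  moreover have "\<mu> k \<ge> ?\<beta>" if "k < n" for k using that by (intro Min_le) auto
  ultimately show thesis using that U by blast
qed

text \<open>The first factor is the projection onto the \<open>k\<close>-th vector of the
  eigenbasis. Since the trace is linear in the second factor, this gives access to eigenvalues of
  sums and of partial traces.\<close>

lemma eigenvalue_as_trace:
  assumes U: "unitary_op n U" and k: "k < n"
  shows "\<mu> k = Re (tr (specm n U (\<lambda>i. if i = k then 1 else 0) * specm n U \<mu>))"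
proof -
  have "(\<Sum>i<n. (if i = k then 1 else 0) * \<mu> i) = \<mu> k"
    using k by (subst sum.remove[of _ k]) auto
  then show ?thesis by (simp add: specm_mult[OF U] tr_specm[OF U])
qed

text \<open>An eigenvalue of the perturbed operator is a weighted mean of eigenvalues of
  \<open>S\<close>, hence at least \<open>\<beta>\<close>, plus \<open>t\<close> times a weighted
  mean of eigenvalues of \<open>X\<close>, hence of modulus at most \<open>M\<close>. So
  \<open>\<beta> / M\<close> is a safe radius, and continuity of eigenvalues does not enter.\<close>

lemma posdef_perturb:
  assumes S: "posdef_op n S" and X: "hermitian_op n X"
  obtains \<delta> where "\<delta> > 0" "\<And>t. \<bar>t\<bar> < \<delta> \<Longrightarrow> posdef_op n (S + complex_of_real t \<cdot>\<^sub>m X)"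
proof -
  obtain V b \<beta> where V: "unitary_op n V" and S_eq: "S = specm n V b" and \<beta>: "\<beta> > 0"
    and b: "\<And>k. k < n \<Longrightarrow> b k \<ge> \<beta>" using posdef_spectral_bound[OF S] by blast
  obtain W x where W: "unitary_op n W" and X_eq: "X = specm n W x" using hermitian_spectral[OF X] by blast
  \<comment> \<open>The summand 1 makes \<open>M\<close> positive even for \<open>X = 0\<close>, so
    that dividing by it is meaningful.\<close>
  define M where "M = 1 + (\<Sum>k<n. \<bar>x k\<bar>)"
  have M: "M > 0" unfolding M_def by (simp add: add_pos_nonneg sum_nonneg)
  have xM: "\<bar>x k\<bar> \<le> M" if "k < n" for k
    unfolding M_def using member_le_sum[of k "{..<n}" "\<lambda>k. \<bar>x k\<bar>"] that by simp
  have "posdef_op n (S + complex_of_real t \<cdot>\<^sub>m X)" if t: "\<bar>t\<bar> < \<beta> / M" for t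
  proof -
    have h: "hermitian_op n (S + complex_of_real t \<cdot>\<^sub>m X)"
      using posdef_opD[OF S] X by (intro hermitian_add hermitian_smult)
    obtain U a where U: "unitary_op n U" and eq: "S + complex_of_real t \<cdot>\<^sub>m X = specm n U a"
      using hermitian_spectral[OF h] by blast
    have "a k > 0" if k: "k < n" for k
    proof -
      let ?e = "\<lambda>i. if i = k then 1 else 0 :: real"
      let ?E = "specm n U ?e"
      have row: "Re (tr (?E * specm n V' g)) = (\<Sum>j<n. overlap U V' k j * g j)" if "unitary_op n V'" for V' g
      proof -
        have "(\<Sum>i<n. \<Sum>j<n. overlap U V' i j * (?e i * g j)) = (\<Sum>i<n. if i = k then (\<Sum>j<n. overlap U V' i j * g j) else 0)"
          by (intro sum.cong) auto
        then show ?thesis using k by (simp add: tr_specm_specm[OF U that])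
      qed
      have "a k = Re (tr (?E * (S + complex_of_real t \<cdot>\<^sub>m X)))"
        unfolding eq by (rule eigenvalue_as_trace[OF U k])
      also have "\<dots> = Re (tr (?E * S)) + t * Re (tr (?E * X))"
        using specm_carrier[OF U] specm_carrier[OF V] specm_carrier[OF W]
        by (simp add: S_eq X_eq tr_mult_distrib(1)[of _ n] tr_mult_smult(1)[of _ n])
      also have "\<dots> = (\<Sum>j<n. overlap U V k j * b j) + t * (\<Sum>j<n. overlap U W k j * x j)"
        unfolding S_eq X_eq by (simp add: row[OF V] row[OF W])
      finally have ak: "a k = (\<Sum>j<n. overlap U V k j * b j) + t * (\<Sum>j<n. overlap U W k j * x j)" .
      have "\<beta> = (\<Sum>j<n. overlap U V k j * \<beta>)"
        using sum_overlap(1)[OF U V k] by (simp flip: sum_distrib_right)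
      also have "\<dots> \<le> (\<Sum>j<n. overlap U V k j * b j)"
        using b by (intro sum_mono mult_left_mono overlap_nonneg) auto
      finally have 1: "\<beta> \<le> (\<Sum>j<n. overlap U V k j * b j)" .
      have "\<bar>\<Sum>j<n. overlap U W k j * x j\<bar> \<le> (\<Sum>j<n. \<bar>overlap U W k j * x j\<bar>)" by (rule sum_abs)
      also have "\<dots> \<le> (\<Sum>j<n. overlap U W k j * M)"
        using xM by (intro sum_mono) (auto simp: abs_mult overlap_nonneg intro!: mult_left_mono)
      also have "\<dots> = M" using sum_overlap(1)[OF U W k] by (simp flip: sum_distrib_right)
      finally have "\<bar>\<Sum>j<n. overlap U W k j * x j\<bar> \<le> M" .
      then have "\<bar>t * (\<Sum>j<n. overlap U W k j * x j)\<bar> \<le> \<bar>t\<bar> * M"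
        by (simp add: abs_mult mult_left_mono)
      also have "\<dots> < \<beta>" using t M by (simp add: field_simps)
      finally show "a k > 0" using ak 1 by linarith
    qed
    then show ?thesis unfolding eq using posdef_specm_iff[OF U] by blast
  qed
  then show thesis using that[of "\<beta> / M"] \<beta> M by simp
qed

lemma has_real_derivative_quadratic_bound:
  fixes \<phi> :: "real \<Rightarrow> real"
  assumes "\<delta> > 0" and bound: "\<And>t. \<bar>t\<bar> < \<delta> \<Longrightarrow> \<bar>\<phi> t - \<phi> 0 - t * L\<bar> \<le> K * t\<^sup>2"
  shows "(\<phi> has_real_derivative L) (at 0)"
proof -
  have "((\<lambda>h. (\<phi> (0 + h) - \<phi> 0) / h - L) \<longlongrightarrow> 0) (at 0)"
  proof (rule Lim_null_comparison)
    show "\<forall>\<^sub>F h in at 0. norm ((\<phi> (0 + h) - \<phi> 0) / h - L) \<le> \<bar>K\<bar> * \<bar>h\<bar>"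
      unfolding eventually_at
    proof (intro exI[of _ \<delta>] conjI ballI impI assms(1))
      fix h :: real assume "h \<noteq> 0 \<and> dist h 0 < \<delta>"
      then have h: "h \<noteq> 0" "\<bar>h\<bar> < \<delta>" by auto
      have "norm ((\<phi> (0 + h) - \<phi> 0) / h - L) = \<bar>\<phi> h - \<phi> 0 - h * L\<bar> / \<bar>h\<bar>"
        using h by (simp add: field_simps flip: abs_divide)
      also have "\<dots> \<le> (K * h\<^sup>2) / \<bar>h\<bar>" using bound[OF h(2)] by (intro divide_right_mono) auto
      also have "\<dots> = K * \<bar>h\<bar>" using h by (simp add: power2_eq_square field_simps)
      also have "\<dots> \<le> \<bar>K\<bar> * \<bar>h\<bar>" by (intro mult_right_mono) auto
      finally show "norm ((\<phi> (0 + h) - \<phi> 0) / h - L) \<le> \<bar>K\<bar> * \<bar>h\<bar>" .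
    qed
    show "((\<lambda>h. \<bar>K\<bar> * \<bar>h\<bar>) \<longlongrightarrow> 0) (at (0::real))"
      by (auto intro!: tendsto_eq_intros)
  qed
  then show ?thesis unfolding DERIV_def by (simp add: LIM_zero_iff)
qed

theorem entropy_has_derivative:
  assumes S: "posdef_op n S" and X: "hermitian_op n X"
  shows "((\<lambda>t. Re (tr ((S + complex_of_real t \<cdot>\<^sub>m X) * mlog (S + complex_of_real t \<cdot>\<^sub>m X))))
    has_real_derivative Re (tr (X * mlog S)) + Re (tr X)) (at 0)"
proof -
  obtain V b \<beta> where V: "unitary_op n V" and S_eq: "S = specm n V b" and \<beta>: "\<beta> > 0"
    and b: "\<And>k. k < n \<Longrightarrow> b k \<ge> \<beta>" using posdef_spectral_bound[OF S] by blast
  obtain \<delta> where \<delta>: "\<delta> > 0" "\<And>t. \<bar>t\<bar> < \<delta> \<Longrightarrow> posdef_op n (S + complex_of_real t \<cdot>\<^sub>m X)"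
    using posdef_perturb[OF S X] by blast
  have c: "S \<in> carrier_mat n n" "X \<in> carrier_mat n n" "mlog S \<in> carrier_mat n n"
    using posdef_opD[OF S] hermitian_opD(1)[OF X] mlog_hermitian[OF S] hermitian_opD(1) by auto
  let ?A = "\<lambda>t. S + complex_of_real t \<cdot>\<^sub>m X"
  let ?\<phi> = "\<lambda>t. Re (tr (?A t * mlog (?A t)))"
  let ?L = "Re (tr (X * mlog S)) + Re (tr X)"
  have "\<bar>?\<phi> t - ?\<phi> 0 - t * ?L\<bar> \<le> (Re (tr (X * X)) / \<beta>) * t\<^sup>2" if t: "\<bar>t\<bar> < \<delta>" for t
  proof -
    obtain U a where U: "unitary_op n U" and eq: "?A t = specm n U a" and a: "\<And>k. k < n \<Longrightarrow> a k > 0"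
      using posdef_spectral[OF \<delta>(2)[OF t]] by blast
    let ?D = "Re (tr (?A t * mlog (?A t))) - Re (tr (?A t * mlog S)) - Re (tr (?A t)) + Re (tr S)"
    have D: "0 \<le> ?D" "?D \<le> Re (tr ((?A t - S) * (?A t - S))) / \<beta>"
      unfolding eq unfolding S_eq by (rule relative_entropy_bounds[OF U V a b \<beta>]; assumption)+
    have "?A t - S = complex_of_real t \<cdot>\<^sub>m X" using c by (intro eq_matI) auto
    then have "tr ((?A t - S) * (?A t - S)) = complex_of_real t * (complex_of_real t * tr (X * X))"
      using c by (simp add: tr_mult_smult(1)[of _ n] tr_mult_smult(2)[of _ n])
    then have Q: "Re (tr ((?A t - S) * (?A t - S))) = Re (tr (X * X)) * t\<^sup>2"
      by (simp add: power2_eq_square)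
    have "?A 0 = S" using c by (intro eq_matI) auto
    then have \<phi>0: "?\<phi> 0 = Re (tr (S * mlog S))" by simp
    have tX: "complex_of_real t \<cdot>\<^sub>m X \<in> carrier_mat n n" using c by simp
    \<comment> \<open>The relative entropy is exactly the first-order remainder, because its two
      other \<open>t\<close>-dependent terms, the trace against \<open>mlog S\<close> and the plain
      trace, are affine in \<open>t\<close>.\<close>
    have "?D = ?\<phi> t - ?\<phi> 0 - t * ?L"
      unfolding \<phi>0 tr_mult_distrib(2)[OF c(1) tX c(3)] tr_mult_smult(2)[OF c(2,3)] tr_add[OF c(1) tX]
        tr_smult[OF c(2)] by (simp add: algebra_simps)
    then show ?thesis using D unfolding Q by simp
  qed
  then show ?thesis by (rule has_real_derivative_quadratic_bound[OF \<delta>(1)])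
qed

section \<open>Tensor products and partial traces\<close>

text \<open>The dimension is a parameter so that the empty sum is the \<open>n\<close> by
  \<open>n\<close> zero matrix; on logarithms this is the counterpart of an empty star product being
  the identity.\<close>

definition msum :: "nat \<Rightarrow> ('k \<Rightarrow> complex mat) \<Rightarrow> 'k set \<Rightarrow> complex mat" where
  "msum n F K = mat n n (\<lambda>(i, j). \<Sum>k\<in>K. F k $$ (i, j))"

lemma msum_carrier [simp]: "msum n F K \<in> carrier_mat n n"
  and msum_dim [simp]: "dim_row (msum n F K) = n" "dim_col (msum n F K) = n"
  and msum_index [simp]: "i < n \<Longrightarrow> j < n \<Longrightarrow> msum n F K $$ (i, j) = (\<Sum>k\<in>K. F k $$ (i, j))"
  unfolding msum_def by auto

lemma msum_empty: "msum n F {} = 0\<^sub>m n n"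
  by (rule eq_matI) auto

lemma msum_insert:
  assumes "finite K" "k \<notin> K" "F k \<in> carrier_mat n n"
  shows "msum n F (insert k K) = F k + msum n F K"
  using assms by (intro eq_matI) auto

lemma msum_cong: "(\<And>k. k \<in> K \<Longrightarrow> F k = F' k) \<Longrightarrow> msum n F K = msum n F' K"
  unfolding msum_def by (simp cong: sum.cong)

lemma msum_hermitian:
  assumes "\<And>k. k \<in> K \<Longrightarrow> hermitian_op n (F k)"
  shows "hermitian_op n (msum n F K)"
proof (rule hermitian_opI)
  fix i j assume ij: "i < n" "j < n"
  show "msum n F K $$ (i, j) = cnj (msum n F K $$ (j, i))"
    unfolding msum_index[OF ij] msum_index[OF ij(2,1)] cnj_sum
    by (rule sum.cong[OF refl]) (rule hermitian_op_index[OF assms ij])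
qed simp

lemma msum_specm:
  assumes U: "unitary_op n U"
  shows "msum n (\<lambda>k. specm n U (\<mu> k)) K = specm n U (\<lambda>l. \<Sum>k\<in>K. \<mu> k l)"
proof (rule eq_matI)
  fix i j assume "i < dim_row (specm n U (\<lambda>l. \<Sum>k\<in>K. \<mu> k l))" "j < dim_col (specm n U (\<lambda>l. \<Sum>k\<in>K. \<mu> k l))"
  then have ij: "i < n" "j < n" using specm_dim[OF U] by auto
  show "msum n (\<lambda>k. specm n U (\<mu> k)) K $$ (i, j) = specm n U (\<lambda>l. \<Sum>k\<in>K. \<mu> k l) $$ (i, j)"
    unfolding msum_index[OF ij] specm_index[OF U ij]
    by (subst sum.swap) (simp add: sum_distrib_left sum_distrib_right)
qed (use specm_dim[OF U] in auto)

lemma tr_mult_msum: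
  assumes "A \<in> carrier_mat n n" "\<And>k. k \<in> K \<Longrightarrow> F k \<in> carrier_mat n n"
  shows "tr (A * msum n F K) = (\<Sum>k\<in>K. tr (A * F k))"
proof -
  have "tr (A * msum n F K) = (\<Sum>i<n. \<Sum>j<n. \<Sum>k\<in>K. A $$ (i, j) * F k $$ (j, i))"
    unfolding tr_mult_sum[OF assms(1) msum_carrier] by (intro sum.cong refl) (auto simp: sum_distrib_left)
  also have "\<dots> = (\<Sum>i<n. \<Sum>k\<in>K. \<Sum>j<n. A $$ (i, j) * F k $$ (j, i))"
    by (rule sum.cong[OF refl], rule sum.swap)
  also have "\<dots> = (\<Sum>k\<in>K. \<Sum>i<n. \<Sum>j<n. A $$ (i, j) * F k $$ (j, i))"
    by (rule sum.swap)
  also have "\<dots> = (\<Sum>k\<in>K. tr (A * F k))"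
    by (rule sum.cong[OF refl]) (simp add: tr_mult_sum[OF assms(1) assms(2)])
  finally show ?thesis .
qed

text \<open>\<^const>\<open>star\<close> is left-commutative only on positive definite arguments, so the general fold
  lemmas do not apply; every derivation in the fold graph is evaluated instead.\<close>

lemma fold_graph_star:
  assumes "fold_graph (\<lambda>k A. M k \<star> A) (1\<^sub>m n) K B" "finite K" "\<And>k. k \<in> K \<Longrightarrow> posdef_op n (M k)"
  shows "B = mexp (msum n (\<lambda>k. mlog (M k)) K)"
  using assms
proof (induction rule: fold_graph.induct)
  case emptyI
  have "mexp (0\<^sub>m n n) = 1\<^sub>m n" using mexp_mlog[OF posdef_one] by (simp add: mlog_one)
  then show ?case by (simp add: msum_empty)
next
  case (insertI x A y)
  then have y: "y = mexp (msum n (\<lambda>k. mlog (M k)) A)" by simp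
  have h: "hermitian_op n (msum n (\<lambda>k. mlog (M k)) A)"
    using insertI by (intro msum_hermitian mlog_hermitian) auto
  have "msum n (\<lambda>k. mlog (M k)) (insert x A) = mlog (M x) + msum n (\<lambda>k. mlog (M k)) A"
    using insertI hermitian_opD(1)[OF mlog_hermitian] by (intro msum_insert) auto
  then show ?case unfolding star_def y mlog_mexp[OF h] by simp
qed

lemma big_star_eq:
  assumes "finite K" "\<And>k. k \<in> K \<Longrightarrow> posdef_op n (M k)"
  shows "big_star n M K = mexp (msum n (\<lambda>k. mlog (M k)) K)"
proof -
  let ?E = "mexp (msum n (\<lambda>k. mlog (M k)) K)"
  have unique: "C = ?E" if "fold_graph (\<lambda>k A. M k \<star> A) (1\<^sub>m n) K C" for C
    by (rule fold_graph_star[where M = M, OF that assms(1)]) (rule assms(2))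
  obtain B where B: "fold_graph (\<lambda>k A. M k \<star> A) (1\<^sub>m n) K B"
    using finite_imp_fold_graph[OF assms(1), of "\<lambda>k A. M k \<star> A" "1\<^sub>m n"] by (rule exE)
  have "(THE C. fold_graph (\<lambda>k A. M k \<star> A) (1\<^sub>m n) K C) = ?E"
    using B unique[OF B] by (intro the_equality unique) simp_all
  then show ?thesis unfolding big_star_def Finite_Set.fold_def using assms(1) by simp
qed

lemma big_star_posdef:
  assumes "finite K" "\<And>k. k \<in> K \<Longrightarrow> posdef_op n (M k)"
  shows "posdef_op n (big_star n M K)" "mlog (big_star n M K) = msum n (\<lambda>k. mlog (M k)) K"
proof -
  have "hermitian_op n (msum n (\<lambda>k. mlog (M k)) K)"
    using assms by (intro msum_hermitian mlog_hermitian) auto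
  moreover have "big_star n M K = mexp (msum n (\<lambda>k. mlog (M k)) K)"
    using assms by (rule big_star_eq)
  ultimately show "posdef_op n (big_star n M K)" "mlog (big_star n M K) = msum n (\<lambda>k. mlog (M k)) K"
    by (simp_all add: mexp_posdef mlog_mexp)
qed

text \<open>The product set has \<open>tdim d S\<close> elements, so the \<open>SOME\<close> in the
  definition has a witness. Bijectivity is the only property of the enumeration that is ever
  extracted.\<close>

lemma basis_cfg_bij:
  assumes "finite S"
  shows "bij_betw (basis_cfg d S) {..<tdim d S} (\<Pi>\<^sub>E i\<in>S. {..<d i})"
proof -
  have "card (\<Pi>\<^sub>E i\<in>S. {..<d i}) = tdim d S"
    using assms by (simp add: card_PiE tdim_def)
  moreover have "finite (\<Pi>\<^sub>E i\<in>S. {..<d i})" using assms by (intro finite_PiE) auto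
  ultimately have "\<exists>f. bij_betw f {..<tdim d S} (\<Pi>\<^sub>E i\<in>S. {..<d i})"
    by (intro finite_same_card_bij) auto
  then show ?thesis unfolding basis_cfg_def by (rule someI_ex)
qed

section \<open>Product bases, tensor products and embedded local operators\<close>

context
  fixes d :: "'v \<Rightarrow> nat" and S :: "'v set"
  assumes S: "finite S"
begin

lemma basis_cfg_less: "u < tdim d S \<Longrightarrow> k \<in> S \<Longrightarrow> basis_cfg d S u k < d k"
  using bij_betwE[OF basis_cfg_bij[OF S, of d]] by (auto simp: PiE_def Pi_def)

lemma basis_cfg_eq_iff:
  assumes "u < tdim d S" "w < tdim d S"
  shows "u = w \<longleftrightarrow> (\<forall>k\<in>S. basis_cfg d S u k = basis_cfg d S w k)"
proof
  assume "\<forall>k\<in>S. basis_cfg d S u k = basis_cfg d S w k"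
  moreover have "basis_cfg d S u \<in> (\<Pi>\<^sub>E i\<in>S. {..<d i})" "basis_cfg d S w \<in> (\<Pi>\<^sub>E i\<in>S. {..<d i})"
    using bij_betwE[OF basis_cfg_bij[OF S, of d]] assms by auto
  ultimately have "basis_cfg d S u = basis_cfg d S w" by (intro PiE_ext) auto
  then show "u = w"
    using bij_betw_imp_inj_on[OF basis_cfg_bij[OF S, of d]] assms by (auto simp: inj_on_def)
qed simp

lemma basis_cfg_surj:
  assumes "\<And>k. k \<in> S \<Longrightarrow> x k < d k"
  shows "\<exists>u<tdim d S. \<forall>k\<in>S. basis_cfg d S u k = x k"
proof -
  have "restrict x S \<in> (\<Pi>\<^sub>E i\<in>S. {..<d i})" using assms by auto
  then obtain u where "u < tdim d S" "basis_cfg d S u = restrict x S"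
    using bij_betw_imp_surj_on[OF basis_cfg_bij[OF S, of d]] by (metis imageE lessThan_iff)
  then show ?thesis by auto
qed

lemma sum_basis_cfg: "(\<Sum>u<tdim d S. F (basis_cfg d S u)) = (\<Sum>x\<in>(\<Pi>\<^sub>E i\<in>S. {..<d i}). F x)"
  by (rule sum.reindex_bij_betw[OF basis_cfg_bij[OF S]])

lemma tensor_op_carrier [simp]: "tensor_op d S M \<in> carrier_mat (tdim d S) (tdim d S)"
  and tensor_op_dim [simp]: "dim_row (tensor_op d S M) = tdim d S" "dim_col (tensor_op d S M) = tdim d S"
  unfolding tensor_op_def by auto

lemma tensor_op_index:
  assumes "u < tdim d S" "w < tdim d S"
  shows "tensor_op d S M $$ (u, w) = (\<Prod>k\<in>S. M k $$ (basis_cfg d S u k, basis_cfg d S w k))"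
  using assms unfolding tensor_op_def by simp

lemma tensor_op_cong: "(\<And>k. k \<in> S \<Longrightarrow> M k = M' k) \<Longrightarrow> tensor_op d S M = tensor_op d S M'"
  unfolding tensor_op_def by (simp cong: prod.cong)

text \<open>Summing over joint configurations is summing over every coordinate independently, so
  distributivity in the form \<open>prod_sum_PiE\<close> turns the sum of products into a product of
  matrix entries.\<close>

lemma tensor_op_mult:
  assumes M: "\<And>k. k \<in> S \<Longrightarrow> M k \<in> carrier_mat (d k) (d k)" and N: "\<And>k. k \<in> S \<Longrightarrow> N k \<in> carrier_mat (d k) (d k)"
  shows "tensor_op d S M * tensor_op d S N = tensor_op d S (\<lambda>k. M k * N k)"
proof (rule eq_matI)
  let ?c = "basis_cfg d S"
  fix u w assume "u < dim_row (tensor_op d S (\<lambda>k. M k * N k))" "w < dim_col (tensor_op d S (\<lambda>k. M k * N k))"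
  then have uw: "u < tdim d S" "w < tdim d S" by auto
  have "(tensor_op d S M * tensor_op d S N) $$ (u, w) =
      (\<Sum>v<tdim d S. \<Prod>k\<in>S. M k $$ (?c u k, ?c v k) * N k $$ (?c v k, ?c w k))"
    unfolding index_mult_mat_sum[OF tensor_op_carrier tensor_op_carrier uw] prod.distrib
    by (rule sum.cong) (simp_all add: tensor_op_index uw)
  also have "\<dots> = (\<Sum>x\<in>(\<Pi>\<^sub>E i\<in>S. {..<d i}). \<Prod>k\<in>S. M k $$ (?c u k, x k) * N k $$ (x k, ?c w k))"
    by (rule sum_basis_cfg)
  also have "\<dots> = (\<Prod>k\<in>S. \<Sum>l<d k. M k $$ (?c u k, l) * N k $$ (l, ?c w k))"
    using S by (intro prod_sum_PiE[symmetric]) auto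
  also have "\<dots> = (\<Prod>k\<in>S. (M k * N k) $$ (?c u k, ?c w k))"
    by (rule prod.cong[OF refl]) (simp only: index_mult_mat_sum[OF M N] basis_cfg_less uw)
  also have "\<dots> = tensor_op d S (\<lambda>k. M k * N k) $$ (u, w)"
    by (rule tensor_op_index[OF uw, symmetric])
  finally show "(tensor_op d S M * tensor_op d S N) $$ (u, w) = tensor_op d S (\<lambda>k. M k * N k) $$ (u, w)" .
qed auto

lemma tensor_op_adjoint:
  assumes "\<And>k. k \<in> S \<Longrightarrow> M k \<in> carrier_mat (d k) (d k)"
  shows "mat_adjoint (tensor_op d S M) = tensor_op d S (\<lambda>k. mat_adjoint (M k))"
proof (rule eq_matI)
  fix u w assume "u < dim_row (tensor_op d S (\<lambda>k. mat_adjoint (M k)))" "w < dim_col (tensor_op d S (\<lambda>k. mat_adjoint (M k)))"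
  then have uw: "u < tdim d S" "w < tdim d S" by auto
  have "basis_cfg d S u k < dim_col (M k)" "basis_cfg d S w k < dim_row (M k)" if "k \<in> S" for k
    using assms[OF that] basis_cfg_less uw that by auto
  then show "mat_adjoint (tensor_op d S M) $$ (u, w) = tensor_op d S (\<lambda>k. mat_adjoint (M k)) $$ (u, w)"
    using uw by (simp add: tensor_op_index cong: prod.cong)
qed auto

lemma tensor_op_one: "tensor_op d S (\<lambda>k. 1\<^sub>m (d k)) = 1\<^sub>m (tdim d S)"
proof (rule eq_matI)
  fix u w assume "u < dim_row (1\<^sub>m (tdim d S) :: complex mat)" "w < dim_col (1\<^sub>m (tdim d S) :: complex mat)"
  then have uw: "u < tdim d S" "w < tdim d S" by auto
  have "tensor_op d S (\<lambda>k. 1\<^sub>m (d k)) $$ (u, w) =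
      (\<Prod>k\<in>S. if basis_cfg d S u k = basis_cfg d S w k then 1 else 0)"
    unfolding tensor_op_index[OF uw] by (rule prod.cong) (auto simp: basis_cfg_less uw)
  also have "\<dots> = (if u = w then 1 else 0)"
    using S by (auto simp: basis_cfg_eq_iff[OF uw] prod_zero_iff)
  finally show "tensor_op d S (\<lambda>k. 1\<^sub>m (d k)) $$ (u, w) = 1\<^sub>m (tdim d S) $$ (u, w)" using uw by simp
qed auto

lemma tensor_op_unitary:
  assumes "\<And>k. k \<in> S \<Longrightarrow> unitary_op (d k) (U k)"
  shows "unitary_op (tdim d S) (tensor_op d S U)"
proof -
  note u = unitary_opD[OF assms]
  have "mat_adjoint (tensor_op d S U) * tensor_op d S U = tensor_op d S (\<lambda>k. mat_adjoint (U k) * U k)"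
    using u by (simp add: tensor_op_adjoint tensor_op_mult)
  also have "\<dots> = 1\<^sub>m (tdim d S)"
    unfolding tensor_op_one[symmetric] by (rule tensor_op_cong) (rule u(6))
  finally show ?thesis by (intro unitary_opI tensor_op_carrier)
qed

text \<open>Products of eigenvectors are eigenvectors, with the products of the eigenvalues. The
  proof is again the expansion \<open>prod_sum_PiE\<close>.\<close>

lemma tensor_specm:
  assumes U: "\<And>k. k \<in> S \<Longrightarrow> unitary_op (d k) (U k)"
  shows "tensor_op d S (\<lambda>k. specm (d k) (U k) (\<mu> k)) =
    specm (tdim d S) (tensor_op d S U) (\<lambda>u. \<Prod>k\<in>S. \<mu> k (basis_cfg d S u k))"
    (is "?L = ?R")
proof (rule eq_matI)
  let ?c = "basis_cfg d S"
  have UU: "unitary_op (tdim d S) (tensor_op d S U)" by (rule tensor_op_unitary[OF U])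
  note dimR = specm_dim[OF UU]
  fix u w assume "u < dim_row ?R" "w < dim_col ?R"
  then have uw: "u < tdim d S" "w < tdim d S" using dimR by auto
  have "?L $$ (u, w) = (\<Prod>k\<in>S. \<Sum>l<d k. U k $$ (?c u k, l) * \<mu> k l * cnj (U k $$ (?c w k, l)))"
    unfolding tensor_op_index[OF uw]
    by (rule prod.cong[OF refl]) (simp only: specm_index[OF U] basis_cfg_less uw)
  also have "\<dots> = (\<Sum>x\<in>(\<Pi>\<^sub>E i\<in>S. {..<d i}). \<Prod>k\<in>S. U k $$ (?c u k, x k) * \<mu> k (x k) * cnj (U k $$ (?c w k, x k)))"
    using S by (intro prod_sum_PiE) auto
  also have "\<dots> = (\<Sum>v<tdim d S. \<Prod>k\<in>S. U k $$ (?c u k, ?c v k) * \<mu> k (?c v k) * cnj (U k $$ (?c w k, ?c v k)))"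
    by (rule sum_basis_cfg[symmetric])
  also have "\<dots> = ?R $$ (u, w)"
    unfolding specm_index[OF UU uw]
    by (rule sum.cong) (simp_all add: tensor_op_index uw prod.distrib)
  finally show "?L $$ (u, w) = ?R $$ (u, w)" .
qed (use specm_dim[OF tensor_op_unitary[OF U]] in auto)

text \<open>At the other sites the identity has constant spectrum 1 in every basis, so arbitrary
  unitaries may be used there. Hence local operators at different sites become diagonal in one
  common product basis.\<close>

lemma embed_specm:
  assumes U: "\<And>k. k \<in> S \<Longrightarrow> unitary_op (d k) (U k)" and i: "i \<in> S"
  shows "embed_op d S i (specm (d i) (U i) \<nu>) =
    specm (tdim d S) (tensor_op d S U) (\<lambda>u. \<nu> (basis_cfg d S u i))"
proof -
  have "embed_op d S i (specm (d i) (U i) \<nu>) =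
      tensor_op d S (\<lambda>k. specm (d k) (U k) (if k = i then \<nu> else (\<lambda>_. 1)))"
    unfolding embed_op_def
    by (rule tensor_op_cong) (use specm_const[OF U, of _ 1] in auto)
  also have "\<dots> = specm (tdim d S) (tensor_op d S U)
      (\<lambda>u. \<Prod>k\<in>S. (if k = i then \<nu> else (\<lambda>_. 1)) (basis_cfg d S u k))"
    by (rule tensor_specm[OF U])
  also have "(\<lambda>u. \<Prod>k\<in>S. (if k = i then \<nu> else (\<lambda>_. 1)) (basis_cfg d S u k)) = (\<lambda>u. \<nu> (basis_cfg d S u i))"
    (is "?l = ?r")
  proof
    fix u
    have "?l u = (\<Prod>k\<in>S. if k = i then \<nu> (basis_cfg d S u k) else 1)" by (rule prod.cong) auto
    then show "?l u = ?r u" using S i by (simp add: prod.delta)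
  qed
  finally show ?thesis .
qed

lemma embed_op_carrier [simp]: "embed_op d S i A \<in> carrier_mat (tdim d S) (tdim d S)"
  unfolding embed_op_def by simp

text \<open>One \<open>W\<close> serves all \<open>\<nu>\<close> at once; this uniformity is what
  lets functional calculus commute with the embedding.\<close>

lemma embed_specm_single:
  assumes V: "unitary_op (d i) V" and i: "i \<in> S"
  obtains W where "unitary_op (tdim d S) W"
    "\<And>\<nu>. embed_op d S i (specm (d i) V \<nu>) = specm (tdim d S) W (\<lambda>u. \<nu> (basis_cfg d S u i))"
proof -
  let ?U = "\<lambda>k. if k = i then V else 1\<^sub>m (d k)"
  have U: "unitary_op (d k) (?U k)" for k using V unitary_op_one by simp
  show thesis using that[OF tensor_op_unitary[OF U]] embed_specm[OF U i] by simp
qed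

lemma embed_hermitian:
  assumes "hermitian_op (d i) A" "i \<in> S"
  shows "hermitian_op (tdim d S) (embed_op d S i A)"
proof -
  obtain V \<mu> where V: "unitary_op (d i) V" "A = specm (d i) V \<mu>" using hermitian_spectral[OF assms(1)] by blast
  obtain W where "unitary_op (tdim d S) W"
    "\<And>\<nu>. embed_op d S i (specm (d i) V \<nu>) = specm (tdim d S) W (\<lambda>u. \<nu> (basis_cfg d S u i))"
    using embed_specm_single[of i V, OF V(1) assms(2)] by blast
  then show ?thesis unfolding V(2) by (simp add: specm_hermitian)
qed

lemma embed_posdef:
  assumes "posdef_op (d i) A" "i \<in> S"
  shows "posdef_op (tdim d S) (embed_op d S i A)" "mlog (embed_op d S i A) = embed_op d S i (mlog A)"
proof -
  obtain V \<mu> where V: "unitary_op (d i) V" "A = specm (d i) V \<mu>" and pos: "\<And>k. k < d i \<Longrightarrow> \<mu> k > 0"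
    using posdef_spectral[OF assms(1)] by blast
  obtain W where W: "unitary_op (tdim d S) W"
    "\<And>\<nu>. embed_op d S i (specm (d i) V \<nu>) = specm (tdim d S) W (\<lambda>u. \<nu> (basis_cfg d S u i))"
    using embed_specm_single[of i V, OF V(1) assms(2)] by blast
  show "posdef_op (tdim d S) (embed_op d S i A)"
    unfolding V(2) W(2) posdef_specm_iff[OF W(1)] using pos basis_cfg_less[OF _ assms(2)] by blast
  show "mlog (embed_op d S i A) = embed_op d S i (mlog A)"
    unfolding V(2) by (simp add: W herm_fun_specm V(1))
qed

text \<open>In the product eigenbasis the formula for the logarithm is \<open>ln_prod\<close> on
  eigenvalues. It is the link between the tensor product of messages in an update and the star
  product of embedded messages in a belief.\<close>

lemma tensor_posdef:
  assumes "\<And>k. k \<in> S \<Longrightarrow> posdef_op (d k) (M k)"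
  shows "posdef_op (tdim d S) (tensor_op d S M)"
    "mlog (tensor_op d S M) = msum (tdim d S) (\<lambda>k. embed_op d S k (mlog (M k))) S"
proof -
  have "\<forall>k\<in>S. \<exists>V \<nu>. unitary_op (d k) V \<and> M k = specm (d k) V \<nu> \<and> (\<forall>l<d k. \<nu> l > 0)"
    using posdef_spectral[OF assms] by metis
  then obtain U \<mu> where U: "\<And>k. k \<in> S \<Longrightarrow> unitary_op (d k) (U k)"
    and M: "\<And>k. k \<in> S \<Longrightarrow> M k = specm (d k) (U k) (\<mu> k)"
    and pos: "\<And>k l. k \<in> S \<Longrightarrow> l < d k \<Longrightarrow> \<mu> k l > 0" by metis
  have T: "unitary_op (tdim d S) (tensor_op d S U)" by (rule tensor_op_unitary[OF U])
  have "tensor_op d S M = tensor_op d S (\<lambda>k. specm (d k) (U k) (\<mu> k))"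
    by (rule tensor_op_cong) (rule M)
  also have "\<dots> = specm (tdim d S) (tensor_op d S U) (\<lambda>u. \<Prod>k\<in>S. \<mu> k (basis_cfg d S u k))"
    by (rule tensor_specm[OF U])
  finally have eq: "tensor_op d S M = \<dots>" .
  show "posdef_op (tdim d S) (tensor_op d S M)"
    unfolding eq posdef_specm_iff[OF T] by (auto intro!: prod_pos pos basis_cfg_less)
  have "msum (tdim d S) (\<lambda>k. embed_op d S k (mlog (M k))) S =
      msum (tdim d S) (\<lambda>k. specm (tdim d S) (tensor_op d S U) (\<lambda>u. ln (\<mu> k (basis_cfg d S u k)))) S"
    by (rule msum_cong) (simp add: M herm_fun_specm[OF U] embed_specm[OF U])
  also have "\<dots> = specm (tdim d S) (tensor_op d S U) (\<lambda>u. \<Sum>k\<in>S. ln (\<mu> k (basis_cfg d S u k)))"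
    by (rule msum_specm[OF T])
  also have "\<dots> = specm (tdim d S) (tensor_op d S U) (\<lambda>u. ln (\<Prod>k\<in>S. \<mu> k (basis_cfg d S u k)))"
    by (rule specm_cong, rule ln_prod[symmetric, OF S])
      (rule less_imp_neq[THEN not_sym], rule pos, auto intro: basis_cfg_less)
  also have "\<dots> = mlog (tensor_op d S M)" unfolding eq by (simp add: herm_fun_specm[OF T])
  finally show "mlog (tensor_op d S M) = msum (tdim d S) (\<lambda>k. embed_op d S k (mlog (M k))) S" ..
qed

text \<open>Let \<open>\<zeta> k\<close> be the eigenvalues of \<open>Z k\<close>. In a common
  product eigenbasis the hypothesis says that the sum of the \<open>\<zeta> k (x k)\<close> is
  \<open>c\<close> for every configuration \<open>x\<close>; varying the coordinate at
  \<open>i\<close> alone shows that \<open>\<zeta> i\<close> is constant. Positive dimensions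
  provide the reference coordinate 0.\<close>

lemma embed_sum_scalar:
  assumes d: "\<And>k. k \<in> S \<Longrightarrow> d k \<ge> 1" and Z: "\<And>k. k \<in> S \<Longrightarrow> hermitian_op (d k) (Z k)"
    and eq: "msum (tdim d S) (\<lambda>k. embed_op d S k (Z k)) S = complex_of_real c \<cdot>\<^sub>m 1\<^sub>m (tdim d S)"
    and i: "i \<in> S"
  shows "\<exists>c'. Z i = complex_of_real c' \<cdot>\<^sub>m 1\<^sub>m (d i)"
proof -
  have "\<forall>k\<in>S. \<exists>V \<nu>. unitary_op (d k) V \<and> Z k = specm (d k) V \<nu>"
    using hermitian_spectral[OF Z] by blast
  then obtain U \<zeta> where U: "\<And>k. k \<in> S \<Longrightarrow> unitary_op (d k) (U k)"
    and ZU: "\<And>k. k \<in> S \<Longrightarrow> Z k = specm (d k) (U k) (\<zeta> k)" by metis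
  have T: "unitary_op (tdim d S) (tensor_op d S U)" by (rule tensor_op_unitary[OF U])
  have "specm (tdim d S) (tensor_op d S U) (\<lambda>_. c) = msum (tdim d S) (\<lambda>k. embed_op d S k (Z k)) S"
    unfolding eq by (rule specm_const[OF T])
  also have "\<dots> = msum (tdim d S) (\<lambda>k. specm (tdim d S) (tensor_op d S U) (\<lambda>u. \<zeta> k (basis_cfg d S u k))) S"
    by (rule msum_cong) (simp add: ZU embed_specm[OF U])
  also have "\<dots> = specm (tdim d S) (tensor_op d S U) (\<lambda>u. \<Sum>k\<in>S. \<zeta> k (basis_cfg d S u k))"
    by (rule msum_specm[OF T])
  finally have sp: "specm (tdim d S) (tensor_op d S U) (\<lambda>u. \<Sum>k\<in>S. \<zeta> k (basis_cfg d S u k))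
      = specm (tdim d S) (tensor_op d S U) (\<lambda>_. c)" ..
  \<comment> \<open>Equality of the matrices is turned into equality of eigenvalues by testing both
    against the same spectral projection.\<close>
  have sum: "(\<Sum>k\<in>S. \<zeta> k (basis_cfg d S u k)) = c" if "u < tdim d S" for u
    using eigenvalue_as_trace[OF T that, of "\<lambda>u. \<Sum>k\<in>S. \<zeta> k (basis_cfg d S u k)"]
      eigenvalue_as_trace[OF T that, of "\<lambda>_. c"] sp by simp
  have "\<zeta> i x = \<zeta> i 0" if x: "x < d i" for x
  proof -
    have d0: "0 < d k" if "k \<in> S" for k using d[OF that] by simp
    have "\<exists>u<tdim d S. \<forall>k\<in>S. basis_cfg d S u k = (if k = i then x else 0)"
      using x d0 by (intro basis_cfg_surj) auto
    then obtain u where u: "u < tdim d S" "\<forall>k\<in>S. basis_cfg d S u k = (if k = i then x else 0)"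
      by blast
    have "\<exists>w<tdim d S. \<forall>k\<in>S. basis_cfg d S w k = 0"
      using d0 by (intro basis_cfg_surj) auto
    then obtain w where w: "w < tdim d S" "\<forall>k\<in>S. basis_cfg d S w k = 0" by blast
    have "(\<Sum>k\<in>S. \<zeta> k (basis_cfg d S u k)) = \<zeta> i x + (\<Sum>k\<in>S - {i}. \<zeta> k 0)"
      using S i u(2) by (subst sum.remove[of _ i]) auto
    moreover have "(\<Sum>k\<in>S. \<zeta> k (basis_cfg d S w k)) = \<zeta> i 0 + (\<Sum>k\<in>S - {i}. \<zeta> k 0)"
      using S i w(2) by (subst sum.remove[of _ i]) auto
    ultimately show ?thesis using sum[OF u(1)] sum[OF w(1)] by simp
  qed
  then have "specm (d i) (U i) (\<zeta> i) = specm (d i) (U i) (\<lambda>_. \<zeta> i 0)" by (intro specm_cong)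
  then show ?thesis using ZU[OF i] specm_const[OF U[OF i]] by auto
qed

section \<open>Partial trace as the dual of the embedding\<close>

lemma ptrace_carrier [simp]: "ptrace d S i A \<in> carrier_mat (d i) (d i)"
  unfolding ptrace_def by simp

lemma ptrace_index:
  assumes "x < d i" "y < d i"
  shows "ptrace d S i A $$ (x, y) = (\<Sum>u<tdim d S. \<Sum>w<tdim d S.
    if basis_cfg d S u i = x \<and> basis_cfg d S w i = y \<and>
      (\<forall>k\<in>S - {i}. basis_cfg d S u k = basis_cfg d S w k) then A $$ (u, w) else 0)"
proof -
  let ?P = "\<lambda>u w. basis_cfg d S u i = x \<and> basis_cfg d S w i = y \<and>
      (\<forall>k\<in>S - {i}. basis_cfg d S u k = basis_cfg d S w k)"
  have "ptrace d S i A $$ (x, y) = (\<Sum>(u, w)\<in>{(u, w). u < tdim d S \<and> w < tdim d S \<and> ?P u w}. A $$ (u, w))"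
    using assms unfolding ptrace_def by simp
  also have "\<dots> = (\<Sum>(u, w)\<in>{..<tdim d S} \<times> {..<tdim d S}. if ?P u w then A $$ (u, w) else 0)"
    by (rule sum.mono_neutral_cong_left) (auto split: if_splits)
  finally show ?thesis unfolding sum.cartesian_product .
qed

lemma embed_op_index:
  assumes uw: "u < tdim d S" "w < tdim d S" and i: "i \<in> S"
  shows "embed_op d S i A $$ (u, w) = (if \<forall>k\<in>S - {i}. basis_cfg d S u k = basis_cfg d S w k
    then A $$ (basis_cfg d S u i, basis_cfg d S w i) else 0)"
proof -
  have "embed_op d S i A $$ (u, w) = A $$ (basis_cfg d S u i, basis_cfg d S w i) *
      (\<Prod>k\<in>S - {i}. (if k = i then A else 1\<^sub>m (d k)) $$ (basis_cfg d S u k, basis_cfg d S w k))"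
    unfolding embed_op_def tensor_op_index[OF uw] using S i by (subst prod.remove[of _ i]) auto
  also have "(\<Prod>k\<in>S - {i}. (if k = i then A else 1\<^sub>m (d k)) $$ (basis_cfg d S u k, basis_cfg d S w k)) =
      (\<Prod>k\<in>S - {i}. if basis_cfg d S u k = basis_cfg d S w k then 1 else 0)"
    by (rule prod.cong) (auto simp: basis_cfg_less uw)
  also have "\<dots> = (if \<forall>k\<in>S - {i}. basis_cfg d S u k = basis_cfg d S w k then 1 else 0)"
    using S by (auto simp: prod_zero_iff)
  finally show ?thesis by auto
qed

text \<open>Duality of partial trace and embedding. It moves a multiplier at \<open>i\<close> into
  the space of the whole factor, and it lets the trace and the eigenvalues of a marginal be computed
  from the full operator.\<close>

theorem tr_ptrace:
  assumes A: "A \<in> carrier_mat (d i) (d i)" and B: "B \<in> carrier_mat (tdim d S) (tdim d S)" and i: "i \<in> S"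
  shows "tr (A * ptrace d S i B) = tr (embed_op d S i A * B)"
proof -
  let ?N = "tdim d S" and ?c = "basis_cfg d S"
  let ?agree = "\<lambda>u w. \<forall>k\<in>S - {i}. ?c u k = ?c w k"
  let ?g = "\<lambda>x y u w. if ?c u i = y \<and> ?c w i = x \<and> ?agree u w then A $$ (x, y) * B $$ (u, w) else 0"
  have "tr (A * ptrace d S i B) = (\<Sum>x<d i. \<Sum>y<d i. \<Sum>u<?N. \<Sum>w<?N. ?g x y u w)"
    unfolding tr_mult_sum[OF A ptrace_carrier]
    by (intro sum.cong refl) (auto simp: ptrace_index sum_distrib_left intro!: sum.cong)
  \<comment> \<open>The order of summation is changed until \<open>x\<close> and \<open>y\<close>
    are innermost; for fixed \<open>u\<close> and \<open>w\<close> both are then determined by the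
    configurations.\<close>
  also have "\<dots> = (\<Sum>x<d i. \<Sum>u<?N. \<Sum>y<d i. \<Sum>w<?N. ?g x y u w)"
    by (rule sum.cong[OF refl], rule sum.swap)
  also have "\<dots> = (\<Sum>u<?N. \<Sum>x<d i. \<Sum>y<d i. \<Sum>w<?N. ?g x y u w)"
    by (rule sum.swap)
  also have "\<dots> = (\<Sum>u<?N. \<Sum>x<d i. \<Sum>w<?N. \<Sum>y<d i. ?g x y u w)"
    by (rule sum.cong[OF refl], rule sum.cong[OF refl], rule sum.swap)
  also have "\<dots> = (\<Sum>u<?N. \<Sum>w<?N. \<Sum>x<d i. \<Sum>y<d i. ?g x y u w)"
    by (rule sum.cong[OF refl], rule sum.swap)
  also have "\<dots> = (\<Sum>u<?N. \<Sum>w<?N. if ?agree u w then A $$ (?c w i, ?c u i) * B $$ (u, w) else 0)"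
  proof (intro sum.cong refl)
    fix u w assume "u \<in> {..<?N}" "w \<in> {..<?N}"
    then have c: "?c u i < d i" "?c w i < d i" using basis_cfg_less i by auto
    have "(\<Sum>x<d i. \<Sum>y<d i. ?g x y u w) = (\<Sum>x<d i. if x = ?c w i then
        (\<Sum>y<d i. if y = ?c u i then (if ?agree u w then A $$ (x, y) * B $$ (u, w) else 0) else 0) else 0)"
      by (intro sum.cong refl) (auto intro!: sum.cong sum.neutral)
    also have "\<dots> = (if ?agree u w then A $$ (?c w i, ?c u i) * B $$ (u, w) else 0)"
      using c by simp
    finally show "(\<Sum>x<d i. \<Sum>y<d i. ?g x y u w) = (if ?agree u w then A $$ (?c w i, ?c u i) * B $$ (u, w) else 0)" .
  qed
  also have "\<dots> = (\<Sum>w<?N. \<Sum>u<?N. if ?agree u w then A $$ (?c w i, ?c u i) * B $$ (u, w) else 0)"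
    by (rule sum.swap)
  also have "\<dots> = tr (embed_op d S i A * B)"
    unfolding tr_mult_sum[OF embed_op_carrier B]
  proof (intro sum.cong refl)
    fix w u assume "w \<in> {..<?N}" "u \<in> {..<?N}"
    then have uw: "w < ?N" "u < ?N" by auto
    have "?agree w u = ?agree u w" by (rule ball_cong[OF refl]) (rule eq_commute)
    then show "(if ?agree u w then A $$ (?c w i, ?c u i) * B $$ (u, w) else 0) = embed_op d S i A $$ (w, u) * B $$ (u, w)"
      unfolding embed_op_index[OF uw i] by simp
  qed
  finally show ?thesis .
qed

lemma tr_ptrace_eq:
  assumes "B \<in> carrier_mat (tdim d S) (tdim d S)" "i \<in> S"
  shows "tr (ptrace d S i B) = tr B"
proof -
  have "embed_op d S i (1\<^sub>m (d i)) = tensor_op d S (\<lambda>k. 1\<^sub>m (d k))"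
    unfolding embed_op_def by (rule tensor_op_cong) auto
  then show ?thesis
    using tr_ptrace[OF one_carrier_mat assms] assms(1) left_mult_one_mat[OF ptrace_carrier[of i B]]
    by (simp add: tensor_op_one)
qed

lemma ptrace_hermitian:
  assumes A: "hermitian_op (tdim d S) A"
  shows "hermitian_op (d i) (ptrace d S i A)"
proof (rule hermitian_opI)
  fix x y assume xy: "x < d i" "y < d i"
  show "ptrace d S i A $$ (x, y) = cnj (ptrace d S i A $$ (y, x))"
    unfolding ptrace_index[OF xy] ptrace_index[OF xy(2,1)] cnj_sum
    by (subst sum.swap) (intro sum.cong refl, auto intro: hermitian_op_index[OF A])
qed simp

text \<open>An eigenvalue of the marginal is a trace against a projection. Embedding the projection
  writes it as a sum of nonnegative terms over pairs \<open>u, v\<close>. A strictly positive term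
  exists: positive dimensions give a \<open>u\<close> with coordinate \<open>l\<close> at
  \<open>i\<close>, and the overlaps in row \<open>u\<close> sum to one, so they do not all
  vanish.\<close>

lemma ptrace_posdef:
  assumes d: "\<And>k. k \<in> S \<Longrightarrow> d k \<ge> 1" and A: "posdef_op (tdim d S) A" and i: "i \<in> S"
  shows "posdef_op (d i) (ptrace d S i A)"
proof -
  obtain V \<mu> where V: "unitary_op (d i) V" and eq: "ptrace d S i A = specm (d i) V \<mu>"
    using hermitian_spectral[OF ptrace_hermitian[OF posdef_opD(1)[OF A]]] by blast
  obtain W where W: "unitary_op (tdim d S) W"
    and emb: "\<And>\<nu>. embed_op d S i (specm (d i) V \<nu>) = specm (tdim d S) W (\<lambda>u. \<nu> (basis_cfg d S u i))"
    using embed_specm_single[of i V, OF V i] by blast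
  obtain U a where U: "unitary_op (tdim d S) U" and Aeq: "A = specm (tdim d S) U a"
    and a: "\<And>k. k < tdim d S \<Longrightarrow> a k > 0" using posdef_spectral[OF A] by blast
  have "\<mu> l > 0" if l: "l < d i" for l
  proof -
    let ?e = "\<lambda>k. if k = l then 1 else 0 :: real"
    let ?N = "tdim d S"
    have "\<mu> l = Re (tr (specm (d i) V ?e * ptrace d S i A))"
      unfolding eq by (rule eigenvalue_as_trace[OF V l])
    also have "\<dots> = Re (tr (embed_op d S i (specm (d i) V ?e) * A))"
      by (subst tr_ptrace[OF specm_carrier[OF V] posdef_opD(2)[OF A] i]) simp
    also have "\<dots> = (\<Sum>u<?N. \<Sum>v<?N. overlap W U u v * (?e (basis_cfg d S u i) * a v))"
      unfolding emb Aeq by (simp only: tr_specm_specm[OF W U] Re_complex_of_real)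
    finally have \<mu>: "\<mu> l = \<dots>" .
    have d0: "0 < d k" if "k \<in> S" for k using d[OF that] by simp
    have "\<exists>u<?N. \<forall>k\<in>S. basis_cfg d S u k = (if k = i then l else 0)"
      using l d0 by (intro basis_cfg_surj) auto
    then obtain u where u: "u < ?N" "basis_cfg d S u i = l" using i by auto
    have "\<exists>v\<in>{..<?N}. overlap W U u v > 0"
    proof (rule ccontr)
      assume "\<not> ?thesis"
      then have "(\<Sum>v<?N. overlap W U u v) = 0"
        using overlap_nonneg[of W U u] by (intro sum.neutral) (auto simp: antisym_conv not_less)
      then show False using sum_overlap(1)[OF W U u(1)] by simp
    qed
    then obtain v where v: "v < ?N" "overlap W U u v > 0" by auto
    have nonneg: "0 \<le> overlap W U u v * (?e (basis_cfg d S u i) * a v)" if "v < ?N" for u v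
      using overlap_nonneg a[OF that] by simp
    have 1: "0 < (\<Sum>v<?N. overlap W U u v * (?e (basis_cfg d S u i) * a v))"
    proof (rule sum_pos2[of _ v])
      show "0 < overlap W U u v * (?e (basis_cfg d S u i) * a v)" using v u a[OF v(1)] by simp
    qed (use v(1) nonneg in auto)
    show "\<mu> l > 0" unfolding \<mu>
    proof (rule sum_pos2[of _ u])
      show "0 \<le> (\<Sum>v<?N. overlap W U w v * (?e (basis_cfg d S w i) * a v))" for w
        by (rule sum_nonneg) (rule nonneg, simp)
    qed (use 1 u(1) in auto)
  qed
  then show ?thesis unfolding eq using posdef_specm_iff[OF V] by blast
qed

end

section \<open>Equality modulo the identity\<close>

text \<open>Logarithmic form of \<open>\<propto>\<^sub>+\<close>. The constant is real because it
  stands for \<open>ln c\<close> with \<open>c > 0\<close>; carriers are left to the individual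
  lemmas.\<close>

definition eq_mod_id :: "nat \<Rightarrow> complex mat \<Rightarrow> complex mat \<Rightarrow> bool" where
  "eq_mod_id n A B \<longleftrightarrow> (\<exists>c::real. A = B + complex_of_real c \<cdot>\<^sub>m 1\<^sub>m n)"

lemma eq_mod_idI:
  assumes "A \<in> carrier_mat n n" "B \<in> carrier_mat n n"
    and "\<And>i j. i < n \<Longrightarrow> j < n \<Longrightarrow> A $$ (i, j) = B $$ (i, j) + complex_of_real c * 1\<^sub>m n $$ (i, j)"
  shows "eq_mod_id n A B"
proof -
  have "A = B + complex_of_real c \<cdot>\<^sub>m 1\<^sub>m n"
    using assms by (intro eq_matI) auto
  then show ?thesis unfolding eq_mod_id_def by blast
qed

lemma eq_mod_idE:
  assumes "eq_mod_id n A B" "B \<in> carrier_mat n n"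
  obtains c :: real where
    "\<And>i j. i < n \<Longrightarrow> j < n \<Longrightarrow> A $$ (i, j) = B $$ (i, j) + complex_of_real c * 1\<^sub>m n $$ (i, j)"
proof -
  obtain c :: real where "A = B + complex_of_real c \<cdot>\<^sub>m 1\<^sub>m n"
    using assms unfolding eq_mod_id_def by blast
  then show thesis using assms(2) that[of c] by auto
qed

lemma eq_mod_id_iff:
  assumes "A \<in> carrier_mat n n" "B \<in> carrier_mat n n"
  shows "eq_mod_id n A B \<longleftrightarrow>
    (\<exists>c::real. \<forall>i<n. \<forall>j<n. A $$ (i, j) = B $$ (i, j) + complex_of_real c * 1\<^sub>m n $$ (i, j))"
  using eq_mod_idE[OF _ assms(2)] eq_mod_idI[OF assms] by metis

lemma eq_mod_id_carrier: "eq_mod_id n A B \<Longrightarrow> B \<in> carrier_mat n n \<Longrightarrow> A \<in> carrier_mat n n"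
  unfolding eq_mod_id_def by auto

lemma eq_mod_id_refl: "A \<in> carrier_mat n n \<Longrightarrow> eq_mod_id n A A"
  by (rule eq_mod_idI[where c = 0]) auto

lemma eq_mod_id_sym:
  assumes "eq_mod_id n A B" "B \<in> carrier_mat n n"
  shows "eq_mod_id n B A"
proof -
  obtain c :: real where "\<And>i j. i < n \<Longrightarrow> j < n \<Longrightarrow>
      A $$ (i, j) = B $$ (i, j) + complex_of_real c * 1\<^sub>m n $$ (i, j)"
    using eq_mod_idE[OF assms] by blast
  then show ?thesis
    by (intro eq_mod_idI[where c = "- c"] eq_mod_id_carrier[OF assms] assms(2)) simp
qed

lemma eq_mod_id_trans:
  assumes "eq_mod_id n A B" "eq_mod_id n B C" "C \<in> carrier_mat n n"
  shows "eq_mod_id n A C"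
proof -
  note B = eq_mod_id_carrier[OF assms(2,3)]
  obtain c1 c2 :: real where
    "\<And>i j. i < n \<Longrightarrow> j < n \<Longrightarrow> A $$ (i, j) = B $$ (i, j) + complex_of_real c1 * 1\<^sub>m n $$ (i, j)"
    "\<And>i j. i < n \<Longrightarrow> j < n \<Longrightarrow> B $$ (i, j) = C $$ (i, j) + complex_of_real c2 * 1\<^sub>m n $$ (i, j)"
    using eq_mod_idE[OF assms(1) B] eq_mod_idE[OF assms(2,3)] by metis
  then show ?thesis
    by (intro eq_mod_idI[where c = "c1 + c2"] eq_mod_id_carrier[OF assms(1) B] assms(3))
      (simp add: algebra_simps)
qed

lemma eq_mod_id_add:
  assumes "eq_mod_id n A A'" "eq_mod_id n B B'" "A' \<in> carrier_mat n n" "B' \<in> carrier_mat n n"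
  shows "eq_mod_id n (A + B) (A' + B')"
proof -
  note AB = eq_mod_id_carrier[OF assms(1,3)] eq_mod_id_carrier[OF assms(2,4)]
  obtain c1 c2 :: real where
    "\<And>i j. i < n \<Longrightarrow> j < n \<Longrightarrow> A $$ (i, j) = A' $$ (i, j) + complex_of_real c1 * 1\<^sub>m n $$ (i, j)"
    "\<And>i j. i < n \<Longrightarrow> j < n \<Longrightarrow> B $$ (i, j) = B' $$ (i, j) + complex_of_real c2 * 1\<^sub>m n $$ (i, j)"
    using eq_mod_idE[OF assms(1,3)] eq_mod_idE[OF assms(2,4)] by metis
  then show ?thesis using AB assms
    by (intro eq_mod_idI[where c = "c1 + c2"]) (auto simp: algebra_simps)
qed

lemma eq_mod_id_msum:
  assumes "\<And>k. k \<in> K \<Longrightarrow> eq_mod_id n (F k) (F' k)" "\<And>k. k \<in> K \<Longrightarrow> F' k \<in> carrier_mat n n"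
  shows "eq_mod_id n (msum n F K) (msum n F' K)"
proof -
  have "\<forall>k\<in>K. \<exists>c::real. \<forall>i<n. \<forall>j<n. F k $$ (i, j) = F' k $$ (i, j) + complex_of_real c * 1\<^sub>m n $$ (i, j)"
    using eq_mod_idE[OF assms] by metis
  then obtain c :: "_ \<Rightarrow> real" where
    "\<forall>k\<in>K. \<forall>i<n. \<forall>j<n. F k $$ (i, j) = F' k $$ (i, j) + complex_of_real (c k) * 1\<^sub>m n $$ (i, j)"
    by metis
  then show ?thesis
    by (intro eq_mod_idI[where c = "\<Sum>k\<in>K. c k"]) (simp_all add: sum.distrib sum_distrib_right del: index_one_mat)
qed

section \<open>Proportionality expressed through logarithms\<close>

lemma propto_posdef: "A \<propto>\<^sub>+ B \<Longrightarrow> posdef_op n B \<Longrightarrow> posdef_op n A"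
  unfolding propto_def using posdef_smult by auto

text \<open>An additive constant \<open>c\<close> corresponds to the factor \<open>exp c\<close>;
  that the logarithm determines a positive definite operator follows by applying
  \<open>mexp\<close>.\<close>

lemma propto_iff_mlog:
  assumes A: "posdef_op n A" and B: "posdef_op n B"
  shows "A \<propto>\<^sub>+ B \<longleftrightarrow> eq_mod_id n (mlog A) (mlog B)"
proof
  assume "A \<propto>\<^sub>+ B"
  then obtain c where "c > 0" "A = complex_of_real c \<cdot>\<^sub>m B" unfolding propto_def by blast
  then show "eq_mod_id n (mlog A) (mlog B)" unfolding eq_mod_id_def using mlog_smult[OF B] by blast
next
  assume "eq_mod_id n (mlog A) (mlog B)"
  then obtain c where "mlog A = mlog B + complex_of_real c \<cdot>\<^sub>m 1\<^sub>m n" unfolding eq_mod_id_def by blast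
  also have "\<dots> = mlog (complex_of_real (exp c) \<cdot>\<^sub>m B)" using mlog_smult[OF B, of "exp c"] by simp
  finally have "mexp (mlog A) = mexp (mlog (complex_of_real (exp c) \<cdot>\<^sub>m B))" by simp
  then have "A = complex_of_real (exp c) \<cdot>\<^sub>m B"
    using mexp_mlog[OF A] mexp_mlog[OF posdef_smult[OF B, of "exp c"]] by simp
  then show "A \<propto>\<^sub>+ B" unfolding propto_def using exp_gt_zero by blast
qed

lemma posdef_trace:
  assumes "posdef_op n A" "n \<ge> 1"
  obtains \<tau> where "\<tau> > 0" "tr A = complex_of_real \<tau>"
proof -
  obtain U \<mu> where U: "unitary_op n U" "A = specm n U \<mu>" and pos: "\<And>k. k < n \<Longrightarrow> \<mu> k > 0"
    using posdef_spectral[OF assms(1)] by blast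
  have "(\<Sum>k<n. \<mu> k) > 0" using pos assms(2) by (intro sum_pos) (auto simp: lessThan_empty_iff)
  then show thesis using that tr_specm[OF U(1)] U(2) by blast
qed

text \<open>A logarithm prescribed modulo the identity leaves one scalar free, which is spent on
  trace one. With \<open>n \<ge> 1\<close> the trace of the exponential is positive, so it can be
  divided out.\<close>

lemma exists_density_with_log:
  assumes H: "hermitian_op n H" and n: "n \<ge> 1"
  shows "\<exists>m. density_op n m \<and> posdef_op n m \<and> eq_mod_id n (mlog m) H"
proof -
  note E = mexp_posdef[OF H]
  obtain \<tau> where \<tau>: "\<tau> > 0" "tr (mexp H) = complex_of_real \<tau>" using posdef_trace[OF E n] by blast
  let ?m = "complex_of_real (1 / \<tau>) \<cdot>\<^sub>m mexp H"
  have m: "posdef_op n ?m" using \<tau> by (intro posdef_smult E) simp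
  have "tr ?m = 1" using \<tau> by (simp add: tr_smult[OF posdef_opD(2)[OF E]])
  moreover have "?m \<propto>\<^sub>+ mexp H" unfolding propto_def using \<tau>(1) by (intro exI[of _ "1 / \<tau>"]) simp
  then have "eq_mod_id n (mlog ?m) H" using propto_iff_mlog[OF m E] mlog_mexp[OF H] by simp
  ultimately show ?thesis unfolding density_op_def using m posdef_imp_psd by blast
qed

lemma propto_density_eq:
  assumes "A \<propto>\<^sub>+ B" "tr A = 1" "tr B = 1" "B \<in> carrier_mat n n"
  shows "A = B"
proof -
  obtain c where c: "c > 0" "A = complex_of_real c \<cdot>\<^sub>m B" using assms(1) unfolding propto_def by blast
  then have "complex_of_real c = 1" using assms tr_smult[OF assms(4), of "complex_of_real c"] by simp
  then show ?thesis using c by simp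
qed

lemma embed_op_dim [simp]:
  "dim_row (embed_op d S i A) = tdim d S" "dim_col (embed_op d S i A) = tdim d S"
  unfolding embed_op_def tensor_op_def by auto

lemma ptrace_dim [simp]: "dim_row (ptrace d S i A) = d i" "dim_col (ptrace d S i A) = d i"
  unfolding ptrace_def by auto

lemma embed_add:
  assumes "finite S" "i \<in> S" "A \<in> carrier_mat (d i) (d i)" "B \<in> carrier_mat (d i) (d i)"
  shows "embed_op d S i (A + B) = embed_op d S i A + embed_op d S i B"
proof (rule eq_matI)
  fix u w assume "u < dim_row (embed_op d S i A + embed_op d S i B)" "w < dim_col (embed_op d S i A + embed_op d S i B)"
  then have uw: "u < tdim d S" "w < tdim d S" by auto
  then have "basis_cfg d S u i < d i" "basis_cfg d S w i < d i"
    using basis_cfg_less[OF assms(1)] assms(2) by auto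
  then have "embed_op d S i (A + B) $$ (u, w) = embed_op d S i A $$ (u, w) + embed_op d S i B $$ (u, w)"
    unfolding embed_op_index[OF assms(1) uw assms(2)] using assms(3,4) by simp
  then show "embed_op d S i (A + B) $$ (u, w) = (embed_op d S i A + embed_op d S i B) $$ (u, w)"
    using uw by simp
qed simp_all

lemma embed_smult_one:
  assumes "finite S" "i \<in> S"
  shows "embed_op d S i (complex_of_real c \<cdot>\<^sub>m 1\<^sub>m (d i)) = complex_of_real c \<cdot>\<^sub>m 1\<^sub>m (tdim d S)"
  using embed_specm[OF assms(1) _ assms(2), of d "\<lambda>k. 1\<^sub>m (d k)" "\<lambda>_. c"]
  by (simp add: specm_const unitary_op_one tensor_op_one[OF assms(1)])

lemma embed_eq_mod_id:
  assumes "finite S" "i \<in> S" "eq_mod_id (d i) A B" "B \<in> carrier_mat (d i) (d i)"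
  shows "eq_mod_id (tdim d S) (embed_op d S i A) (embed_op d S i B)"
  using assms(3) embed_add[where d = d and i = i, OF assms(1,2,4)] embed_smult_one[OF assms(1,2), of d]
  unfolding eq_mod_id_def by (metis one_carrier_mat smult_carrier_mat)

lemma ptrace_smult:
  assumes "finite S" "A \<in> carrier_mat (tdim d S) (tdim d S)"
  shows "ptrace d S i (c \<cdot>\<^sub>m A) = c \<cdot>\<^sub>m ptrace d S i A"
proof (rule eq_matI)
  fix x y assume "x < dim_row (c \<cdot>\<^sub>m ptrace d S i A)" "y < dim_col (c \<cdot>\<^sub>m ptrace d S i A)"
  then have xy: "x < d i" "y < d i" by auto
  have "ptrace d S i (c \<cdot>\<^sub>m A) $$ (x, y) = c * ptrace d S i A $$ (x, y)"
    unfolding ptrace_index[where d = d and i = i, OF assms(1) xy] sum_distrib_left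
    by (intro sum.cong refl) (use assms(2) in auto)
  then show "ptrace d S i (c \<cdot>\<^sub>m A) $$ (x, y) = (c \<cdot>\<^sub>m ptrace d S i A) $$ (x, y)"
    using xy by simp
qed simp_all

lemma ptrace_propto:
  assumes "finite S" "A \<propto>\<^sub>+ B" "B \<in> carrier_mat (tdim d S) (tdim d S)"
  shows "ptrace d S i A \<propto>\<^sub>+ ptrace d S i B"
  using assms ptrace_smult unfolding propto_def by metis

lemma msum_remove:
  assumes "finite K" "a \<in> K" "i < n" "j < n"
  shows "msum n Q K $$ (i, j) = Q a $$ (i, j) + msum n Q (K - {a}) $$ (i, j)"
  using assms by (simp add: sum.remove[of K a])

text \<open>In the next three lemmas \<open>K\<close> is the neighbourhood of a variable node \<open>i\<close>, and \<open>P a\<close>, \<open>Q a\<close>, \<open>S\<close> and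
  \<open>L a\<close> are the logarithms of \<open>m\<^bsub>i\<rightarrow>a\<^esub>\<close>, \<open>m\<^bsub>a\<rightarrow>i\<^esub>\<close> and \<open>\<sigma>\<^sub>i\<close> and the multiplier of the edge \<open>(i, a)\<close>.\<close>

lemma node_update_iff:
  assumes K: "finite K" "a \<in> K" and c: "S \<in> carrier_mat n n" "P \<in> carrier_mat n n" "Q a \<in> carrier_mat n n"
    and S: "eq_mod_id n S (msum n Q K)"
  shows "eq_mod_id n P (msum n Q (K - {a})) \<longleftrightarrow> eq_mod_id n (Q a) (S - P)"
proof -
  let ?R = "msum n Q (K - {a})"
  have SP: "S - P \<in> carrier_mat n n" using c by auto
  \<comment> \<open>Modulo the identity \<open>S = Q a + ?R\<close>, with \<open>?R\<close> the sum
    over the other neighbours. Both sides of the equivalence are then rearrangements of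
    \<open>S = Q a + P\<close>.\<close>
  obtain s where s: "\<And>i j. i < n \<Longrightarrow> j < n \<Longrightarrow>
      S $$ (i, j) = Q a $$ (i, j) + ?R $$ (i, j) + complex_of_real s * 1\<^sub>m n $$ (i, j)"
    using eq_mod_idE[OF S msum_carrier] msum_remove[OF K] by metis
  show ?thesis
  proof
    assume "eq_mod_id n P ?R"
    then obtain p where p: "\<And>i j. i < n \<Longrightarrow> j < n \<Longrightarrow> P $$ (i, j) = ?R $$ (i, j) + complex_of_real p * 1\<^sub>m n $$ (i, j)"
      using eq_mod_idE[OF _ msum_carrier] by metis
    show "eq_mod_id n (Q a) (S - P)"
      by (rule eq_mod_idI[OF c(3) SP, where c = "p - s"])
        (use c(2) in \<open>simp add: s p algebra_simps del: index_one_mat msum_index\<close>)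
  next
    assume "eq_mod_id n (Q a) (S - P)"
    then obtain p where p: "\<And>i j. i < n \<Longrightarrow> j < n \<Longrightarrow> Q a $$ (i, j) = (S - P) $$ (i, j) + complex_of_real p * 1\<^sub>m n $$ (i, j)"
      using eq_mod_idE[OF _ SP] by metis
    show "eq_mod_id n P ?R"
    proof (rule eq_mod_idI[OF c(2) msum_carrier, where c = "p + s"])
      fix i j assume ij: "i < n" "j < n"
      show "P $$ (i, j) = ?R $$ (i, j) + complex_of_real (p + s) * 1\<^sub>m n $$ (i, j)"
        using s[OF ij] p[OF ij] c(1,2) ij by (simp add: algebra_simps del: index_one_mat msum_index)
    qed
  qed
qed

lemma node_update_imp_stationary:
  assumes K: "finite K" and c: "S \<in> carrier_mat n n" "\<And>a. a \<in> K \<Longrightarrow> P a \<in> carrier_mat n n"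
    and S: "eq_mod_id n S (msum n Q K)" and Q: "\<And>a. a \<in> K \<Longrightarrow> eq_mod_id n (Q a) (S - P a)"
  shows "eq_mod_id n (complex_of_real (real (card K) - 1) \<cdot>\<^sub>m S + msum n (\<lambda>a. - P a) K) (0\<^sub>m n n)"
proof -
  obtain s where s: "\<And>i j. i < n \<Longrightarrow> j < n \<Longrightarrow>
      S $$ (i, j) = (\<Sum>a\<in>K. Q a $$ (i, j)) + complex_of_real s * 1\<^sub>m n $$ (i, j)"
    using eq_mod_idE[OF S msum_carrier] msum_index by metis
  have "\<forall>a\<in>K. \<exists>p::real. \<forall>i<n. \<forall>j<n. Q a $$ (i, j) = (S - P a) $$ (i, j) + complex_of_real p * 1\<^sub>m n $$ (i, j)"
  proof
    fix a assume a: "a \<in> K"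
    have "S - P a \<in> carrier_mat n n" by (rule minus_carrier_mat[OF c(2)[OF a]])
    then show "\<exists>p::real. \<forall>i<n. \<forall>j<n. Q a $$ (i, j) = (S - P a) $$ (i, j) + complex_of_real p * 1\<^sub>m n $$ (i, j)"
      using eq_mod_idE[OF Q[OF a]] by metis
  qed
  then obtain p :: "_ \<Rightarrow> real" where
    p: "\<forall>a\<in>K. \<forall>i<n. \<forall>j<n. Q a $$ (i, j) = (S - P a) $$ (i, j) + complex_of_real (p a) * 1\<^sub>m n $$ (i, j)"
    by metis
  show ?thesis
  proof (rule eq_mod_idI[where c = "- (s + (\<Sum>a\<in>K. p a))"])
    fix i j assume ij: "i < n" "j < n"
    let ?\<delta> = "1\<^sub>m n $$ (i, j) :: complex"
    \<comment> \<open>Summation produces \<open>card K\<close> copies of \<open>S\<close>.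
      Substitution into the node belief, which has one \<open>S\<close> on its left, leaves
      \<open>card K - 1\<close> of them.\<close>
    have "(\<Sum>a\<in>K. Q a $$ (i, j)) = (\<Sum>a\<in>K. S $$ (i, j) - P a $$ (i, j) + complex_of_real (p a) * ?\<delta>)"
    proof (rule sum.cong[OF refl])
      fix a assume a: "a \<in> K"
      show "Q a $$ (i, j) = S $$ (i, j) - P a $$ (i, j) + complex_of_real (p a) * ?\<delta>"
        using p a ij c(1) c(2)[OF a] by (auto simp del: index_one_mat)
    qed
    also have "\<dots> = of_nat (card K) * S $$ (i, j) - (\<Sum>a\<in>K. P a $$ (i, j)) + (\<Sum>a\<in>K. complex_of_real (p a)) * ?\<delta>"
      by (simp only: sum.distrib sum_subtractf sum_constant sum_distrib_right)
    finally have sumQ: "(\<Sum>a\<in>K. Q a $$ (i, j)) = \<dots>" .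
    have "(\<Sum>a\<in>K. (- P a) $$ (i, j)) = - (\<Sum>a\<in>K. P a $$ (i, j))"
      unfolding sum_negf[symmetric]
      by (intro sum.cong refl index_uminus_mat) (use carrier_matD[OF c(2)] ij in auto)
    then show "(complex_of_real (real (card K) - 1) \<cdot>\<^sub>m S + msum n (\<lambda>a. - P a) K) $$ (i, j)
        = 0\<^sub>m n n $$ (i, j) + complex_of_real (- (s + (\<Sum>a\<in>K. p a))) * ?\<delta>"
      using s[OF ij] sumQ ij c(1) by (simp add: algebra_simps del: index_one_mat)
  qed (use c in auto)
qed

lemma stationary_imp_node_belief:
  assumes K: "finite K" and c: "S \<in> carrier_mat n n" "\<And>a. a \<in> K \<Longrightarrow> L a \<in> carrier_mat n n"
      "\<And>a. a \<in> K \<Longrightarrow> P a \<in> carrier_mat n n"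
    and stat: "eq_mod_id n (complex_of_real (real (card K) - 1) \<cdot>\<^sub>m S + msum n L K) (0\<^sub>m n n)"
    and PL: "\<And>a. a \<in> K \<Longrightarrow> eq_mod_id n (P a + L a) (0\<^sub>m n n)"
    and Q: "\<And>a. a \<in> K \<Longrightarrow> eq_mod_id n (Q a) (S - P a)"
  shows "eq_mod_id n S (msum n Q K)"
proof -
  obtain s where s: "\<And>i j. i < n \<Longrightarrow> j < n \<Longrightarrow>
      (complex_of_real (real (card K) - 1) \<cdot>\<^sub>m S + msum n L K) $$ (i, j) = 0\<^sub>m n n $$ (i, j) + complex_of_real s * 1\<^sub>m n $$ (i, j)"
    using eq_mod_idE[OF stat zero_carrier_mat] by metis
  have "\<forall>a\<in>K. \<exists>p::real. \<forall>i<n. \<forall>j<n. Q a $$ (i, j) = S $$ (i, j) + L a $$ (i, j) + complex_of_real p * 1\<^sub>m n $$ (i, j)"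
  proof
    fix a assume a: "a \<in> K"
    have SP: "S - P a \<in> carrier_mat n n" by (rule minus_carrier_mat[OF c(3)[OF a]])
    obtain p q :: real where
      p: "\<And>i j. i < n \<Longrightarrow> j < n \<Longrightarrow> Q a $$ (i, j) = (S - P a) $$ (i, j) + complex_of_real p * 1\<^sub>m n $$ (i, j)" and
      q: "\<And>i j. i < n \<Longrightarrow> j < n \<Longrightarrow> (P a + L a) $$ (i, j) = 0\<^sub>m n n $$ (i, j) + complex_of_real q * 1\<^sub>m n $$ (i, j)"
      using eq_mod_idE[OF Q[OF a] SP] eq_mod_idE[OF PL[OF a] zero_carrier_mat] by metis
    \<comment> \<open>Modulo the identity \<open>P a\<close> is \<open>- L a\<close>, so
      \<open>Q a\<close> is expressed through the multiplier, to which the stationarity equation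
      applies after summation.\<close>
    have "Q a $$ (i, j) = S $$ (i, j) + L a $$ (i, j) + complex_of_real (p - q) * 1\<^sub>m n $$ (i, j)"
      if ij: "i < n" "j < n" for i j
    proof -
      have "P a $$ (i, j) = complex_of_real q * 1\<^sub>m n $$ (i, j) - L a $$ (i, j)"
        unfolding eq_diff_eq using q[OF ij] c(2)[OF a] ij by (auto simp del: index_one_mat)
      moreover have "Q a $$ (i, j) = S $$ (i, j) - P a $$ (i, j) + complex_of_real p * 1\<^sub>m n $$ (i, j)"
        using p[OF ij] c(1) c(3)[OF a] ij by (auto simp del: index_one_mat)
      ultimately show ?thesis by (simp only:) (simp add: algebra_simps del: index_one_mat)
    qed
    then show "\<exists>p::real. \<forall>i<n. \<forall>j<n. Q a $$ (i, j) = S $$ (i, j) + L a $$ (i, j) + complex_of_real p * 1\<^sub>m n $$ (i, j)"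
      by blast
  qed
  then obtain p :: "_ \<Rightarrow> real" where
    p: "\<forall>a\<in>K. \<forall>i<n. \<forall>j<n. Q a $$ (i, j) = S $$ (i, j) + L a $$ (i, j) + complex_of_real (p a) * 1\<^sub>m n $$ (i, j)"
    by metis
  show ?thesis
  proof (rule eq_mod_idI[OF c(1) msum_carrier, where c = "- (s + (\<Sum>a\<in>K. p a))"])
    fix i j assume ij: "i < n" "j < n"
    let ?\<delta> = "1\<^sub>m n $$ (i, j) :: complex"
    have "(\<Sum>a\<in>K. Q a $$ (i, j)) = (\<Sum>a\<in>K. S $$ (i, j) + L a $$ (i, j) + complex_of_real (p a) * ?\<delta>)"
      by (rule sum.cong[OF refl]) (use p ij in blast)
    also have "\<dots> = of_nat (card K) * S $$ (i, j) + (\<Sum>a\<in>K. L a $$ (i, j)) + (\<Sum>a\<in>K. complex_of_real (p a)) * ?\<delta>"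
      by (simp only: sum.distrib sum_constant sum_distrib_right)
    finally have sumQ: "(\<Sum>a\<in>K. Q a $$ (i, j)) = \<dots>" .
    have "of_nat (card K) * S $$ (i, j) - S $$ (i, j) + (\<Sum>a\<in>K. L a $$ (i, j)) = complex_of_real s * ?\<delta>"
      using s[OF ij] ij c(1) by (simp add: algebra_simps del: index_one_mat)
    then show "S $$ (i, j) = msum n Q K $$ (i, j) + complex_of_real (- (s + (\<Sum>a\<in>K. p a))) * ?\<delta>"
      using sumQ ij by (simp add: algebra_simps del: index_one_mat)
  qed
qed

section \<open>Gradient of the Lagrangian\<close>

lemma trace_affine_derivative:
  assumes "A \<in> carrier_mat n n" "X \<in> carrier_mat n n" "L \<in> carrier_mat n n"
  shows "((\<lambda>t. Re (tr ((A + complex_of_real t \<cdot>\<^sub>m X) * L))) has_real_derivative Re (tr (X * L))) (at t0)"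
proof -
  have "Re (tr ((A + complex_of_real t \<cdot>\<^sub>m X) * L)) = Re (tr (A * L)) + t * Re (tr (X * L))" for t
    using tr_mult_distrib(2)[OF assms(1) smult_carrier_mat[OF assms(2)] assms(3)]
    by (simp add: tr_mult_smult(2)[OF assms(2,3)])
  then show ?thesis by (auto intro!: derivative_eq_intros)
qed

text \<open>Gradient of the Lagrangian at \<open>\<sigma>F a\<close> without its identity component
  \<open>1 + \<kappa> a\<close>, where 1 stems from the entropy and \<open>\<kappa> a\<close> from
  the trace constraint.\<close>

definition factor_gradient ::
    "('v, 'f) qfg \<Rightarrow> ('v \<Rightarrow> 'f \<Rightarrow> complex mat) \<Rightarrow> ('f \<Rightarrow> complex mat) \<Rightarrow> 'f \<Rightarrow> complex mat" where
  "factor_gradient G \<Lambda> \<sigma>F a = (mlog (\<sigma>F a) - mlog (pot G a)) +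
     msum (fdim G a) (\<lambda>i. embed_op (hdim G) (nbf G a) i (\<Lambda> i a)) (nbf G a)"

text \<open>Minus the gradient of the Lagrangian at \<open>\<sigma>V i\<close>, again without its
  identity component. With this sign the multipliers enter both gradients positively.\<close>

definition vertex_gradient ::
    "('v, 'f) qfg \<Rightarrow> ('v \<Rightarrow> 'f \<Rightarrow> complex mat) \<Rightarrow> ('v \<Rightarrow> complex mat) \<Rightarrow> 'v \<Rightarrow> complex mat" where
  "vertex_gradient G \<Lambda> \<sigma>V i = complex_of_real (real (card (nbv G i)) - 1) \<cdot>\<^sub>m mlog (\<sigma>V i) +
     msum (hdim G i) (\<lambda>a. \<Lambda> i a) (nbv G i)"

context
  fixes G :: "('v, 'f) qfg"
  assumes qfg: "quantum_factor_graph G"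
begin

lemma edge_factor: "(i, a) \<in> edges G \<Longrightarrow> a \<in> factors G"
  and edge_vert: "(i, a) \<in> edges G \<Longrightarrow> i \<in> verts G"
  and hdim_pos: "i \<in> verts G \<Longrightarrow> hdim G i \<ge> 1"
  and finite_verts: "finite (verts G)" and finite_factors: "finite (factors G)"
  using qfg unfolding quantum_factor_graph_def by auto

lemma finite_nbf: "finite (nbf G a)"
  by (rule finite_subset[OF _ finite_verts]) (auto simp: nbf_def intro: edge_vert)

lemma finite_nbv: "finite (nbv G i)"
  by (rule finite_subset[OF _ finite_factors]) (auto simp: nbv_def intro: edge_factor)

lemma nbf_hdim_pos: "i \<in> nbf G a \<Longrightarrow> hdim G i \<ge> 1"
  using hdim_pos[OF edge_vert, of i a] by (simp add: nbf_def)

lemma sum_edges_verts: "(\<Sum>(i, a)\<in>edges G. f i a) = (\<Sum>i\<in>verts G. \<Sum>a\<in>nbv G i. f i a)"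
proof -
  have "edges G = Sigma (verts G) (nbv G)" by (auto simp: nbv_def intro: edge_vert)
  then show ?thesis using finite_verts finite_nbv by (simp add: sum.Sigma)
qed

lemma sum_edges_factors: "(\<Sum>(i, a)\<in>edges G. f i a) = (\<Sum>a\<in>factors G. \<Sum>i\<in>nbf G a. f i a)"
proof -
  have "edges G = prod.swap ` Sigma (factors G) (nbf G)" by (force simp: nbf_def intro: edge_factor)
  then have "(\<Sum>(i, a)\<in>edges G. f i a) = (\<Sum>(a, i)\<in>Sigma (factors G) (nbf G). f i a)"
    by (simp add: sum.reindex split_def)
  then show ?thesis using finite_factors finite_nbf by (simp add: sum.Sigma)
qed

context
  fixes \<sigma>F :: "'f \<Rightarrow> complex mat" and \<sigma>V :: "'v \<Rightarrow> complex mat" and \<Lambda> :: "'v \<Rightarrow> 'f \<Rightarrow> complex mat"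
  assumes pot: "\<And>a. a \<in> factors G \<Longrightarrow> posdef_op (fdim G a) (pot G a)"
    and \<sigma>F: "\<And>a. a \<in> factors G \<Longrightarrow> posdef_op (fdim G a) (\<sigma>F a)"
    and \<sigma>V: "\<And>i. i \<in> verts G \<Longrightarrow> posdef_op (hdim G i) (\<sigma>V i)"
    and \<Lambda>: "\<And>i a. (i, a) \<in> edges G \<Longrightarrow> hermitian_op (hdim G i) (\<Lambda> i a)"
begin

lemma embed_multiplier_hermitian:
  assumes "i \<in> nbf G a"
  shows "hermitian_op (fdim G a) (embed_op (hdim G) (nbf G a) i (\<Lambda> i a))"
  unfolding fdim_def by (rule embed_hermitian[OF finite_nbf _ assms]) (use assms \<Lambda> in \<open>simp add: nbf_def\<close>)

lemma factor_gradient_hermitian: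
  assumes "a \<in> factors G"
  shows "hermitian_op (fdim G a) (factor_gradient G \<Lambda> \<sigma>F a)"
  unfolding factor_gradient_def using assms
  by (intro hermitian_add hermitian_minus mlog_hermitian msum_hermitian embed_multiplier_hermitian pot \<sigma>F)

lemma vertex_gradient_hermitian:
  assumes "i \<in> verts G"
  shows "hermitian_op (hdim G i) (vertex_gradient G \<Lambda> \<sigma>V i)"
  unfolding vertex_gradient_def using assms
  by (intro hermitian_add hermitian_smult mlog_hermitian msum_hermitian \<sigma>V \<Lambda>) (auto simp: nbv_def)

text \<open>Only the entropy terms are nonlinear in the operators;
  \<open>entropy_has_derivative\<close> treats them, and all others are affine in \<open>t\<close>.
  Collecting everything paired with one \<open>X a\<close> or one \<open>Y i\<close> gives the two
  gradients.\<close>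

lemma lagrangian_derivative:
  assumes X: "\<And>a. a \<in> factors G \<Longrightarrow> hermitian_op (fdim G a) (X a)"
    and Y: "\<And>i. i \<in> verts G \<Longrightarrow> hermitian_op (hdim G i) (Y i)"
  shows "((\<lambda>t::real. lagrangian G \<kappa> \<nu> \<Lambda>
             (\<lambda>a. \<sigma>F a + complex_of_real t \<cdot>\<^sub>m X a)
             (\<lambda>i. \<sigma>V i + complex_of_real t \<cdot>\<^sub>m Y i)) has_real_derivative
       (\<Sum>a\<in>factors G. Re (tr (X a * (factor_gradient G \<Lambda> \<sigma>F a + complex_of_real (1 + \<kappa> a) \<cdot>\<^sub>m 1\<^sub>m (fdim G a)))))
     - (\<Sum>i\<in>verts G. Re (tr (Y i * (vertex_gradient G \<Lambda> \<sigma>V i +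
           complex_of_real (real (card (nbv G i)) - 1 - \<nu> i) \<cdot>\<^sub>m 1\<^sub>m (hdim G i)))))) (at 0)"
proof -
  let ?A = "\<lambda>t a. \<sigma>F a + complex_of_real t \<cdot>\<^sub>m X a" and ?B = "\<lambda>t i. \<sigma>V i + complex_of_real t \<cdot>\<^sub>m Y i"
  let ?E = "\<lambda>i a. embed_op (hdim G) (nbf G a) i (\<Lambda> i a)"
  let ?k = "\<lambda>i. real (card (nbv G i)) - 1"
  have c: "\<sigma>F a \<in> carrier_mat (fdim G a) (fdim G a)" "X a \<in> carrier_mat (fdim G a) (fdim G a)"
    "mlog (\<sigma>F a) \<in> carrier_mat (fdim G a) (fdim G a)" "mlog (pot G a) \<in> carrier_mat (fdim G a) (fdim G a)"
    if "a \<in> factors G" for a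
    using posdef_opD(2)[OF \<sigma>F[OF that]] hermitian_opD(1)[OF X[OF that]]
      hermitian_opD(1)[OF mlog_hermitian[OF \<sigma>F[OF that]]] hermitian_opD(1)[OF mlog_hermitian[OF pot[OF that]]]
    by auto
  have cv: "\<sigma>V i \<in> carrier_mat (hdim G i) (hdim G i)" "Y i \<in> carrier_mat (hdim G i) (hdim G i)"
    "mlog (\<sigma>V i) \<in> carrier_mat (hdim G i) (hdim G i)" if "i \<in> verts G" for i
    using posdef_opD(2)[OF \<sigma>V[OF that]] hermitian_opD(1)[OF Y[OF that]]
      hermitian_opD(1)[OF mlog_hermitian[OF \<sigma>V[OF that]]] by auto
  have D1: "((\<lambda>t. \<Sum>a\<in>factors G. Re (tr (?A t a * mlog (pot G a)))) has_real_derivative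
      (\<Sum>a\<in>factors G. Re (tr (X a * mlog (pot G a))))) (at 0)"
    by (intro DERIV_sum) (rule trace_affine_derivative[OF c(1,2,4)])
  have D2: "((\<lambda>t. \<Sum>a\<in>factors G. Re (tr (?A t a * mlog (?A t a)))) has_real_derivative
      (\<Sum>a\<in>factors G. Re (tr (X a * mlog (\<sigma>F a))) + Re (tr (X a)))) (at 0)"
    by (intro DERIV_sum) (rule entropy_has_derivative[OF \<sigma>F X])
  have D3: "((\<lambda>t. \<Sum>i\<in>verts G. ?k i * Re (tr (?B t i * mlog (?B t i)))) has_real_derivative
      (\<Sum>i\<in>verts G. ?k i * (Re (tr (Y i * mlog (\<sigma>V i))) + Re (tr (Y i))))) (at 0)"
    by (intro DERIV_sum DERIV_cmult) (rule entropy_has_derivative[OF \<sigma>V Y])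
  have trA: "((\<lambda>t. Re (tr (M + complex_of_real t \<cdot>\<^sub>m N))) has_real_derivative Re (tr N)) (at 0)"
    if "M \<in> carrier_mat n n" "N \<in> carrier_mat n n" for M N n
    using trace_affine_derivative[OF that one_carrier_mat] that by simp
  have D4: "((\<lambda>t. \<Sum>a\<in>factors G. \<kappa> a * (Re (tr (?A t a)) - 1)) has_real_derivative
      (\<Sum>a\<in>factors G. \<kappa> a * (Re (tr (X a)) - 0))) (at 0)"
    by (intro DERIV_sum DERIV_cmult DERIV_diff DERIV_const) (rule trA[OF c(1,2)])
  have D5: "((\<lambda>t. \<Sum>i\<in>verts G. \<nu> i * (Re (tr (?B t i)) - 1)) has_real_derivative
      (\<Sum>i\<in>verts G. \<nu> i * (Re (tr (Y i)) - 0))) (at 0)"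
    by (intro DERIV_sum DERIV_cmult DERIV_diff DERIV_const) (rule trA[OF cv(1,2)])
  have D6: "((\<lambda>t. \<Sum>(i, a)\<in>edges G. Re (tr (\<Lambda> i a * (ptrace (hdim G) (nbf G a) i (?A t a) - ?B t i)))) has_real_derivative
      (\<Sum>(i, a)\<in>edges G. Re (tr (X a * ?E i a)) - Re (tr (Y i * \<Lambda> i a)))) (at 0)"
  proof (unfold split_def, intro DERIV_sum)
    fix e assume e: "e \<in> edges G"
    obtain i a where ia: "e = (i, a)" by (cases e)
    have a: "a \<in> factors G" and i: "i \<in> verts G" and inb: "i \<in> nbf G a"
      using e edge_factor edge_vert unfolding ia by (auto simp: nbf_def)
    have L: "\<Lambda> i a \<in> carrier_mat (hdim G i) (hdim G i)" using hermitian_opD(1)[OF \<Lambda>] e ia by auto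
    have E: "?E i a \<in> carrier_mat (fdim G a) (fdim G a)" unfolding fdim_def by (rule embed_op_carrier[OF finite_nbf])
    have "Re (tr (\<Lambda> i a * (ptrace (hdim G) (nbf G a) i (?A t a) - ?B t i))) =
        Re (tr (?A t a * ?E i a)) - Re (tr (?B t i * \<Lambda> i a))" for t
    proof -
      have At: "?A t a \<in> carrier_mat (fdim G a) (fdim G a)" and Bt: "?B t i \<in> carrier_mat (hdim G i) (hdim G i)"
        using c(2)[OF a] cv(2)[OF i] by auto
      have "tr (\<Lambda> i a * (ptrace (hdim G) (nbf G a) i (?A t a) - ?B t i)) =
          tr (\<Lambda> i a * ptrace (hdim G) (nbf G a) i (?A t a)) - tr (\<Lambda> i a * ?B t i)"
        by (rule tr_mult_distrib(3)[OF L ptrace_carrier[where d = "hdim G", OF finite_nbf] Bt])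
      \<comment> \<open>Duality turns the pairing with a marginal into a pairing of the full
        operator with the embedded multiplier.\<close>
      also have "tr (\<Lambda> i a * ptrace (hdim G) (nbf G a) i (?A t a)) = tr (?E i a * ?A t a)"
        by (rule tr_ptrace[where d = "hdim G" and i = i, OF finite_nbf L _ inb]) (use At in \<open>simp add: fdim_def\<close>)
      finally show ?thesis using tr_mult_commute[OF E At] tr_mult_commute[OF L Bt] by simp
    qed
    then show "((\<lambda>t. Re (tr (\<Lambda> (fst e) (snd e) * (ptrace (hdim G) (nbf G (snd e)) (fst e) (?A t (snd e)) - ?B t (fst e)))))
        has_real_derivative Re (tr (X (snd e) * ?E (fst e) (snd e))) - Re (tr (Y (fst e) * \<Lambda> (fst e) (snd e)))) (at 0)"
      unfolding ia by (simp, intro DERIV_diff trace_affine_derivative[OF c(1,2)[OF a] E]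
          trace_affine_derivative[OF cv(1,2)[OF i] L])
  qed
  let ?D = "- (\<Sum>a\<in>factors G. Re (tr (X a * mlog (pot G a))))
      + (\<Sum>a\<in>factors G. Re (tr (X a * mlog (\<sigma>F a))) + Re (tr (X a)))
      - (\<Sum>i\<in>verts G. ?k i * (Re (tr (Y i * mlog (\<sigma>V i))) + Re (tr (Y i))))
      + (\<Sum>a\<in>factors G. \<kappa> a * (Re (tr (X a)) - 0))
      + (\<Sum>i\<in>verts G. \<nu> i * (Re (tr (Y i)) - 0))
      + (\<Sum>(i, a)\<in>edges G. Re (tr (X a * ?E i a)) - Re (tr (Y i * \<Lambda> i a)))"
  have D: "((\<lambda>t. lagrangian G \<kappa> \<nu> \<Lambda> (?A t) (?B t)) has_real_derivative ?D) (at 0)"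
    unfolding lagrangian_def bethe_def by (intro DERIV_add DERIV_diff DERIV_minus D1 D2 D3 D4 D5 D6)
  have XE: "(\<Sum>i\<in>nbf G a. Re (tr (X a * ?E i a))) = Re (tr (X a * msum (fdim G a) (\<lambda>i. ?E i a) (nbf G a)))"
    if "a \<in> factors G" for a
    by (subst tr_mult_msum[OF c(2)[OF that]]) (auto simp: fdim_def embed_op_carrier[OF finite_nbf])
  have YL: "(\<Sum>a\<in>nbv G i. Re (tr (Y i * \<Lambda> i a))) = Re (tr (Y i * msum (hdim G i) (\<lambda>a. \<Lambda> i a) (nbv G i)))"
    if "i \<in> verts G" for i
    by (subst tr_mult_msum[OF cv(2)[OF that]]) (auto simp: nbv_def intro: hermitian_opD(1)[OF \<Lambda>])
  have fac: "Re (tr (X a * (factor_gradient G \<Lambda> \<sigma>F a + complex_of_real (1 + \<kappa> a) \<cdot>\<^sub>m 1\<^sub>m (fdim G a)))) =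
      - Re (tr (X a * mlog (pot G a))) + (Re (tr (X a * mlog (\<sigma>F a))) + Re (tr (X a))) + \<kappa> a * (Re (tr (X a)) - 0)
      + (\<Sum>i\<in>nbf G a. Re (tr (X a * ?E i a)))" if a: "a \<in> factors G" for a
  proof -
    note ca = c[OF a]
    have 1: "mlog (\<sigma>F a) - mlog (pot G a) \<in> carrier_mat (fdim G a) (fdim G a)"
      by (rule minus_carrier_mat[OF ca(4)])
    have 2: "complex_of_real (1 + \<kappa> a) \<cdot>\<^sub>m 1\<^sub>m (fdim G a) \<in> carrier_mat (fdim G a) (fdim G a)" by simp
    have 3: "factor_gradient G \<Lambda> \<sigma>F a \<in> carrier_mat (fdim G a) (fdim G a)"
      by (rule hermitian_opD(1)[OF factor_gradient_hermitian[OF a]])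
    show ?thesis
      unfolding XE[OF a] tr_mult_distrib(1)[OF ca(2) 3 2] tr_mult_smult(1)[OF ca(2) one_carrier_mat]
      unfolding factor_gradient_def tr_mult_distrib(1)[OF ca(2) 1 msum_carrier] tr_mult_distrib(3)[OF ca(2,3,4)]
        right_mult_one_mat[OF ca(2)]
      by (simp add: algebra_simps)
  qed
  have ver: "Re (tr (Y i * (vertex_gradient G \<Lambda> \<sigma>V i + complex_of_real (?k i - \<nu> i) \<cdot>\<^sub>m 1\<^sub>m (hdim G i)))) =
      ?k i * (Re (tr (Y i * mlog (\<sigma>V i))) + Re (tr (Y i))) - \<nu> i * (Re (tr (Y i)) - 0)
      + (\<Sum>a\<in>nbv G i. Re (tr (Y i * \<Lambda> i a)))" if i: "i \<in> verts G" for i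
  proof -
    note ci = cv[OF i]
    have 1: "complex_of_real (?k i) \<cdot>\<^sub>m mlog (\<sigma>V i) \<in> carrier_mat (hdim G i) (hdim G i)"
      by (rule smult_carrier_mat[OF ci(3)])
    have 2: "complex_of_real (?k i - \<nu> i) \<cdot>\<^sub>m 1\<^sub>m (hdim G i) \<in> carrier_mat (hdim G i) (hdim G i)" by simp
    have 3: "vertex_gradient G \<Lambda> \<sigma>V i \<in> carrier_mat (hdim G i) (hdim G i)"
      by (rule hermitian_opD(1)[OF vertex_gradient_hermitian[OF i]])
    show ?thesis
      unfolding YL[OF i] tr_mult_distrib(1)[OF ci(2) 3 2] tr_mult_smult(1)[OF ci(2) one_carrier_mat]
      unfolding vertex_gradient_def tr_mult_distrib(1)[OF ci(2) 1 msum_carrier] tr_mult_smult(1)[OF ci(2,3)]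
        right_mult_one_mat[OF ci(2)]
      by (simp add: algebra_simps)
  qed
  \<comment> \<open>The sum over edges is split in two: the part with \<open>X\<close> is grouped by
    factors, the part with \<open>Y\<close> by variables.\<close>
  have "(\<Sum>(i, a)\<in>edges G. Re (tr (X a * ?E i a)) - Re (tr (Y i * \<Lambda> i a))) =
      (\<Sum>a\<in>factors G. \<Sum>i\<in>nbf G a. Re (tr (X a * ?E i a))) - (\<Sum>i\<in>verts G. \<Sum>a\<in>nbv G i. Re (tr (Y i * \<Lambda> i a)))"
    unfolding sum_edges_factors[symmetric] sum_edges_verts[symmetric] sum_subtractf[symmetric]
    by (rule sum.cong) auto
  then have "?D = (\<Sum>a\<in>factors G. Re (tr (X a * (factor_gradient G \<Lambda> \<sigma>F a + complex_of_real (1 + \<kappa> a) \<cdot>\<^sub>m 1\<^sub>m (fdim G a)))))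
     - (\<Sum>i\<in>verts G. Re (tr (Y i * (vertex_gradient G \<Lambda> \<sigma>V i + complex_of_real (?k i - \<nu> i) \<cdot>\<^sub>m 1\<^sub>m (hdim G i)))))"
    by (simp only: fac ver sum.distrib sum_subtractf sum_negf cong: sum.cong)
  then show ?thesis using D by (simp only:)
qed

text \<open>The gradients are Hermitian and hence admissible directions. A direction equal to the
  gradient at one node and zero elsewhere makes the derivative, up to sign, the squared
  Hilbert-Schmidt norm of that gradient.\<close>

lemma lagrangian_stationary_iff:
  "lagrangian_stationary G \<kappa> \<nu> \<Lambda> \<sigma>F \<sigma>V \<longleftrightarrow>
    (\<forall>a\<in>factors G. factor_gradient G \<Lambda> \<sigma>F a + complex_of_real (1 + \<kappa> a) \<cdot>\<^sub>m 1\<^sub>m (fdim G a) = 0\<^sub>m (fdim G a) (fdim G a)) \<and>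
    (\<forall>i\<in>verts G. vertex_gradient G \<Lambda> \<sigma>V i +
      complex_of_real (real (card (nbv G i)) - 1 - \<nu> i) \<cdot>\<^sub>m 1\<^sub>m (hdim G i) = 0\<^sub>m (hdim G i) (hdim G i))"
    (is "_ \<longleftrightarrow> (\<forall>a\<in>_. ?H a = _) \<and> (\<forall>i\<in>_. ?J i = _)")
proof
  have H: "hermitian_op (fdim G a) (?H a)" if "a \<in> factors G" for a
    by (intro hermitian_add hermitian_smult hermitian_one factor_gradient_hermitian that)
  have J: "hermitian_op (hdim G i) (?J i)" if "i \<in> verts G" for i
    by (intro hermitian_add hermitian_smult hermitian_one vertex_gradient_hermitian that)
  have tr0: "Re (tr (0\<^sub>m n n * M)) = 0" if "M \<in> carrier_mat n n" for n M
    using that by (simp add: tr_def)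
  let ?Z = "\<lambda>a. 0\<^sub>m (fdim G a) (fdim G a)" and ?W = "\<lambda>i. 0\<^sub>m (hdim G i) (hdim G i)"
  have Z0: "(\<Sum>a\<in>factors G. Re (tr (?Z a * ?H a))) = 0"
    by (rule sum.neutral) (use tr0 hermitian_opD(1)[OF H] in blast)
  have W0: "(\<Sum>i\<in>verts G. Re (tr (?W i * ?J i))) = 0"
    by (rule sum.neutral) (use tr0 hermitian_opD(1)[OF J] in blast)
  { assume st: "lagrangian_stationary G \<kappa> \<nu> \<Lambda> \<sigma>F \<sigma>V"
    have zero: "(\<Sum>a\<in>factors G. Re (tr (X a * ?H a))) - (\<Sum>i\<in>verts G. Re (tr (Y i * ?J i))) = 0"
      if "\<And>a. a \<in> factors G \<Longrightarrow> hermitian_op (fdim G a) (X a)"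
        "\<And>i. i \<in> verts G \<Longrightarrow> hermitian_op (hdim G i) (Y i)" for X Y
      using DERIV_unique[OF lagrangian_derivative[OF that]] st that unfolding lagrangian_stationary_def by blast
    have "?H a = ?Z a" if a: "a \<in> factors G" for a
    proof (rule hermitian_trace_zero_imp_zero[OF H[OF a]])
      let ?X = "?Z(a := ?H a)"
      have "(\<Sum>b\<in>factors G. Re (tr (?X b * ?H b))) = Re (tr (?H a * ?H a)) + (\<Sum>b\<in>factors G - {a}. Re (tr (?X b * ?H b)))"
        using a by (subst sum.remove[OF finite_factors a]) simp
      also have "(\<Sum>b\<in>factors G - {a}. Re (tr (?X b * ?H b))) = 0"
        using tr0 hermitian_opD(1)[OF H] by (intro sum.neutral) auto
      finally have "(\<Sum>b\<in>factors G. Re (tr (?X b * ?H b))) = Re (tr (?H a * ?H a))" by simp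
      moreover have "hermitian_op (fdim G b) (?X b)" if "b \<in> factors G" for b
        using H[OF a] by (simp add: hermitian_zero)
      ultimately show "Re (tr (?H a * ?H a)) = 0" using zero[of ?X ?W] W0 hermitian_zero by simp
    qed
    moreover have "?J i = ?W i" if i: "i \<in> verts G" for i
    proof (rule hermitian_trace_zero_imp_zero[OF J[OF i]])
      let ?Y = "?W(i := ?J i)"
      have "(\<Sum>b\<in>verts G. Re (tr (?Y b * ?J b))) = Re (tr (?J i * ?J i)) + (\<Sum>b\<in>verts G - {i}. Re (tr (?Y b * ?J b)))"
        using i by (subst sum.remove[OF finite_verts i]) simp
      also have "(\<Sum>b\<in>verts G - {i}. Re (tr (?Y b * ?J b))) = 0"
        using tr0 hermitian_opD(1)[OF J] by (intro sum.neutral) auto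
      finally have "(\<Sum>b\<in>verts G. Re (tr (?Y b * ?J b))) = Re (tr (?J i * ?J i))" by simp
      moreover have "hermitian_op (hdim G b) (?Y b)" if "b \<in> verts G" for b
        using J[OF i] by (simp add: hermitian_zero)
      ultimately show "Re (tr (?J i * ?J i)) = 0" using zero[of ?Z ?Y] Z0 hermitian_zero by simp
    qed
    ultimately show "(\<forall>a\<in>factors G. ?H a = ?Z a) \<and> (\<forall>i\<in>verts G. ?J i = ?W i)" by blast }
  assume eq: "(\<forall>a\<in>factors G. ?H a = ?Z a) \<and> (\<forall>i\<in>verts G. ?J i = ?W i)"
  show "lagrangian_stationary G \<kappa> \<nu> \<Lambda> \<sigma>F \<sigma>V"
    unfolding lagrangian_stationary_def
  proof (intro allI impI)
    fix X Y assume "\<forall>a\<in>factors G. hermitian_op (fdim G a) (X a)" "\<forall>i\<in>verts G. hermitian_op (hdim G i) (Y i)"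
    then have X: "\<And>a. a \<in> factors G \<Longrightarrow> hermitian_op (fdim G a) (X a)"
      and Y: "\<And>i. i \<in> verts G \<Longrightarrow> hermitian_op (hdim G i) (Y i)" by auto
    have trz: "Re (tr (M * 0\<^sub>m n n)) = 0" if "M \<in> carrier_mat n n" for n M
      using that by (simp add: tr_def)
    have "(\<Sum>a\<in>factors G. Re (tr (X a * ?H a))) = 0"
      by (rule sum.neutral) (use eq trz hermitian_opD(1)[OF X] in force)
    moreover have "(\<Sum>i\<in>verts G. Re (tr (Y i * ?J i))) = 0"
      by (rule sum.neutral) (use eq trz hermitian_opD(1)[OF Y] in force)
    ultimately show "((\<lambda>t::real. lagrangian G \<kappa> \<nu> \<Lambda> (\<lambda>a. \<sigma>F a + complex_of_real t \<cdot>\<^sub>m X a)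
             (\<lambda>i. \<sigma>V i + complex_of_real t \<cdot>\<^sub>m Y i)) has_real_derivative 0) (at 0)"
      using lagrangian_derivative[OF X Y, of \<kappa> \<nu>] by simp
  qed
qed

text \<open>The trace multipliers enter the stationarity equations only as multiples of the
  identity, one free real number per node, so they absorb precisely what \<open>eq_mod_id\<close>
  ignores.\<close>

lemma exists_stationary_iff:
  "(\<exists>\<kappa> \<nu>. lagrangian_stationary G \<kappa> \<nu> \<Lambda> \<sigma>F \<sigma>V) \<longleftrightarrow>
    (\<forall>a\<in>factors G. eq_mod_id (fdim G a) (factor_gradient G \<Lambda> \<sigma>F a) (0\<^sub>m (fdim G a) (fdim G a))) \<and>
    (\<forall>i\<in>verts G. eq_mod_id (hdim G i) (vertex_gradient G \<Lambda> \<sigma>V i) (0\<^sub>m (hdim G i) (hdim G i)))"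
    (is "?L \<longleftrightarrow> ?R")
proof -
  have shift: "M + complex_of_real r \<cdot>\<^sub>m 1\<^sub>m n = 0\<^sub>m n n \<longleftrightarrow> M = 0\<^sub>m n n + complex_of_real (- r) \<cdot>\<^sub>m 1\<^sub>m n"
    if M: "M \<in> carrier_mat n n" for M n r
  proof
    assume eq: "M + complex_of_real r \<cdot>\<^sub>m 1\<^sub>m n = 0\<^sub>m n n"
    show "M = 0\<^sub>m n n + complex_of_real (- r) \<cdot>\<^sub>m 1\<^sub>m n"
    proof (rule eq_matI)
      fix i j assume "i < dim_row (0\<^sub>m n n + complex_of_real (- r) \<cdot>\<^sub>m 1\<^sub>m n)"
        "j < dim_col (0\<^sub>m n n + complex_of_real (- r) \<cdot>\<^sub>m 1\<^sub>m n)"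
      then have ij: "i < n" "j < n" by auto
      then have "M $$ (i, j) + complex_of_real r * 1\<^sub>m n $$ (i, j) = 0"
        using M arg_cong[OF eq, of "\<lambda>A. A $$ (i, j)"] by (simp del: index_one_mat(1))
      then show "M $$ (i, j) = (0\<^sub>m n n + complex_of_real (- r) \<cdot>\<^sub>m 1\<^sub>m n) $$ (i, j)"
        using ij by (simp add: add_eq_0_iff2 del: index_one_mat(1))
    qed (use M in auto)
  qed (auto intro!: eq_matI)
  have F: "factor_gradient G \<Lambda> \<sigma>F a \<in> carrier_mat (fdim G a) (fdim G a)" if "a \<in> factors G" for a
    by (rule hermitian_opD(1)[OF factor_gradient_hermitian[OF that]])
  have V: "vertex_gradient G \<Lambda> \<sigma>V i \<in> carrier_mat (hdim G i) (hdim G i)" if "i \<in> verts G" for i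
    by (rule hermitian_opD(1)[OF vertex_gradient_hermitian[OF that]])
  show ?thesis
  proof
    assume ?L
    then show ?R unfolding lagrangian_stationary_iff eq_mod_id_def using shift F V by blast
  next
    assume ?R
    then obtain f g :: "_ \<Rightarrow> real" where
      f: "\<And>a. a \<in> factors G \<Longrightarrow> factor_gradient G \<Lambda> \<sigma>F a = 0\<^sub>m (fdim G a) (fdim G a) + complex_of_real (f a) \<cdot>\<^sub>m 1\<^sub>m (fdim G a)"
      and g: "\<And>i. i \<in> verts G \<Longrightarrow> vertex_gradient G \<Lambda> \<sigma>V i = 0\<^sub>m (hdim G i) (hdim G i) + complex_of_real (g i) \<cdot>\<^sub>m 1\<^sub>m (hdim G i)"
      unfolding eq_mod_id_def by metis
    \<comment> \<open>The multipliers solve \<open>1 + \<kappa> a = - f a\<close> and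
      \<open>card (nbv G i) - 1 - \<nu> i = - g i\<close>.\<close>
    have "lagrangian_stationary G (\<lambda>a. - f a - 1) (\<lambda>i. g i + (real (card (nbv G i)) - 1)) \<Lambda> \<sigma>F \<sigma>V"
      unfolding lagrangian_stationary_iff
    proof (intro conjI ballI)
      fix a assume a: "a \<in> factors G"
      show "factor_gradient G \<Lambda> \<sigma>F a + complex_of_real (1 + (- f a - 1)) \<cdot>\<^sub>m 1\<^sub>m (fdim G a) = 0\<^sub>m (fdim G a) (fdim G a)"
        by (rule shift[OF F[OF a], THEN iffD2]) (simp add: f[OF a])
    next
      fix i assume i: "i \<in> verts G"
      let ?k = "real (card (nbv G i)) - 1"
      show "vertex_gradient G \<Lambda> \<sigma>V i + complex_of_real (?k - (g i + ?k)) \<cdot>\<^sub>m 1\<^sub>m (hdim G i) = 0\<^sub>m (hdim G i) (hdim G i)"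
        by (rule shift[OF V[OF i], THEN iffD2]) (simp add: g[OF i])
    qed
    then show ?L by blast
  qed
qed

end

end

section \<open>Beliefs and updates in terms of logarithms\<close>

lemma eq_mod_id_minus_cancel:
  assumes "eq_mod_id n (A - C) (B - C)" "A \<in> carrier_mat n n" "B \<in> carrier_mat n n" "C \<in> carrier_mat n n"
  shows "eq_mod_id n A B"
proof -
  have BC: "B - C \<in> carrier_mat n n" by (rule minus_carrier_mat[OF assms(4)])
  obtain c :: real where c: "\<And>i j. i < n \<Longrightarrow> j < n \<Longrightarrow>
      (A - C) $$ (i, j) = (B - C) $$ (i, j) + complex_of_real c * 1\<^sub>m n $$ (i, j)"
    using eq_mod_idE[OF assms(1) BC] by metis
  show ?thesis
  proof (rule eq_mod_idI[OF assms(2,3), where c = c])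
    fix i j assume ij: "i < n" "j < n"
    show "A $$ (i, j) = B $$ (i, j) + complex_of_real c * 1\<^sub>m n $$ (i, j)"
      using c[OF ij] assms(2-4) ij by (simp add: algebra_simps del: index_one_mat)
  qed
qed

lemma eq_mod_id_minus:
  assumes "eq_mod_id n A B" "B \<in> carrier_mat n n" "C \<in> carrier_mat n n"
  shows "eq_mod_id n (A - C) (B - C)"
  using eq_mod_id_add[OF assms(1) eq_mod_id_refl[of "- C" n] assms(2)] assms eq_mod_id_carrier[OF assms(1,2)]
  by (simp add: minus_add_uminus_mat[of _ n n])

text \<open>\<open>L\<close> and \<open>R\<close> are the logarithms of a factor belief and of its
  potential, \<open>M\<close> and \<open>N\<close> the sums of embedded log-messages and of embedded
  multipliers. Since \<open>L - R + N\<close> is the sum of \<open>L - R - M\<close> and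
  \<open>M + N\<close>, any two of the three relations imply the third.\<close>

lemma eq_mod_id_gradient:
  assumes c: "L \<in> carrier_mat n n" "R \<in> carrier_mat n n" "M \<in> carrier_mat n n" "N \<in> carrier_mat n n"
  shows "eq_mod_id n L (R + M) \<Longrightarrow> eq_mod_id n (M + N) (0\<^sub>m n n) \<Longrightarrow> eq_mod_id n (L - R + N) (0\<^sub>m n n)"
    and "eq_mod_id n L (R + M) \<Longrightarrow> eq_mod_id n (L - R + N) (0\<^sub>m n n) \<Longrightarrow> eq_mod_id n (M + N) (0\<^sub>m n n)"
    and "eq_mod_id n (M + N) (0\<^sub>m n n) \<Longrightarrow> eq_mod_id n (L - R + N) (0\<^sub>m n n) \<Longrightarrow> eq_mod_id n L (R + M)"
proof -
  have cc: "R + M \<in> carrier_mat n n" "M + N \<in> carrier_mat n n" "L - R + N \<in> carrier_mat n n"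
    using c by auto
  have LRM: "eq_mod_id n L (R + M) \<longleftrightarrow>
      (\<exists>x::real. \<forall>i<n. \<forall>j<n. L $$ (i, j) = R $$ (i, j) + M $$ (i, j) + complex_of_real x * 1\<^sub>m n $$ (i, j))"
    unfolding eq_mod_id_iff[OF c(1) cc(1)] using c by (simp del: index_one_mat)
  have MN: "eq_mod_id n (M + N) (0\<^sub>m n n) \<longleftrightarrow>
      (\<exists>x::real. \<forall>i<n. \<forall>j<n. M $$ (i, j) + N $$ (i, j) = complex_of_real x * 1\<^sub>m n $$ (i, j))"
    unfolding eq_mod_id_iff[OF cc(2) zero_carrier_mat] using c by (simp del: index_one_mat)
  have LRN: "eq_mod_id n (L - R + N) (0\<^sub>m n n) \<longleftrightarrow>
      (\<exists>x::real. \<forall>i<n. \<forall>j<n. L $$ (i, j) - R $$ (i, j) + N $$ (i, j) = complex_of_real x * 1\<^sub>m n $$ (i, j))"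
    unfolding eq_mod_id_iff[OF cc(3) zero_carrier_mat] using c by (simp del: index_one_mat)
  show "eq_mod_id n L (R + M) \<Longrightarrow> eq_mod_id n (M + N) (0\<^sub>m n n) \<Longrightarrow> eq_mod_id n (L - R + N) (0\<^sub>m n n)"
    unfolding LRM MN LRN
  proof (elim exE)
    fix x y :: real
    assume "\<forall>i<n. \<forall>j<n. L $$ (i, j) = R $$ (i, j) + M $$ (i, j) + complex_of_real x * 1\<^sub>m n $$ (i, j)"
      "\<forall>i<n. \<forall>j<n. M $$ (i, j) + N $$ (i, j) = complex_of_real y * 1\<^sub>m n $$ (i, j)"
    then show "\<exists>x::real. \<forall>i<n. \<forall>j<n. L $$ (i, j) - R $$ (i, j) + N $$ (i, j) = complex_of_real x * 1\<^sub>m n $$ (i, j)"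
      by (intro exI[of _ "x + y"]) (simp add: algebra_simps del: index_one_mat)
  qed
  show "eq_mod_id n L (R + M) \<Longrightarrow> eq_mod_id n (L - R + N) (0\<^sub>m n n) \<Longrightarrow> eq_mod_id n (M + N) (0\<^sub>m n n)"
    unfolding LRM MN LRN
  proof (elim exE)
    fix x y :: real
    assume "\<forall>i<n. \<forall>j<n. L $$ (i, j) = R $$ (i, j) + M $$ (i, j) + complex_of_real x * 1\<^sub>m n $$ (i, j)"
      "\<forall>i<n. \<forall>j<n. L $$ (i, j) - R $$ (i, j) + N $$ (i, j) = complex_of_real y * 1\<^sub>m n $$ (i, j)"
    then show "\<exists>x::real. \<forall>i<n. \<forall>j<n. M $$ (i, j) + N $$ (i, j) = complex_of_real x * 1\<^sub>m n $$ (i, j)"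
      by (intro exI[of _ "y - x"]) (simp add: algebra_simps del: index_one_mat)
  qed
  show "eq_mod_id n (M + N) (0\<^sub>m n n) \<Longrightarrow> eq_mod_id n (L - R + N) (0\<^sub>m n n) \<Longrightarrow> eq_mod_id n L (R + M)"
    unfolding LRM MN LRN
  proof (elim exE)
    fix x y :: real
    assume x: "\<forall>i<n. \<forall>j<n. M $$ (i, j) + N $$ (i, j) = complex_of_real x * 1\<^sub>m n $$ (i, j)"
      and y: "\<forall>i<n. \<forall>j<n. L $$ (i, j) - R $$ (i, j) + N $$ (i, j) = complex_of_real y * 1\<^sub>m n $$ (i, j)"
    have "L $$ (i, j) = R $$ (i, j) + M $$ (i, j) + complex_of_real (y - x) * 1\<^sub>m n $$ (i, j)" if "i < n" "j < n" for i j
    proof -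
      have "complex_of_real (y - x) * 1\<^sub>m n $$ (i, j) = (L $$ (i, j) - R $$ (i, j) + N $$ (i, j)) - (M $$ (i, j) + N $$ (i, j))"
        using x y that by (simp add: algebra_simps del: index_one_mat)
      then show ?thesis by (simp only:) simp
    qed
    then show "\<exists>x::real. \<forall>i<n. \<forall>j<n. L $$ (i, j) = R $$ (i, j) + M $$ (i, j) + complex_of_real x * 1\<^sub>m n $$ (i, j)"
      by blast
  qed
qed

text \<open>One direction is \<open>embed_sum_scalar\<close>; the other holds because embedding a
  multiple of the identity gives a multiple of the identity.\<close>

lemma embed_sum_zero_iff:
  assumes S: "finite S" and d: "\<And>k. k \<in> S \<Longrightarrow> d k \<ge> 1" and Z: "\<And>k. k \<in> S \<Longrightarrow> hermitian_op (d k) (Z k)"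
  shows "eq_mod_id (tdim d S) (msum (tdim d S) (\<lambda>k. embed_op d S k (Z k)) S) (0\<^sub>m (tdim d S) (tdim d S)) \<longleftrightarrow>
    (\<forall>k\<in>S. eq_mod_id (d k) (Z k) (0\<^sub>m (d k) (d k)))" (is "?L \<longleftrightarrow> ?R")
proof
  let ?N = "tdim d S"
  assume ?L
  then obtain c where "msum ?N (\<lambda>k. embed_op d S k (Z k)) S = complex_of_real c \<cdot>\<^sub>m 1\<^sub>m ?N"
    unfolding eq_mod_id_def by auto
  then have "\<exists>c'. Z k = complex_of_real c' \<cdot>\<^sub>m 1\<^sub>m (d k)" if "k \<in> S" for k
    using embed_sum_scalar[of S d Z c k] S d Z that by blast
  then show ?R unfolding eq_mod_id_def by simp
next
  let ?N = "tdim d S"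
  assume R: ?R
  have E0: "embed_op d S k (0\<^sub>m (d k) (d k)) = 0\<^sub>m ?N ?N" if "k \<in> S" for k
  proof (rule eq_matI)
    fix u w assume "u < dim_row (0\<^sub>m ?N ?N :: complex mat)" "w < dim_col (0\<^sub>m ?N ?N :: complex mat)"
    then have uw: "u < ?N" "w < ?N" by auto
    then have "basis_cfg d S u k < d k" "basis_cfg d S w k < d k"
      using basis_cfg_less[OF S _ that] by auto
    then show "embed_op d S k (0\<^sub>m (d k) (d k)) $$ (u, w) = 0\<^sub>m ?N ?N $$ (u, w)"
      using uw by (simp add: embed_op_index[OF S uw that])
  qed auto
  have "eq_mod_id ?N (msum ?N (\<lambda>k. embed_op d S k (Z k)) S) (msum ?N (\<lambda>k. 0\<^sub>m ?N ?N) S)"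
  proof (rule eq_mod_id_msum)
    fix k assume k: "k \<in> S"
    have "eq_mod_id ?N (embed_op d S k (Z k)) (embed_op d S k (0\<^sub>m (d k) (d k)))"
      by (rule embed_eq_mod_id[OF S k]) (use R k in auto)
    then show "eq_mod_id ?N (embed_op d S k (Z k)) (0\<^sub>m ?N ?N)" unfolding E0[OF k] .
  qed simp
  moreover have "msum ?N (\<lambda>k. 0\<^sub>m ?N ?N) S = 0\<^sub>m ?N ?N" by (rule eq_matI) auto
  ultimately show ?L by simp
qed

lemma node_belief_iff:
  assumes "\<And>a. a \<in> K \<Longrightarrow> posdef_op n (M a)" "finite K" "posdef_op n s"
  shows "s \<propto>\<^sub>+ big_star n M K \<longleftrightarrow> eq_mod_id n (mlog s) (msum n (\<lambda>a. mlog (M a)) K)"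
proof -
  have "posdef_op n (big_star n M K)" "mlog (big_star n M K) = msum n (\<lambda>a. mlog (M a)) K"
    using big_star_posdef[of K n M] assms by blast+
  then show ?thesis using propto_iff_mlog[OF assms(3)] by simp
qed

lemma messagesD:
  assumes "messages G mVF mFV" "(i, a) \<in> edges G"
  shows "density_op (hdim G i) (mVF i a)" "posdef_op (hdim G i) (mVF i a)"
    "density_op (hdim G i) (mFV a i)" "posdef_op (hdim G i) (mFV a i)"
  using assms unfolding messages_def by auto

context
  fixes G :: "('v, 'f) qfg"
  assumes qfg: "quantum_factor_graph G"
    and pot: "\<And>a. a \<in> factors G \<Longrightarrow> posdef_op (fdim G a) (pot G a)"
begin

text \<open>Updates multiply the potential by a tensor product, beliefs multiply it by a star
  product of embedded messages. Both second factors have the same logarithm, and \<open>star\<close>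
  depends on them only through it.\<close>

lemma factor_product:
  fixes mVF
  assumes a: "a \<in> factors G" and m: "\<And>k. k \<in> nbf G a \<Longrightarrow> posdef_op (hdim G k) (mVF k a)"
  defines "T \<equiv> pot G a \<star> tensor_op (hdim G) (nbf G a) (\<lambda>k. mVF k a)"
  shows "posdef_op (fdim G a) T"
    "mlog T = mlog (pot G a) + msum (fdim G a) (\<lambda>k. embed_op (hdim G) (nbf G a) k (mlog (mVF k a))) (nbf G a)"
    "pot G a \<star> big_star (fdim G a) (\<lambda>i. embed_op (hdim G) (nbf G a) i (mVF i a)) (nbf G a) = T"
proof -
  note fin = finite_nbf[OF qfg, of a]
  have t: "posdef_op (fdim G a) (tensor_op (hdim G) (nbf G a) (\<lambda>k. mVF k a))"
    and lt: "mlog (tensor_op (hdim G) (nbf G a) (\<lambda>k. mVF k a)) =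
      msum (fdim G a) (\<lambda>k. embed_op (hdim G) (nbf G a) k (mlog (mVF k a))) (nbf G a)"
    unfolding fdim_def by (rule tensor_posdef[OF fin]; use m in blast)+
  show "posdef_op (fdim G a) T"
    "mlog T = mlog (pot G a) + msum (fdim G a) (\<lambda>k. embed_op (hdim G) (nbf G a) k (mlog (mVF k a))) (nbf G a)"
    unfolding T_def using star_posdef[OF pot[OF a] t] lt by simp_all
  have e: "posdef_op (fdim G a) (embed_op (hdim G) (nbf G a) k (mVF k a))"
    "mlog (embed_op (hdim G) (nbf G a) k (mVF k a)) = embed_op (hdim G) (nbf G a) k (mlog (mVF k a))"
    if "k \<in> nbf G a" for k
    unfolding fdim_def by (rule embed_posdef[where d = "hdim G" and i = k, OF fin m[OF that] that])+
  have "mlog (big_star (fdim G a) (\<lambda>i. embed_op (hdim G) (nbf G a) i (mVF i a)) (nbf G a)) =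
      msum (fdim G a) (\<lambda>k. mlog (embed_op (hdim G) (nbf G a) k (mVF k a))) (nbf G a)"
    by (rule big_star_posdef(2)[OF fin e(1)])
  also have "\<dots> = mlog (tensor_op (hdim G) (nbf G a) (\<lambda>k. mVF k a))"
    unfolding lt by (rule msum_cong) (rule e(2))
  finally show "pot G a \<star> big_star (fdim G a) (\<lambda>i. embed_op (hdim G) (nbf G a) i (mVF i a)) (nbf G a) = T"
    unfolding T_def star_def by simp
qed

lemma factor_belief_iff:
  assumes a: "a \<in> factors G" and m: "\<And>k. k \<in> nbf G a \<Longrightarrow> posdef_op (hdim G k) (mVF k a)"
    and s: "posdef_op (fdim G a) s"
  shows "s \<propto>\<^sub>+ pot G a \<star> big_star (fdim G a) (\<lambda>i. embed_op (hdim G) (nbf G a) i (mVF i a)) (nbf G a) \<longleftrightarrow>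
    eq_mod_id (fdim G a) (mlog s)
      (mlog (pot G a) + msum (fdim G a) (\<lambda>k. embed_op (hdim G) (nbf G a) k (mlog (mVF k a))) (nbf G a))"
  using propto_iff_mlog[OF s factor_product(1)[of a mVF, OF a m]] factor_product(2,3)[of a mVF, OF a m] by simp

lemma ptrace_factor_posdef:
  assumes "posdef_op (fdim G a) s" "i \<in> nbf G a"
  shows "posdef_op (hdim G i) (ptrace (hdim G) (nbf G a) i s)"
  using assms nbf_hdim_pos[OF qfg] unfolding fdim_def
  by (intro ptrace_posdef[OF finite_nbf[OF qfg]]) auto

text \<open>The belief \<open>s\<close> is proportional to the operator under the partial trace, so
  its marginal may be used instead at the cost of a multiple of the identity in the logarithm;
  \<open>minv\<close> contributes the subtraction.\<close>

lemma factor_update_iff: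
  assumes a: "a \<in> factors G" and m: "\<And>k. k \<in> nbf G a \<Longrightarrow> posdef_op (hdim G k) (mVF k a)"
    and s: "s \<propto>\<^sub>+ pot G a \<star> big_star (fdim G a) (\<lambda>i. embed_op (hdim G) (nbf G a) i (mVF i a)) (nbf G a)"
    and i: "i \<in> nbf G a" and q: "posdef_op (hdim G i) q"
  shows "q \<propto>\<^sub>+ ptrace (hdim G) (nbf G a) i (pot G a \<star> tensor_op (hdim G) (nbf G a) (\<lambda>k. mVF k a)) \<star> minv (mVF i a) \<longleftrightarrow>
    eq_mod_id (hdim G i) (mlog q) (mlog (ptrace (hdim G) (nbf G a) i s) - mlog (mVF i a))"
proof -
  let ?n = "hdim G i" and ?pt = "ptrace (hdim G) (nbf G a) i" and ?P = "mlog (mVF i a)"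
  define T where "T = pot G a \<star> tensor_op (hdim G) (nbf G a) (\<lambda>k. mVF k a)"
  note T = factor_product(1)[of a mVF, OF a m, folded T_def]
  have sT: "s \<propto>\<^sub>+ T" using s factor_product(3)[of a mVF, OF a m] unfolding T_def by simp
  have s': "posdef_op (fdim G a) s" by (rule propto_posdef[OF sT T])
  note pT = ptrace_factor_posdef[OF T i] and ps = ptrace_factor_posdef[OF s' i]
  have "?pt s \<propto>\<^sub>+ ?pt T"
    by (rule ptrace_propto[OF finite_nbf[OF qfg] sT]) (use posdef_opD(2)[OF T] in \<open>simp add: fdim_def\<close>)
  then have TT: "eq_mod_id ?n (mlog (?pt s)) (mlog (?pt T))" using propto_iff_mlog[OF ps pT] by simp
  have c: "mlog (?pt s) \<in> carrier_mat ?n ?n" "mlog (?pt T) \<in> carrier_mat ?n ?n" "?P \<in> carrier_mat ?n ?n"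
    using hermitian_opD(1)[OF mlog_hermitian] ps pT m[OF i] by auto
  have d: "mlog (?pt s) - ?P \<in> carrier_mat ?n ?n" "mlog (?pt T) - ?P \<in> carrier_mat ?n ?n"
    by (rule minus_carrier_mat[OF c(3)])+
  have iff: "eq_mod_id ?n (mlog q) (mlog (?pt T) - ?P) \<longleftrightarrow> eq_mod_id ?n (mlog q) (mlog (?pt s) - ?P)"
    using eq_mod_id_trans[OF _ eq_mod_id_minus[OF TT c(2,3)] d(2)]
      eq_mod_id_trans[OF _ eq_mod_id_minus[OF eq_mod_id_sym[OF TT c(2)] c(1,3)] d(1)] by blast
  have r: "posdef_op ?n (?pt T \<star> minv (mVF i a))" "mlog (?pt T \<star> minv (mVF i a)) = mlog (?pt T) - ?P"
    using star_posdef[OF pT posdef_minv[OF m[OF i]]] mlog_minv[OF m[OF i]] minus_add_uminus_mat[OF c(2,3)] by simp_all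
  show ?thesis unfolding T_def[symmetric] propto_iff_mlog[OF q r(1)] r(2) iff ..
qed

text \<open>The three implications have separate uses: fixed points give stationarity, given beliefs
  pin down the multipliers of a stationary point, and multipliers of a stationary point produce
  messages with the right factor beliefs.\<close>

lemma factor_gradient_eq:
  fixes mVF
  assumes a: "a \<in> factors G" and m: "\<And>k. k \<in> nbf G a \<Longrightarrow> posdef_op (hdim G k) (mVF k a)"
    and \<Lambda>: "\<And>k. k \<in> nbf G a \<Longrightarrow> hermitian_op (hdim G k) (\<Lambda> k a)"
    and s: "posdef_op (fdim G a) (\<sigma>F a)"
  defines "belief \<equiv> \<sigma>F a \<propto>\<^sub>+ pot G a \<star> big_star (fdim G a) (\<lambda>i. embed_op (hdim G) (nbf G a) i (mVF i a)) (nbf G a)"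
    and "stationary \<equiv> eq_mod_id (fdim G a) (factor_gradient G \<Lambda> \<sigma>F a) (0\<^sub>m (fdim G a) (fdim G a))"
    and "multiplier \<equiv> \<forall>k\<in>nbf G a. eq_mod_id (hdim G k) (mlog (mVF k a) + \<Lambda> k a) (0\<^sub>m (hdim G k) (hdim G k))"
  shows "belief \<Longrightarrow> multiplier \<Longrightarrow> stationary" "belief \<Longrightarrow> stationary \<Longrightarrow> multiplier"
    "multiplier \<Longrightarrow> stationary \<Longrightarrow> belief"
proof -
  let ?n = "fdim G a" and ?E = "\<lambda>k. embed_op (hdim G) (nbf G a) k"
  let ?M = "msum ?n (\<lambda>k. ?E k (mlog (mVF k a))) (nbf G a)" and ?N = "msum ?n (\<lambda>k. ?E k (\<Lambda> k a)) (nbf G a)"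
  note fin = finite_nbf[OF qfg, of a]
  have c: "mlog (\<sigma>F a) \<in> carrier_mat ?n ?n" "mlog (pot G a) \<in> carrier_mat ?n ?n"
    using hermitian_opD(1)[OF mlog_hermitian] s pot[OF a] by auto
  have P: "hermitian_op (hdim G k) (mlog (mVF k a))" if "k \<in> nbf G a" for k
    by (rule mlog_hermitian[OF m[OF that]])
  have h: "hermitian_op (hdim G k) (mlog (mVF k a) + \<Lambda> k a)" if "k \<in> nbf G a" for k
    by (rule hermitian_add[OF P[OF that] \<Lambda>[OF that]])
  have "?M + ?N = msum ?n (\<lambda>k. ?E k (mlog (mVF k a)) + ?E k (\<Lambda> k a)) (nbf G a)"
    by (rule eq_matI) (auto simp: sum.distrib fdim_def)
  also have "\<dots> = msum ?n (\<lambda>k. ?E k (mlog (mVF k a) + \<Lambda> k a)) (nbf G a)"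
    by (rule msum_cong, rule embed_add[symmetric, OF fin]) (auto intro: hermitian_opD(1)[OF P] hermitian_opD(1)[OF \<Lambda>])
  finally have MN: "eq_mod_id ?n (?M + ?N) (0\<^sub>m ?n ?n) \<longleftrightarrow> multiplier"
    unfolding multiplier_def fdim_def
    using embed_sum_zero_iff[OF fin nbf_hdim_pos[OF qfg] h] by simp
  have B: "eq_mod_id ?n (mlog (\<sigma>F a)) (mlog (pot G a) + ?M) \<longleftrightarrow> belief"
    unfolding belief_def using factor_belief_iff[of a mVF, OF a m s] by simp
  have S: "eq_mod_id ?n (mlog (\<sigma>F a) - mlog (pot G a) + ?N) (0\<^sub>m ?n ?n) \<longleftrightarrow> stationary"
    unfolding stationary_def factor_gradient_def ..
  show "belief \<Longrightarrow> multiplier \<Longrightarrow> stationary" "belief \<Longrightarrow> stationary \<Longrightarrow> multiplier"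
    "multiplier \<Longrightarrow> stationary \<Longrightarrow> belief"
    using eq_mod_id_gradient[OF c, of ?M ?N, OF msum_carrier msum_carrier] unfolding MN B S by blast+
qed

end

section \<open>From fixed points to interior stationary points, and back\<close>

context
  fixes G :: "('v, 'f) qfg"
  assumes qfg: "quantum_factor_graph G"
    and pot: "\<And>a. a \<in> factors G \<Longrightarrow> posdef_op (fdim G a) (pot G a)"
begin

lemma node_updates:
  assumes i: "i \<in> verts G" and s: "posdef_op (hdim G i) s"
    and q: "\<And>a. a \<in> nbv G i \<Longrightarrow> posdef_op (hdim G i) (q a)"
    and b: "s \<propto>\<^sub>+ big_star (hdim G i) q (nbv G i)"
    and a: "a \<in> nbv G i" and p: "posdef_op (hdim G i) p"
  shows "p \<propto>\<^sub>+ big_star (hdim G i) q (nbv G i - {a}) \<longleftrightarrow>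
    eq_mod_id (hdim G i) (mlog (q a)) (mlog s - mlog p)"
proof -
  note fin = finite_nbv[OF qfg, of i]
  have c: "mlog s \<in> carrier_mat (hdim G i) (hdim G i)" "mlog p \<in> carrier_mat (hdim G i) (hdim G i)"
    "mlog (q a) \<in> carrier_mat (hdim G i) (hdim G i)"
    using hermitian_opD(1)[OF mlog_hermitian] s p q[OF a] by auto
  have "eq_mod_id (hdim G i) (mlog s) (msum (hdim G i) (\<lambda>a. mlog (q a)) (nbv G i))"
    using node_belief_iff[of "nbv G i" "hdim G i" q s] q fin s b by blast
  moreover have "p \<propto>\<^sub>+ big_star (hdim G i) q (nbv G i - {a}) \<longleftrightarrow>
      eq_mod_id (hdim G i) (mlog p) (msum (hdim G i) (\<lambda>a. mlog (q a)) (nbv G i - {a}))"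
    using node_belief_iff[of "nbv G i - {a}" "hdim G i" q p] q fin p by blast
  ultimately show ?thesis using node_update_iff[OF fin a c(1,2), of "\<lambda>a. mlog (q a)"] c(3) by simp
qed

text \<open>Consistency has to be derived, because factor and variable beliefs are built from
  different messages. The two updates at an edge give two expressions for
  \<open>mlog (mFV a i)\<close>; comparing them cancels \<open>mlog (mVF i a)\<close> and shows that
  the marginal of \<open>\<sigma>F a\<close> is proportional to \<open>\<sigma>V i\<close>.\<close>

theorem fixed_point_imp_interior_stationary:
  assumes msg: "messages G mVF mFV" and fp: "bp_fixed_point G mVF mFV"
    and dens: "density_family G \<sigma>F \<sigma>V" and bel: "bp_beliefs G mVF mFV \<sigma>F \<sigma>V"
  shows "interior_stationary G \<sigma>F \<sigma>V"
proof -
  note m = messagesD[OF msg]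
  have mF: "posdef_op (hdim G k) (mVF k a)" if "k \<in> nbf G a" for k a
    using m(2)[of k a] that by (simp add: nbf_def)
  have mV: "posdef_op (hdim G i) (mFV a i)" if "a \<in> nbv G i" for i a
    using m(4)[of i a] that by (simp add: nbv_def)
  have bF: "\<sigma>F a \<propto>\<^sub>+ pot G a \<star> big_star (fdim G a) (\<lambda>i. embed_op (hdim G) (nbf G a) i (mVF i a)) (nbf G a)"
    if "a \<in> factors G" for a using bel that unfolding bp_beliefs_def by blast
  have bV: "\<sigma>V i \<propto>\<^sub>+ big_star (hdim G i) (\<lambda>a. mFV a i) (nbv G i)" if "i \<in> verts G" for i
    using bel that unfolding bp_beliefs_def by blast
  have pF: "posdef_op (fdim G a) (\<sigma>F a)" if a: "a \<in> factors G" for a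
    using propto_posdef[OF bF[OF a]] factor_product(1,3)[OF qfg pot a, of mVF] mF by simp
  have pV: "posdef_op (hdim G i) (\<sigma>V i)" if i: "i \<in> verts G" for i
    using propto_posdef[OF bV[OF i]] big_star_posdef(1)[OF finite_nbv[OF qfg], of i "hdim G i" "\<lambda>a. mFV a i"] mV by blast
  have Q: "eq_mod_id (hdim G i) (mlog (mFV a i)) (mlog (\<sigma>V i) - mlog (mVF i a))" if e: "(i, a) \<in> edges G" for i a
  proof -
    have "mVF i a \<propto>\<^sub>+ big_star (hdim G i) (\<lambda>c. mFV c i) (nbv G i - {a})"
      using fp e unfolding bp_fixed_point_def bp_var_to_factor_def by blast
    moreover have "a \<in> nbv G i" using e by (simp add: nbv_def)
    moreover note i = edge_vert[OF qfg e]
    ultimately show ?thesis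
      using node_updates[OF i pV[OF i] mV bV[OF i], where a = a and p = "mVF i a"] m(2)[OF e] by blast
  qed
  have consistent: "ptrace (hdim G) (nbf G a) i (\<sigma>F a) = \<sigma>V i" if e: "(i, a) \<in> edges G" for i a
  proof -
    let ?n = "hdim G i" and ?T = "ptrace (hdim G) (nbf G a) i (\<sigma>F a)"
    have i: "i \<in> verts G" and a: "a \<in> factors G" and inb: "i \<in> nbf G a"
      using edge_vert[OF qfg e] edge_factor[OF qfg e] e by (auto simp: nbf_def)
    note pT = ptrace_factor_posdef[OF qfg pot pF[OF a] inb]
    have "mFV a i \<propto>\<^sub>+ ptrace (hdim G) (nbf G a) i (pot G a \<star> tensor_op (hdim G) (nbf G a) (\<lambda>k. mVF k a)) \<star> minv (mVF i a)"
      using fp e unfolding bp_fixed_point_def bp_factor_to_var_def by blast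
    then have QT: "eq_mod_id ?n (mlog (mFV a i)) (mlog ?T - mlog (mVF i a))"
      using factor_update_iff[where G = G and mVF = mVF and a = a and i = i, OF qfg pot a mF bF[OF a] inb m(4)[OF e]] by blast
    have c: "mlog ?T \<in> carrier_mat ?n ?n" "mlog (\<sigma>V i) \<in> carrier_mat ?n ?n" "mlog (mVF i a) \<in> carrier_mat ?n ?n"
      using hermitian_opD(1)[OF mlog_hermitian] pT pV[OF i] m(2)[OF e] by auto
    have d: "mlog ?T - mlog (mVF i a) \<in> carrier_mat ?n ?n" "mlog (\<sigma>V i) - mlog (mVF i a) \<in> carrier_mat ?n ?n"
      by (rule minus_carrier_mat[OF c(3)])+
    have "eq_mod_id ?n (mlog ?T - mlog (mVF i a)) (mlog (\<sigma>V i) - mlog (mVF i a))"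
      by (rule eq_mod_id_trans[OF eq_mod_id_sym[OF QT d(1)] Q[OF e] d(2)])
    then have "eq_mod_id ?n (mlog ?T) (mlog (\<sigma>V i))" by (rule eq_mod_id_minus_cancel[OF _ c])
    then have "?T \<propto>\<^sub>+ \<sigma>V i" using propto_iff_mlog[OF pT pV[OF i]] by simp
    \<comment> \<open>Traces fix the remaining factor: the partial trace preserves the trace, and
      both beliefs are normalised.\<close>
    moreover have "tr ?T = tr (\<sigma>F a)"
      by (rule tr_ptrace_eq[where d = "hdim G", OF finite_nbf[OF qfg] _ inb])
        (use posdef_opD(2)[OF pF[OF a]] in \<open>simp add: fdim_def\<close>)
    then have "tr ?T = 1" "tr (\<sigma>V i) = 1" using dens a i unfolding density_family_def density_op_def by auto
    ultimately show "?T = \<sigma>V i" using propto_density_eq posdef_opD(2)[OF pV[OF i]] by blast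
  qed
  define \<Lambda> where "\<Lambda> i a = - mlog (mVF i a)" for i a
  have L: "hermitian_op (hdim G i) (\<Lambda> i a)" if "(i, a) \<in> edges G" for i a
    unfolding \<Lambda>_def by (intro hermitian_uminus mlog_hermitian m(2)[OF that])
  have "eq_mod_id (fdim G a) (factor_gradient G \<Lambda> \<sigma>F a) (0\<^sub>m (fdim G a) (fdim G a))" if a: "a \<in> factors G" for a
  proof (rule factor_gradient_eq(1)[where G = G and mVF = mVF and \<Lambda> = \<Lambda> and \<sigma>F = \<sigma>F and a = a, OF qfg pot a mF _ pF[OF a] bF[OF a]])
    show "hermitian_op (hdim G k) (\<Lambda> k a)" if "k \<in> nbf G a" for k
      using L[of k a] that by (simp add: nbf_def)
    show "\<forall>k\<in>nbf G a. eq_mod_id (hdim G k) (mlog (mVF k a) + \<Lambda> k a) (0\<^sub>m (hdim G k) (hdim G k))"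
    proof
      fix k assume "k \<in> nbf G a"
      then have "mlog (mVF k a) \<in> carrier_mat (hdim G k) (hdim G k)"
        using hermitian_opD(1)[OF mlog_hermitian[OF mF]] by blast
      then have "mlog (mVF k a) + \<Lambda> k a = 0\<^sub>m (hdim G k) (hdim G k)" unfolding \<Lambda>_def by auto
      then show "eq_mod_id (hdim G k) (mlog (mVF k a) + \<Lambda> k a) (0\<^sub>m (hdim G k) (hdim G k))"
        using eq_mod_id_refl[OF zero_carrier_mat] by simp
    qed
  qed
  moreover have "eq_mod_id (hdim G i) (vertex_gradient G \<Lambda> \<sigma>V i) (0\<^sub>m (hdim G i) (hdim G i))"
    if i: "i \<in> verts G" for i
    unfolding vertex_gradient_def \<Lambda>_def
  proof (rule node_update_imp_stationary[where Q = "\<lambda>a. mlog (mFV a i)", OF finite_nbv[OF qfg]])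
    show "mlog (\<sigma>V i) \<in> carrier_mat (hdim G i) (hdim G i)"
      by (rule hermitian_opD(1)[OF mlog_hermitian[OF pV[OF i]]])
    show "mlog (mVF i a) \<in> carrier_mat (hdim G i) (hdim G i)" if "a \<in> nbv G i" for a
      using hermitian_opD(1)[OF mlog_hermitian[OF m(2)]] that by (simp add: nbv_def)
    show "eq_mod_id (hdim G i) (mlog (\<sigma>V i)) (msum (hdim G i) (\<lambda>a. mlog (mFV a i)) (nbv G i))"
      using node_belief_iff[of "nbv G i" "hdim G i" "\<lambda>a. mFV a i" "\<sigma>V i"] mV finite_nbv[OF qfg] pV[OF i] bV[OF i] by blast
    show "eq_mod_id (hdim G i) (mlog (mFV a i)) (mlog (\<sigma>V i) - mlog (mVF i a))" if "a \<in> nbv G i" for a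
      using Q that by (simp add: nbv_def)
  qed
  ultimately have "\<exists>\<kappa> \<nu>. lagrangian_stationary G \<kappa> \<nu> \<Lambda> \<sigma>F \<sigma>V"
    using exists_stationary_iff[where G = G and \<Lambda> = \<Lambda> and \<sigma>F = \<sigma>F and \<sigma>V = \<sigma>V, OF qfg pot pF pV L] by blast
  then show ?thesis
    unfolding interior_stationary_def local_consistent_def using dens consistent pF pV L by blast
qed

section \<open>Messages reconstructed from an interior stationary point\<close>

context
  fixes \<sigma>F :: "'f \<Rightarrow> complex mat" and \<sigma>V :: "'v \<Rightarrow> complex mat"
  assumes int: "interior_stationary G \<sigma>F \<sigma>V"
begin

lemma interior_posdef:
  shows "a \<in> factors G \<Longrightarrow> posdef_op (fdim G a) (\<sigma>F a)"
    and "i \<in> verts G \<Longrightarrow> posdef_op (hdim G i) (\<sigma>V i)"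
  using int unfolding interior_stationary_def by auto

lemma interior_consistent:
  "(i, a) \<in> edges G \<Longrightarrow> ptrace (hdim G) (nbf G a) i (\<sigma>F a) = \<sigma>V i"
  using int unfolding interior_stationary_def local_consistent_def by auto

lemma interior_multipliers:
  "\<exists>\<Lambda>. (\<forall>(i, a)\<in>edges G. hermitian_op (hdim G i) (\<Lambda> i a)) \<and>
    (\<forall>a\<in>factors G. eq_mod_id (fdim G a) (factor_gradient G \<Lambda> \<sigma>F a) (0\<^sub>m (fdim G a) (fdim G a))) \<and>
    (\<forall>i\<in>verts G. eq_mod_id (hdim G i) (vertex_gradient G \<Lambda> \<sigma>V i) (0\<^sub>m (hdim G i) (hdim G i)))"
proof -
  obtain \<kappa> \<nu> \<Lambda> where L: "\<forall>(i, a)\<in>edges G. hermitian_op (hdim G i) (\<Lambda> i a)"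
    and st: "lagrangian_stationary G \<kappa> \<nu> \<Lambda> \<sigma>F \<sigma>V"
    using int unfolding interior_stationary_def by blast
  have L': "hermitian_op (hdim G i) (\<Lambda> i a)" if "(i, a) \<in> edges G" for i a
    using L that by blast
  show ?thesis
    using exists_stationary_iff[where G = G and \<Lambda> = \<Lambda> and \<sigma>F = \<sigma>F and \<sigma>V = \<sigma>V,
      OF qfg pot interior_posdef(1,2) L'] L st by blast
qed

lemma interior_factor_update_iff:
  assumes msg: "messages G mVF mFV" and bel: "bp_beliefs G mVF mFV \<sigma>F \<sigma>V" and e: "(i, a) \<in> edges G"
  shows "mFV a i \<propto>\<^sub>+ ptrace (hdim G) (nbf G a) i (pot G a \<star> tensor_op (hdim G) (nbf G a) (\<lambda>k. mVF k a)) \<star> minv (mVF i a) \<longleftrightarrow>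
      mVF i a \<propto>\<^sub>+ big_star (hdim G i) (\<lambda>c. mFV c i) (nbv G i - {a})"
proof -
  note m = messagesD[OF msg]
  have i: "i \<in> verts G" and a: "a \<in> factors G" and inb: "i \<in> nbf G a" "a \<in> nbv G i"
    using edge_vert[OF qfg e] edge_factor[OF qfg e] e by (auto simp: nbf_def nbv_def)
  have mF: "posdef_op (hdim G k) (mVF k a)" if "k \<in> nbf G a" for k
    using m(2)[of k a] that by (simp add: nbf_def)
  have mV: "posdef_op (hdim G i) (mFV c i)" if "c \<in> nbv G i" for c
    using m(4)[of i c] that by (simp add: nbv_def)
  have bF: "\<sigma>F a \<propto>\<^sub>+ pot G a \<star> big_star (fdim G a) (\<lambda>i. embed_op (hdim G) (nbf G a) i (mVF i a)) (nbf G a)"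
    and bV: "\<sigma>V i \<propto>\<^sub>+ big_star (hdim G i) (\<lambda>a. mFV a i) (nbv G i)"
    using bel a i unfolding bp_beliefs_def by blast+
  show ?thesis
    using factor_update_iff[where G = G and mVF = mVF and a = a and i = i, OF qfg pot a mF bF inb(1) m(4)[OF e]]
      node_updates[OF i interior_posdef(2)[OF i] mV bV inb(2) m(2)[OF e]]
    unfolding interior_consistent[OF e] by blast
qed

lemma interior_updates_equivalent:
  assumes msg: "messages G mVF mFV" and bel: "bp_beliefs G mVF mFV \<sigma>F \<sigma>V"
  shows "bp_factor_to_var G mVF mFV \<longleftrightarrow> bp_var_to_factor G mVF mFV"
  unfolding bp_factor_to_var_def bp_var_to_factor_def
  using interior_factor_update_iff[OF msg bel] by fast

text \<open>The factor beliefs force the multipliers to agree with \<open>- mlog (mVF i a)\<close>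
  modulo the identity, so stationarity at a variable becomes an equation for the given messages. New
  \<open>mFV\<close> are defined by the equation that both updates express, and the stationarity
  equation is what makes their star product the variable belief.\<close>

lemma interior_complete_messages:
  fixes mVF
  assumes m: "\<And>i a. (i, a) \<in> edges G \<Longrightarrow> density_op (hdim G i) (mVF i a) \<and> posdef_op (hdim G i) (mVF i a)"
    and bF: "\<And>a. a \<in> factors G \<Longrightarrow>
      \<sigma>F a \<propto>\<^sub>+ pot G a \<star> big_star (fdim G a) (\<lambda>i. embed_op (hdim G) (nbf G a) i (mVF i a)) (nbf G a)"
  shows "\<exists>mFV. messages G mVF mFV \<and> bp_beliefs G mVF mFV \<sigma>F \<sigma>V \<and> bp_fixed_point G mVF mFV"
proof -
  obtain \<Lambda> where "\<forall>(i, a)\<in>edges G. hermitian_op (hdim G i) (\<Lambda> i a)"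
    and gF: "\<forall>a\<in>factors G. eq_mod_id (fdim G a) (factor_gradient G \<Lambda> \<sigma>F a) (0\<^sub>m (fdim G a) (fdim G a))"
    and gV: "\<forall>i\<in>verts G. eq_mod_id (hdim G i) (vertex_gradient G \<Lambda> \<sigma>V i) (0\<^sub>m (hdim G i) (hdim G i))"
    using interior_multipliers by blast
  then have L: "hermitian_op (hdim G i) (\<Lambda> i a)" if "(i, a) \<in> edges G" for i a
    using that by blast
  have PL: "eq_mod_id (hdim G i) (mlog (mVF i a) + \<Lambda> i a) (0\<^sub>m (hdim G i) (hdim G i))" if e: "(i, a) \<in> edges G" for i a
  proof -
    have a: "a \<in> factors G" and inb: "i \<in> nbf G a" using edge_factor[OF qfg e] e by (auto simp: nbf_def)
    have "posdef_op (hdim G k) (mVF k a)" "hermitian_op (hdim G k) (\<Lambda> k a)" if "k \<in> nbf G a" for k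
      using m[of k a] L[of k a] that by (auto simp: nbf_def)
    then show ?thesis
      using factor_gradient_eq(2)[where G = G and mVF = mVF and \<Lambda> = \<Lambda> and \<sigma>F = \<sigma>F and a = a, OF qfg pot a _ _ interior_posdef(1)[OF a] bF[OF a] gF[rule_format, OF a]] inb by blast
  qed
  let ?good = "\<lambda>i a q. density_op (hdim G i) q \<and> posdef_op (hdim G i) q \<and>
      eq_mod_id (hdim G i) (mlog q) (mlog (\<sigma>V i) - mlog (mVF i a))"
  \<comment> \<open>The logarithm is prescribed only modulo the identity, so a normalised choice
    exists by \<open>exists_density_with_log\<close>.\<close>
  define mFV where "mFV a i = (SOME q. ?good i a q)" for a i
  have good: "?good i a (mFV a i)" if e: "(i, a) \<in> edges G" for i a
  proof -
    note i = edge_vert[OF qfg e]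
    have "hermitian_op (hdim G i) (mlog (\<sigma>V i) - mlog (mVF i a))"
      using m[OF e] interior_posdef(2)[OF i] by (intro hermitian_minus mlog_hermitian) auto
    then have "\<exists>q. ?good i a q" using exists_density_with_log hdim_pos[OF qfg i] by blast
    then show ?thesis unfolding mFV_def by (rule someI_ex)
  qed
  have msg: "messages G mVF mFV" unfolding messages_def using m good by blast
  have bV: "\<sigma>V i \<propto>\<^sub>+ big_star (hdim G i) (\<lambda>a. mFV a i) (nbv G i)" if i: "i \<in> verts G" for i
  proof -
    have e: "(i, a) \<in> edges G" if "a \<in> nbv G i" for a using that by (simp add: nbv_def)
    have S: "eq_mod_id (hdim G i) (mlog (\<sigma>V i)) (msum (hdim G i) (\<lambda>a. mlog (mFV a i)) (nbv G i))"
    proof (rule stationary_imp_node_belief[where L = "\<Lambda> i" and P = "\<lambda>a. mlog (mVF i a)", OF finite_nbv[OF qfg]])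
      show "mlog (\<sigma>V i) \<in> carrier_mat (hdim G i) (hdim G i)"
        by (rule hermitian_opD(1)[OF mlog_hermitian[OF interior_posdef(2)[OF i]]])
      show "\<Lambda> i a \<in> carrier_mat (hdim G i) (hdim G i)" if "a \<in> nbv G i" for a
        using hermitian_opD(1)[OF L[OF e[OF that]]] .
      show "mlog (mVF i a) \<in> carrier_mat (hdim G i) (hdim G i)" if "a \<in> nbv G i" for a
        using hermitian_opD(1)[OF mlog_hermitian] m[OF e[OF that]] by blast
      show "eq_mod_id (hdim G i) (complex_of_real (real (card (nbv G i)) - 1) \<cdot>\<^sub>m mlog (\<sigma>V i) +
          msum (hdim G i) (\<Lambda> i) (nbv G i)) (0\<^sub>m (hdim G i) (hdim G i))"
        using gV[rule_format, OF i] unfolding vertex_gradient_def .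
      show "eq_mod_id (hdim G i) (mlog (mVF i a) + \<Lambda> i a) (0\<^sub>m (hdim G i) (hdim G i))" if "a \<in> nbv G i" for a
        by (rule PL[OF e[OF that]])
      show "eq_mod_id (hdim G i) (mlog (mFV a i)) (mlog (\<sigma>V i) - mlog (mVF i a))" if "a \<in> nbv G i" for a
        using good[OF e[OF that]] by blast
    qed
    have "posdef_op (hdim G i) (mFV a i)" if "a \<in> nbv G i" for a
      using good[OF e[OF that]] by (elim conjE)
    then show ?thesis
      by (rule node_belief_iff[of "nbv G i" "hdim G i" "\<lambda>a. mFV a i" "\<sigma>V i", THEN iffD2])
        (simp_all add: finite_nbv[OF qfg] interior_posdef(2)[OF i] S)
  qed
  have bel: "bp_beliefs G mVF mFV \<sigma>F \<sigma>V" unfolding bp_beliefs_def using bF bV by blast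
  have "mVF i a \<propto>\<^sub>+ big_star (hdim G i) (\<lambda>c. mFV c i) (nbv G i - {a})" if e: "(i, a) \<in> edges G" for i a
  proof -
    note i = edge_vert[OF qfg e]
    have "posdef_op (hdim G i) (mFV c i)" if "c \<in> nbv G i" for c
      using good[of i c] that by (simp add: nbv_def)
    moreover have "a \<in> nbv G i" using e by (simp add: nbv_def)
    ultimately show ?thesis
      using node_updates[OF i interior_posdef(2)[OF i] _ bV[OF i], where a = a and p = "mVF i a"] m[OF e] good[OF e] by blast
  qed
  then have "bp_var_to_factor G mVF mFV" unfolding bp_var_to_factor_def by blast
  then have "bp_fixed_point G mVF mFV"
    unfolding bp_fixed_point_def using interior_updates_equivalent[OF msg bel] by blast
  then show ?thesis using msg bel by blast
qed

text \<open>Normalised exponentials of the negated multipliers serve as messages to factors. For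
  them the factor belief is the stationarity equation at the factor, and the opposite messages come
  from \<open>interior_complete_messages\<close>.\<close>

lemma interior_exists_messages:
  "\<exists>mVF mFV. messages G mVF mFV \<and> bp_beliefs G mVF mFV \<sigma>F \<sigma>V \<and> bp_fixed_point G mVF mFV"
proof -
  obtain \<Lambda> where "\<forall>(i, a)\<in>edges G. hermitian_op (hdim G i) (\<Lambda> i a)"
    and gF: "\<forall>a\<in>factors G. eq_mod_id (fdim G a) (factor_gradient G \<Lambda> \<sigma>F a) (0\<^sub>m (fdim G a) (fdim G a))"
    using interior_multipliers by blast
  then have L: "hermitian_op (hdim G i) (\<Lambda> i a)" if "(i, a) \<in> edges G" for i a
    using that by blast
  let ?good = "\<lambda>i a p. density_op (hdim G i) p \<and> posdef_op (hdim G i) p \<and> eq_mod_id (hdim G i) (mlog p) (- \<Lambda> i a)"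
  define mVF where "mVF i a = (SOME p. ?good i a p)" for i a
  have good: "?good i a (mVF i a)" if e: "(i, a) \<in> edges G" for i a
  proof -
    have "\<exists>p. ?good i a p"
      using exists_density_with_log[OF hermitian_uminus[OF L[OF e]] hdim_pos[OF qfg edge_vert[OF qfg e]]] .
    then show ?thesis unfolding mVF_def by (rule someI_ex)
  qed
  have "\<sigma>F a \<propto>\<^sub>+ pot G a \<star> big_star (fdim G a) (\<lambda>i. embed_op (hdim G) (nbf G a) i (mVF i a)) (nbf G a)"
    if a: "a \<in> factors G" for a
  proof (rule factor_gradient_eq(3)[where G = G and mVF = mVF and \<Lambda> = \<Lambda> and \<sigma>F = \<sigma>F and a = a, OF qfg pot a _ _ interior_posdef(1)[OF a] _ gF[rule_format, OF a]])
    show "posdef_op (hdim G k) (mVF k a)" "hermitian_op (hdim G k) (\<Lambda> k a)" if "k \<in> nbf G a" for k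
      using good[of k a] L[of k a] that by (auto simp: nbf_def)
    show "\<forall>k\<in>nbf G a. eq_mod_id (hdim G k) (mlog (mVF k a) + \<Lambda> k a) (0\<^sub>m (hdim G k) (hdim G k))"
    proof
      fix k assume "k \<in> nbf G a"
      then have e: "(k, a) \<in> edges G" by (simp add: nbf_def)
      have c: "\<Lambda> k a \<in> carrier_mat (hdim G k) (hdim G k)" by (rule hermitian_opD(1)[OF L[OF e]])
      have "eq_mod_id (hdim G k) (mlog (mVF k a) + \<Lambda> k a) (- \<Lambda> k a + \<Lambda> k a)"
        using good[OF e] c by (intro eq_mod_id_add eq_mod_id_refl) auto
      then show "eq_mod_id (hdim G k) (mlog (mVF k a) + \<Lambda> k a) (0\<^sub>m (hdim G k) (hdim G k))"
        using c by simp
    qed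
  qed
  then show ?thesis using interior_complete_messages[of mVF] good by blast
qed

end

end

text \<open>The shape of the converse reflects the freedom that \<open>bp_beliefs\<close> leaves in
  \<open>mFV\<close>: it asserts what beliefs determine, and for the given \<open>mFV\<close> it
  takes one update as the missing information. In the first part \<open>density_family\<close> fixes
  the scalars that \<open>bp_beliefs\<close> leaves open; in the converse normalisation is contained
  in \<open>interior_stationary\<close>.\<close>

theorem theorem3p22:
  fixes G :: "('v, 'f) qfg"
  assumes "quantum_factor_graph G"
    and "\<forall>a \<in> factors G. posdef_op (fdim G a) (pot G a)"
  shows
    "(\<forall>mVF mFV \<sigma>F \<sigma>V.
        messages G mVF mFV \<longrightarrow> bp_fixed_point G mVF mFV \<longrightarrow>
        density_family G \<sigma>F \<sigma>V \<longrightarrow> bp_beliefs G mVF mFV \<sigma>F \<sigma>V \<longrightarrow>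
        interior_stationary G \<sigma>F \<sigma>V)
     \<and>
     (\<forall>\<sigma>F \<sigma>V. interior_stationary G \<sigma>F \<sigma>V \<longrightarrow>
        (\<exists>mVF mFV. messages G mVF mFV \<and> bp_beliefs G mVF mFV \<sigma>F \<sigma>V \<and> bp_fixed_point G mVF mFV)
        \<and>
        (\<forall>mVF mFV. messages G mVF mFV \<longrightarrow> bp_beliefs G mVF mFV \<sigma>F \<sigma>V \<longrightarrow>
           (\<exists>mFV'. messages G mVF mFV' \<and> bp_beliefs G mVF mFV' \<sigma>F \<sigma>V \<and>
                   bp_fixed_point G mVF mFV')
           \<and>
           (bp_var_to_factor G mVF mFV \<or> bp_factor_to_var G mVF mFV \<longrightarrow>
              bp_fixed_point G mVF mFV)))"
proof -
  note qfg = assms(1) and pot = assms(2)[rule_format]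
  show ?thesis
  proof (intro conjI allI impI)
    fix mVF mFV \<sigma>F \<sigma>V
    assume "messages G mVF mFV" "bp_fixed_point G mVF mFV" "density_family G \<sigma>F \<sigma>V" "bp_beliefs G mVF mFV \<sigma>F \<sigma>V"
    then show "interior_stationary G \<sigma>F \<sigma>V"
      using fixed_point_imp_interior_stationary[OF qfg pot] by simp
  next
    fix \<sigma>F \<sigma>V assume "interior_stationary G \<sigma>F \<sigma>V"
    then show "\<exists>mVF mFV. messages G mVF mFV \<and> bp_beliefs G mVF mFV \<sigma>F \<sigma>V \<and> bp_fixed_point G mVF mFV"
      using interior_exists_messages[OF qfg pot] by simp
  next
    fix \<sigma>F \<sigma>V mVF mFV
    assume int: "interior_stationary G \<sigma>F \<sigma>V" and msg: "messages G mVF mFV" and bel: "bp_beliefs G mVF mFV \<sigma>F \<sigma>V"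
    show "\<exists>mFV'. messages G mVF mFV' \<and> bp_beliefs G mVF mFV' \<sigma>F \<sigma>V \<and> bp_fixed_point G mVF mFV'"
      using msg bel unfolding bp_beliefs_def
      by (intro interior_complete_messages[OF qfg pot int, unfolded bp_beliefs_def]) (auto dest: messagesD)
    assume "bp_var_to_factor G mVF mFV \<or> bp_factor_to_var G mVF mFV"
    then show "bp_fixed_point G mVF mFV"
      unfolding bp_fixed_point_def using interior_updates_equivalent[OF qfg pot int msg bel] by blast
  qed
qed

end
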